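(* Let $k\ge2$, $r\ge0$, and let $f_h\in\mathcal G_h^k$, $\mathbf E_h,\mathbf B_h\in\mathcal U_h^r$ be a solution of the semi-discrete discontinuous Galerkin scheme for the Vlasov–Maxwell system described in the context, with the upwind numerical fluxes for both the Vlasov and the Maxwell parts. Then $$\frac{d}{dt}\left(\int_{\mathcal T_h}f_h|\xi|^2\,d\mathbf x\,d\xi+\int_{\mathcal T_h^x}\big(|\mathbf E_h|^2+|\mathbf B_h|^2\big)\,d\mathbf x\right)+\Theta_{h,2}(t)+\Theta_{h,3}(t)=0,$$ with $$\Theta_{h,2}(t)=\int_{\mathcal E_x}\big(|[\mathbf E_h]_\tau|^2+|[\mathbf B_h]_\tau|^2\big)\,ds_x,\qquad \Theta_{h,3}(t)=\int_{\mathcal T_h^x}\int_{\mathcal E_\xi^b}f_h|\xi|^2\max\big((\mathbf E_h+\xi\times\mathbf B_h)\cdot\mathbf n_\xi,\,0\big)\,ds_\xi\,d\mathbf x .$$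
   Context: Domain and mesh. $d_x=d_\xi=3$, $\Omega_x=(-L_x,L_x]^{3}$ with periodic boundary conditions in $\mathbf x$, $\Omega_\xi=[-L_\xi,L_\xi]^{3}$, $\Omega=\Omega_x\times\Omega_\xi$. $\mathcal T_h^x=\{K_x\}$ and $\mathcal T_h^\xi=\{K_\xi\}$ are partitions of $\Omega_x$ and $\Omega_\xi$ into (rotated) Cartesian elements or simplices, and $\mathcal T_h=\{K_x\times K_\xi\}$ is the product partition of $\Omega$. $\mathcal E_x$, $\mathcal E_\xi$ are the sets of edges (faces) of $\mathcal T_h^x$, $\mathcal T_h^\xi$; periodicity is taken into account in $\mathcal E_x$ (so every edge of $\mathcal E_x$ is shared by two elements), and $\mathcal E_\xi=\mathcal E_\xi^i\cup\mathcal E_\xi^b$ with $\mathcal E_\xi^i$ interior and $\mathcal E_\xi^b$ boundary edges. Integrals over $\mathcal T_h,\mathcal T_h^x,\mathcal T_h^\xi,\mathcal E_x,\mathcal E_\xi,\mathcal E_\xi^b$ are sums of integrals over the elements/edges in the set. $\mathbf n_x$, $\mathbf n_\xi$ are unit normals (outward on element boundaries and on $\mathcal E_\xi^b$). Discrete spaces ($P^m(D)$: polynomials of total degree at most $m$ on $D$). $\mathcal G_h^k=\{g\in L^2(\Omega): g|_K\in P^k(K)\ \forall K\in\mathcal T_h\}$, $\mathcal U_h^r=\{\mathbf U\in[L^2(\Omega_x)]^3: \mathbf U|_{K_x}\in[P^r(K_x)]^3\ \forall K_x\in\mathcal T_h^x\}$, with integers $k,r\ge0$. Jumps and averages. For an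 edge $e=K_x^+\cap K_x^-\in\mathcal E_x$ with outward unit normals $\mathbf n_x^\pm$ to $\partial K_x^\pm$, and traces $g^\pm,\mathbf U^\pm$ from $K_x^\pm$: $[g]_x=g^+\mathbf n_x^++g^-\mathbf n_x^-$, $[\mathbf U]_x=\mathbf U^+\cdot\mathbf n_x^++\mathbf U^-\cdot\mathbf n_x^-$, $[\mathbf U]_\tau=\mathbf U^+\times\mathbf n_x^++\mathbf U^-\times\mathbf n_x^-$, $\{g\}_x=\frac12(g^++g^-)$, $\{\mathbf U\}_x=\frac12(\mathbf U^++\mathbf U^-)$. The quantities $[\cdot]_\xi,\{\cdot\}_\xi$ on $\mathcal E_\xi^i$ are defined analogously; on $\mathcal E_\xi^b$ with outward unit normal $\mathbf n_\xi$: $[g]_\xi=g\,\mathbf n_\xi$, $\{g\}_\xi=\frac12 g$, $\{\mathbf U\}_\xi=\frac12\mathbf U$. Scheme. Find time-dependent $f_h\in\mathcal G_h^k$, $\mathbf E_h,\mathbf B_h\in\mathcal U_h^r$ such that for all $g\in\mathcal G_h^k$, $\mathbf U,\mathbf V\in\mathcal U_h^r$: $a_h(f_h,\mathbf E_h,\mathbf B_h;g)=0$ and $b_h(\mathbf E_h,\mathbf B_h;\mathbf U,\mathbf V)=l_h(\mathbf J_h;\mathbf U)$, where $\mathbf J_h(\mathbf x,t)=\int_{\mathcal T_h^\xi} f_h\,\xi\,d\xi$, $l_h(\mathbf J_h;\mathbf U)=-\int_{\mathcal T_h^x}\mathbf J_h\cdot\mathbf U\,d\mathbf x$, $$a_h=\int_{\mathcal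 T_h}\partial_tf_h\,g\,d\mathbf xd\xi-\int_{\mathcal T_h}f_h\,\xi\cdot\nabla_{\mathbf x}g\,d\mathbf xd\xi+\int_{\mathcal T_h^\xi}\int_{\mathcal E_x}\widetilde{f_h\xi}\cdot[g]_x\,ds_xd\xi-\int_{\mathcal T_h}f_h(\mathbf E_h+\xi\times\mathbf B_h)\cdot\nabla_\xi g\,d\mathbf xd\xi+\int_{\mathcal T_h^x}\int_{\mathcal E_\xi}\widetilde{f_h(\mathbf E_h+\xi\times\mathbf B_h)}\cdot[g]_\xi\,ds_\xi d\mathbf x,$$ $$b_h=\int_{\mathcal T_h^x}\partial_t\mathbf E_h\cdot\mathbf U\,d\mathbf x-\int_{\mathcal T_h^x}\mathbf B_h\cdot\nabla\times\mathbf U\,d\mathbf x-\int_{\mathcal E_x}\widetilde{\mathbf B_h}\cdot[\mathbf U]_\tau ds_x+\int_{\mathcal T_h^x}\partial_t\mathbf B_h\cdot\mathbf V\,d\mathbf x+\int_{\mathcal T_h^x}\mathbf E_h\cdot\nabla\times\mathbf V\,d\mathbf x+\int_{\mathcal E_x}\widetilde{\mathbf E_h}\cdot[\mathbf V]_\tau ds_x.$$ Upwind flux for the Vlasov part: $\widetilde{f_h\xi}=\{f_h\xi\}_x+\frac{|\xi\cdot\mathbf n_x|}{2}[f_h]_x$, $\ \widetilde{f_h(\mathbf E_h+\xi\times\mathbf B_h)}=\{f_h(\mathbf E_h+\xi\times\mathbf B_h)\}_\xi+\frac{|(\mathbf E_h+\xi\times\mathbf B_h)\cdot\mathbf n_\xi|}{2}[f_h]_\xi$.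 Upwind flux for the Maxwell part: $\widetilde{\mathbf E_h}=\{\mathbf E_h\}_x+\frac12[\mathbf B_h]_\tau$, $\widetilde{\mathbf B_h}=\{\mathbf B_h\}_x-\frac12[\mathbf E_h]_\tau$. *)

theory Defs
  imports "HOL-Analysis.Analysis"
begin

section \<open>Meshes\<close>

definition cartesian_element :: "(real^3) set \<Rightarrow> bool" where
  "cartesian_element K \<longleftrightarrow>
     (\<exists>(Q :: real^3^3) a b. rotation_matrix Q \<and> (\<forall>i. a $ i < b $ i) \<and> K = (\<lambda>x. Q *v x) ` cbox a b)"

text \<open>Elements are closed sets. Neighbouring elements need not share a whole face, so hanging
  nodes are allowed.\<close>

definition is_mesh :: "(real^3) set \<Rightarrow> (real^3) set set \<Rightarrow> bool" where
  "is_mesh D T \<longleftrightarrow>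
     finite T \<and> (\<forall>K\<in>T. cartesian_element K \<or> 3 simplex K) \<and> \<Union>T = D \<and>
     pairwise (\<lambda>K K'. interior K \<inter> interior K' = {}) T"

definition closed_cube :: "real \<Rightarrow> (real^3) set" where
  "closed_cube L = {x. \<forall>i. - L \<le> x $ i \<and> x $ i \<le> L}"

definition periodic_cell :: "real \<Rightarrow> (real^3) set" where
  "periodic_cell L = {x. \<forall>i. - L < x $ i \<and> x $ i \<le> L}"

definition product_mesh :: "(real^3) set set \<Rightarrow> (real^3) set set \<Rightarrow> ((real^3) \<times> (real^3)) set set" where
  "product_mesh Tx T\<xi> = {Kx \<times> K\<xi> | Kx K\<xi>. Kx \<in> Tx \<and> K\<xi> \<in> T\<xi>}"

definition period_lattice :: "real \<Rightarrow> (real^3) set" where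
  "period_lattice L = {s. \<forall>i. \<exists>m::int. s $ i = 2 * L * of_int m}"

definition periodic_mesh :: "real \<Rightarrow> (real^3) set set \<Rightarrow> (real^3) set set" where
  "periodic_mesh L T = {(\<lambda>x. x + s) ` K | s K. s \<in> period_lattice L \<and> K \<in> T}"

section \<open>Edges\<close>

definition interior_edges :: "(real^3) set set \<Rightarrow> (real^3) set set" where
  "interior_edges T = {K \<inter> K' | K K'. K \<in> T \<and> K' \<in> T \<and> K \<noteq> K' \<and> aff_dim (K \<inter> K') = 2}"

definition boundary_edges :: "(real^3) set \<Rightarrow> (real^3) set set \<Rightarrow> (real^3) set set" where
  "boundary_edges D T = {K \<inter> F | K F. K \<in> T \<and> F facet_of D \<and> aff_dim (K \<inter> F) = 2}"

text \<open>A boundary face of the cube and its translates by periods are one and the same edge. The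
  representative on a plane \<open>x $ i = L\<close> meets the half-open cell; the one on \<open>x $ i = - L\<close> does not.
  A two-dimensional edge inside the closed cube that lies in no boundary plane always meets it.\<close>

definition periodic_edges :: "real \<Rightarrow> (real^3) set set \<Rightarrow> (real^3) set set" where
  "periodic_edges L T = {K \<inter> K' | K K'. K \<in> T \<and> K' \<in> periodic_mesh L T \<and> K \<noteq> K' \<and>
     aff_dim (K \<inter> K') = 2 \<and> K \<inter> K' \<inter> periodic_cell L \<noteq> {}}"

definition sides :: "(real^3) set set \<Rightarrow> (real^3) set \<Rightarrow> (real^3) set set" where
  "sides T e = {K \<in> T. e \<subseteq> K}"

definition outer_normal :: "(real^3) set \<Rightarrow> (real^3) set \<Rightarrow> real^3" where
  "outer_normal K e = (THE n. norm n = 1 \<and> (\<forall>x\<in>e. \<forall>y\<in>K. n \<bullet> (y - x) \<le> 0))"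

text \<open>The sign of this normal is unspecified; it is only used under an absolute value.\<close>

definition edge_normal :: "(real^3) set \<Rightarrow> real^3" where
  "edge_normal e = (SOME n. norm n = 1 \<and> (\<forall>x\<in>e. \<forall>y\<in>e. n \<bullet> (y - x) = 0))"

section \<open>Integrals over elements and edges\<close>

definition mesh_integral :: "'a::euclidean_space set set \<Rightarrow> ('a \<Rightarrow> 'b) \<Rightarrow> 'b::{banach, second_countable_topology}" where
  "mesh_integral T F = (\<Sum>K\<in>T. set_lebesgue_integral lebesgue K F)"

text \<open>Edges are flat, so the surface integral is the planar Lebesgue integral in an isometric
  parametrization of the plane; its value does not depend on the parametrization chosen.\<close>

definition plane_chart :: "(real^3) set \<Rightarrow> real^2 \<Rightarrow> real^3" where
  "plane_chart e = (SOME \<phi>. (\<forall>u v. dist (\<phi> u) (\<phi> v) = dist u v) \<and> e \<subseteq> range \<phi>)"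

definition surface_integral :: "(real^3) set \<Rightarrow> (real^3 \<Rightarrow> real) \<Rightarrow> real" where
  "surface_integral e F =
     set_lebesgue_integral lebesgue (plane_chart e -` e) (\<lambda>u. F (plane_chart e u))"

definition edge_integral :: "(real^3) set set \<Rightarrow> ((real^3) set \<Rightarrow> real^3 \<Rightarrow> real) \<Rightarrow> real" where
  "edge_integral Es F = (\<Sum>e\<in>Es. surface_integral e (F e))"

section \<open>Discrete spaces\<close>

definition multi_indices :: "nat \<Rightarrow> ('a::euclidean_space \<Rightarrow> nat) set" where
  "multi_indices m = {\<alpha>. (\<forall>b. b \<notin> Basis \<longrightarrow> \<alpha> b = 0) \<and> (\<Sum>b\<in>Basis. \<alpha> b) \<le> m}"

definition poly_on :: "nat \<Rightarrow> 'a::euclidean_space set \<Rightarrow> ('a \<Rightarrow> real) \<Rightarrow> bool" where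
  "poly_on m D u \<longleftrightarrow>
     (\<exists>c. \<forall>x\<in>D. u x = (\<Sum>\<alpha>\<in>multi_indices m. c \<alpha> * (\<Prod>b\<in>Basis. (x \<bullet> b) ^ \<alpha> b)))"

text \<open>Functions on the periodic domain are represented by periodic functions on the whole space.
  Values on element boundaries, a null set, are left unconstrained, since square-integrable
  functions are only determined almost everywhere; membership in the Lebesgue space is automatic.\<close>

definition G_space :: "real \<Rightarrow> (real^3) set set \<Rightarrow> (real^3) set set \<Rightarrow> nat \<Rightarrow> ((real^3) \<times> (real^3) \<Rightarrow> real) set" where
  "G_space Lx Tx T\<xi> k = {g. (\<forall>x \<xi>. \<forall>s\<in>period_lattice Lx. g (x + s, \<xi>) = g (x, \<xi>)) \<and>
     (\<forall>K\<in>product_mesh Tx T\<xi>. poly_on k (interior K) g)}"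

definition U_space :: "real \<Rightarrow> (real^3) set set \<Rightarrow> nat \<Rightarrow> (real^3 \<Rightarrow> real^3) set" where
  "U_space Lx Tx r = {U. (\<forall>x. \<forall>s\<in>period_lattice Lx. U (x + s) = U x) \<and>
     (\<forall>K\<in>Tx. \<forall>i. poly_on r (interior K) (\<lambda>x. U x $ i))}"

section \<open>Differential operators\<close>

definition grad :: "(real^3 \<Rightarrow> real) \<Rightarrow> real^3 \<Rightarrow> real^3" where
  "grad u x = (THE D. GDERIV u x :> D)"

definition curl :: "(real^3 \<Rightarrow> real^3) \<Rightarrow> real^3 \<Rightarrow> real^3" where
  "curl U x = (let D = jacobian U (at x) in
     vector [D $ 3 $ 2 - D $ 2 $ 3, D $ 1 $ 3 - D $ 3 $ 1, D $ 2 $ 1 - D $ 1 $ 2])"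

section \<open>Traces, jumps and averages\<close>

definition elem_trace :: "(real^3) set \<Rightarrow> (real^3 \<Rightarrow> 'b::real_normed_vector) \<Rightarrow> real^3 \<Rightarrow> 'b" where
  "elem_trace K u x = Lim (at x within interior K) u"

text \<open>The sums run over the elements adjacent to \<open>e\<close>: the two elements \<open>K\<^sup>+\<close>, \<open>K\<^sup>-\<close> for an
  interior or periodic edge (taking \<open>T\<close> to be the periodic mesh in the latter case), and the single
  element for a boundary edge. The latter gives the boundary conventions, namely the jump is
  \<open>g n\<close> and the average \<open>g / 2\<close>.\<close>

definition jump :: "(real^3) set set \<Rightarrow> (real^3) set \<Rightarrow> (real^3 \<Rightarrow> real) \<Rightarrow> real^3 \<Rightarrow> real^3" where
  "jump T e u x = (\<Sum>K\<in>sides T e. elem_trace K u x *\<^sub>R outer_normal K e)"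

definition tjump :: "(real^3) set set \<Rightarrow> (real^3) set \<Rightarrow> (real^3 \<Rightarrow> real^3) \<Rightarrow> real^3 \<Rightarrow> real^3" where
  "tjump T e U x = (\<Sum>K\<in>sides T e. cross3 (elem_trace K U x) (outer_normal K e))"

definition avg :: "(real^3) set set \<Rightarrow> (real^3) set \<Rightarrow> (real^3 \<Rightarrow> 'b::real_normed_vector) \<Rightarrow> real^3 \<Rightarrow> 'b" where
  "avg T e u x = (1/2) *\<^sub>R (\<Sum>K\<in>sides T e. elem_trace K u x)"

section \<open>The semi-discrete scheme\<close>

text \<open>Upwind flux for transport of \<open>u\<close> by the continuous velocity \<open>\<beta>\<close>.\<close>

definition upwind_flux ::
  "(real^3) set set \<Rightarrow> (real^3) set \<Rightarrow> (real^3 \<Rightarrow> real) \<Rightarrow> (real^3 \<Rightarrow> real^3) \<Rightarrow> real^3 \<Rightarrow> real^3" where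
  "upwind_flux T e u \<beta> y =
     avg T e (\<lambda>z. u z *\<^sub>R \<beta> z) y + (\<bar>\<beta> y \<bullet> edge_normal e\<bar> / 2) *\<^sub>R jump T e u y"

definition E_flux ::
  "(real^3) set set \<Rightarrow> (real^3) set \<Rightarrow> (real^3 \<Rightarrow> real^3) \<Rightarrow> (real^3 \<Rightarrow> real^3) \<Rightarrow> real^3 \<Rightarrow> real^3" where
  "E_flux T e E B x = avg T e E x + (1/2) *\<^sub>R tjump T e B x"

definition B_flux ::
  "(real^3) set set \<Rightarrow> (real^3) set \<Rightarrow> (real^3 \<Rightarrow> real^3) \<Rightarrow> (real^3 \<Rightarrow> real^3) \<Rightarrow> real^3 \<Rightarrow> real^3" where
  "B_flux T e E B x = avg T e B x - (1/2) *\<^sub>R tjump T e E x"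

definition current :: "(real^3) set set \<Rightarrow> ((real^3) \<times> (real^3) \<Rightarrow> real) \<Rightarrow> real^3 \<Rightarrow> real^3" where
  "current T\<xi> f x = mesh_integral T\<xi> (\<lambda>\<xi>. f (x, \<xi>) *\<^sub>R \<xi>)"

definition l_form :: "(real^3) set set \<Rightarrow> (real^3 \<Rightarrow> real^3) \<Rightarrow> (real^3 \<Rightarrow> real^3) \<Rightarrow> real" where
  "l_form Tx J U = - mesh_integral Tx (\<lambda>x. J x \<bullet> U x)"

text \<open>The argument \<open>f'\<close> stands for the time derivative of \<open>f\<close>; likewise \<open>E'\<close>, \<open>B'\<close> below.\<close>

definition a_form ::
  "real \<Rightarrow> real \<Rightarrow> (real^3) set set \<Rightarrow> (real^3) set set \<Rightarrow>
   ((real^3) \<times> (real^3) \<Rightarrow> real) \<Rightarrow> ((real^3) \<times> (real^3) \<Rightarrow> real) \<Rightarrow>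
   (real^3 \<Rightarrow> real^3) \<Rightarrow> (real^3 \<Rightarrow> real^3) \<Rightarrow> ((real^3) \<times> (real^3) \<Rightarrow> real) \<Rightarrow> real" where
  "a_form Lx L\<xi> Tx T\<xi> f' f E B g =
     (let Th = product_mesh Tx T\<xi>;
          Tp = periodic_mesh Lx Tx;
          Ex = periodic_edges Lx Tx;
          E\<xi> = interior_edges T\<xi> \<union> boundary_edges (closed_cube L\<xi>) T\<xi>
      in mesh_integral Th (\<lambda>z. f' z * g z)
       - mesh_integral Th (\<lambda>(x, \<xi>). f (x, \<xi>) * (\<xi> \<bullet> grad (\<lambda>y. g (y, \<xi>)) x))
       + mesh_integral T\<xi> (\<lambda>\<xi>. edge_integral Ex (\<lambda>e x.
           upwind_flux Tp e (\<lambda>y. f (y, \<xi>)) (\<lambda>y. \<xi>) x \<bullet> jump Tp e (\<lambda>y. g (y, \<xi>)) x))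
       - mesh_integral Th (\<lambda>(x, \<xi>).
           f (x, \<xi>) * ((E x + cross3 \<xi> (B x)) \<bullet> grad (\<lambda>\<eta>. g (x, \<eta>)) \<xi>))
       + mesh_integral Tx (\<lambda>x. edge_integral E\<xi> (\<lambda>e \<xi>.
           upwind_flux T\<xi> e (\<lambda>\<eta>. f (x, \<eta>)) (\<lambda>\<eta>. E x + cross3 \<eta> (B x)) \<xi>
             \<bullet> jump T\<xi> e (\<lambda>\<eta>. g (x, \<eta>)) \<xi>)))"

definition b_form ::
  "real \<Rightarrow> (real^3) set set \<Rightarrow> (real^3 \<Rightarrow> real^3) \<Rightarrow> (real^3 \<Rightarrow> real^3) \<Rightarrow>
   (real^3 \<Rightarrow> real^3) \<Rightarrow> (real^3 \<Rightarrow> real^3) \<Rightarrow> (real^3 \<Rightarrow> real^3) \<Rightarrow> (real^3 \<Rightarrow> real^3) \<Rightarrow> real" where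
  "b_form Lx Tx E' B' E B U V =
     (let Tp = periodic_mesh Lx Tx; Ex = periodic_edges Lx Tx
      in mesh_integral Tx (\<lambda>x. E' x \<bullet> U x)
       - mesh_integral Tx (\<lambda>x. B x \<bullet> curl U x)
       - edge_integral Ex (\<lambda>e x. B_flux Tp e E B x \<bullet> tjump Tp e U x)
       + mesh_integral Tx (\<lambda>x. B' x \<bullet> V x)
       + mesh_integral Tx (\<lambda>x. E x \<bullet> curl V x)
       + edge_integral Ex (\<lambda>e x. E_flux Tp e E B x \<bullet> tjump Tp e V x))"

text \<open>On each element the unknowns are polynomials at every time, so differentiability in time of
  their point values is differentiability of their coefficients.\<close>

definition dg_solution ::
  "real \<Rightarrow> real \<Rightarrow> (real^3) set set \<Rightarrow> (real^3) set set \<Rightarrow> nat \<Rightarrow> nat \<Rightarrow> real set \<Rightarrow>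
   (real \<Rightarrow> (real^3) \<times> (real^3) \<Rightarrow> real) \<Rightarrow> (real \<Rightarrow> real^3 \<Rightarrow> real^3) \<Rightarrow> (real \<Rightarrow> real^3 \<Rightarrow> real^3) \<Rightarrow> bool" where
  "dg_solution Lx L\<xi> Tx T\<xi> k r I f E B \<longleftrightarrow>
     (\<forall>t\<in>I.
        f t \<in> G_space Lx Tx T\<xi> k \<and> E t \<in> U_space Lx Tx r \<and> B t \<in> U_space Lx Tx r \<and>
        (\<forall>K\<in>product_mesh Tx T\<xi>. \<forall>z\<in>interior K. (\<lambda>\<tau>. f \<tau> z) differentiable (at t within I)) \<and>
        (\<forall>K\<in>Tx. \<forall>x\<in>interior K. (\<lambda>\<tau>. E \<tau> x) differentiable (at t within I) \<and>
                                 (\<lambda>\<tau>. B \<tau> x) differentiable (at t within I)) \<and>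
        (\<forall>g\<in>G_space Lx Tx T\<xi> k.
           a_form Lx L\<xi> Tx T\<xi> (\<lambda>z. vector_derivative (\<lambda>\<tau>. f \<tau> z) (at t within I))
             (f t) (E t) (B t) g = 0) \<and>
        (\<forall>U\<in>U_space Lx Tx r. \<forall>V\<in>U_space Lx Tx r.
           b_form Lx Tx (\<lambda>x. vector_derivative (\<lambda>\<tau>. E \<tau> x) (at t within I))
             (\<lambda>x. vector_derivative (\<lambda>\<tau>. B \<tau> x) (at t within I)) (E t) (B t) U V
           = l_form Tx (current T\<xi> (f t)) U))"

section \<open>Energy and dissipation\<close>

definition energy ::
  "(real^3) set set \<Rightarrow> (real^3) set set \<Rightarrow> ((real^3) \<times> (real^3) \<Rightarrow> real) \<Rightarrow>
   (real^3 \<Rightarrow> real^3) \<Rightarrow> (real^3 \<Rightarrow> real^3) \<Rightarrow> real" where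
  "energy Tx T\<xi> f E B =
     mesh_integral (product_mesh Tx T\<xi>) (\<lambda>(x, \<xi>). f (x, \<xi>) * (norm \<xi>)\<^sup>2) +
     mesh_integral Tx (\<lambda>x. (norm (E x))\<^sup>2 + (norm (B x))\<^sup>2)"

definition Theta2 :: "real \<Rightarrow> (real^3) set set \<Rightarrow> (real^3 \<Rightarrow> real^3) \<Rightarrow> (real^3 \<Rightarrow> real^3) \<Rightarrow> real" where
  "Theta2 Lx Tx E B = edge_integral (periodic_edges Lx Tx) (\<lambda>e x.
     (norm (tjump (periodic_mesh Lx Tx) e E x))\<^sup>2 + (norm (tjump (periodic_mesh Lx Tx) e B x))\<^sup>2)"

definition boundary_side :: "(real^3) set set \<Rightarrow> (real^3) set \<Rightarrow> (real^3) set" where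
  "boundary_side T e = (THE K. K \<in> sides T e)"

definition Theta3 ::
  "real \<Rightarrow> (real^3) set set \<Rightarrow> (real^3) set set \<Rightarrow> ((real^3) \<times> (real^3) \<Rightarrow> real) \<Rightarrow>
   (real^3 \<Rightarrow> real^3) \<Rightarrow> (real^3 \<Rightarrow> real^3) \<Rightarrow> real" where
  "Theta3 L\<xi> Tx T\<xi> f E B =
     mesh_integral Tx (\<lambda>x. edge_integral (boundary_edges (closed_cube L\<xi>) T\<xi>) (\<lambda>e \<xi>.
       let K = boundary_side T\<xi> e in
       elem_trace K (\<lambda>\<eta>. f (x, \<eta>)) \<xi> * (norm \<xi>)\<^sup>2 *
       max ((E x + cross3 \<xi> (B x)) \<bullet> outer_normal K e) 0))"

end

theory Submission
  imports Defs
begin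

text \<open>Testing the scheme with \<open>g = \<bar>\<xi>\<bar>\<^sup>2\<close> (admissible as \<open>k \<ge> 2\<close>), \<open>U = E\<close> and \<open>V = B\<close> gives the
  energy balance: the terms \<open>\<integral> J \<bullet> E\<close> cancel, \<open>g\<close> is continuous and so only boundary edges contribute to
  the Vlasov flux, and the Maxwell terms reduce to \<open>\<Theta>\<^sub>2\<close> by the divergence theorem for \<open>E \<times> B\<close>.
  Nothing is used about the elements except that they are convex bodies with disjoint interiors: on
  each line parallel to a coordinate axis the fundamental theorem of calculus applies, almost every
  such line enters and leaves an element through the relative interior of one edge each, and every
  edge has exactly two sides, with opposite normals. Periodicity enters through a bijection between
  the pairs of an element of the cell with one of its edges, and the pairs of a periodic edge with
  one of its sides.\<close>

section \<open>Convex bodies and null sets\<close>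

text \<open>Values on element boundaries are unconstrained, so integrands are known only in
  interiors. There they agree with global polynomials, and completeness of \<open>lebesgue\<close>
  makes the rest harmless. \<open>plane_chart\<close> is an arbitrary choice, so the chart of an
  edge and that of its translate by a period are unrelated. Surface integrals are therefore compared
  through their projections to a coordinate plane. With hanging nodes an edge need not be a face of
  either element. It is a two-dimensional contact set, and its normals come from supporting
  hyperplanes. Only point values are given as differentiable in time. Finitely many nodes per
  element recover each polynomial, which turns element integrals into finite sums with
  differentiable coefficients. The constants fit because \<bar>\<xi>\<bar>^2 has gradient 2\<xi>:
  the Vlasov part yields twice the integral of J.E, while the Maxwell part carries half the
  derivative of the field energy and half of \<Theta>2, so it is doubled before adding. The magnetic
  force does no work, since \<xi> x B is orthogonal to \<xi>.\<close>

definition convex_body :: "'a::euclidean_space set \<Rightarrow> bool" where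
  "convex_body K \<longleftrightarrow> convex K \<and> compact K \<and> interior K \<noteq> {}"

lemma convex_bodyD:
  assumes "convex_body K"
  shows "convex K" "compact K" "closed K" "bounded K" "interior K \<noteq> {}" "K \<noteq> {}"
  using assms interior_subset[of K]
  by (auto simp: convex_body_def compact_imp_closed compact_imp_bounded)

lemma closure_interior_convex_body:
  "convex_body K \<Longrightarrow> closure (interior K) = K"
  by (simp add: convex_bodyD convex_closure_interior)

lemma convex_body_translation:
  "convex_body K \<Longrightarrow> convex_body ((\<lambda>x. x + s) ` K)"
  unfolding convex_body_def
  using interior_translation[of s K] compact_translation[of K s] convex_translation[of K s]
  by (simp add: add.commute)

lemma convex_body_Times:
  "convex_body K \<Longrightarrow> convex_body L \<Longrightarrow> convex_body (K \<times> L)"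
  by (auto simp: convex_body_def interior_Times convex_Times compact_Times)

lemma convex_body_cartesian_element:
  assumes "cartesian_element K"
  shows "convex_body K"
proof -
  obtain Q :: "real^3^3" and a b where Q: "rotation_matrix Q" and ab: "\<And>i. a $ i < b $ i"
    and K: "K = (\<lambda>x. Q *v x) ` cbox a b"
    using assms unfolding cartesian_element_def by blast
  have lin: "linear ((*v) Q)" by simp
  have inj: "inj ((*v) Q)"
    using Q by (intro inj_matrix_vector_mult) (simp add: rotation_matrix_def invertible_det_nz)
  have "box a b \<noteq> {}" using ab by (auto simp: interval_ne_empty_cart(2))
  then have "interior (cbox a b) \<noteq> {}" by simp
  then have "interior K \<noteq> {}"
    unfolding K using interior_injective_linear_image[OF lin inj] by simp
  moreover have "compact K"
    unfolding K by (intro compact_continuous_image linear_continuous_on compact_cbox) (simp add: linear_linear[symmetric] del: linear_linear)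
  ultimately show ?thesis
    unfolding convex_body_def K by (simp add: convex_linear_image)
qed

lemma convex_body_simplex:
  fixes K :: "(real^3) set"
  assumes "3 simplex K"
  shows "convex_body K"
proof -
  have "convex K" using assms convex_simplex by blast
  moreover have "compact K" using assms by (simp add: simplex_imp_polytope polytope_imp_compact)
  moreover have "aff_dim K = 3" using assms aff_dim_simplex by blast
  moreover have "interior K \<noteq> {}"
  proof -
    have "interior K = rel_interior K" using \<open>aff_dim K = 3\<close> by (simp add: interior_rel_interior)
    moreover have "K \<noteq> {}" using \<open>aff_dim K = 3\<close> by auto
    ultimately show ?thesis using \<open>convex K\<close> by (simp add: rel_interior_eq_empty)
  qed
  ultimately show ?thesis by (simp add: convex_body_def)
qed

lemma convex_body_mesh:
  "is_mesh D T \<Longrightarrow> K \<in> T \<Longrightarrow> convex_body K"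
  using convex_body_cartesian_element convex_body_simplex unfolding is_mesh_def by blast

lemma negligible_diff_interior:
  "convex_body K \<Longrightarrow> negligible (K - interior K)"
  using negligible_convex_frontier[of K] by (simp add: frontier_def convex_bodyD)

text \<open>Every subset of a negligible set is Lebesgue measurable, so \<open>f\<close> and
  \<open>g\<close> are measurable together. If neither is, both integrals have the default value 0.
  Measurability thus never has to be shown for functions that are arbitrary on element
  boundaries.\<close>

lemma integral_AE_cong_lebesgue:
  fixes f g :: "'a::euclidean_space \<Rightarrow> 'b::{banach, second_countable_topology}"
  assumes "negligible N" and "\<And>x. x \<notin> N \<Longrightarrow> f x = g x"
  shows "integral\<^sup>L lebesgue f = integral\<^sup>L lebesgue g"
proof -
  have N: "N \<in> null_sets lebesgue" using assms(1) by (simp add: negligible_iff_null_sets)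
  have meas: "g \<in> borel_measurable lebesgue"
    if "f \<in> borel_measurable lebesgue" "\<And>x. x \<notin> N \<Longrightarrow> f x = g x"
    for f g :: "'a \<Rightarrow> 'b"
  proof (rule measurableI)
    fix A :: "'b set" assume "A \<in> sets borel"
    have "g -` A = (f -` A - N) \<union> (g -` A \<inter> N)" using that(2) by auto
    moreover have "f -` A - N \<in> sets lebesgue"
      using measurable_sets[OF that(1) \<open>A \<in> sets borel\<close>] N by auto
    moreover have "g -` A \<inter> N \<in> sets lebesgue"
    proof -
      have "negligible (g -` A \<inter> N)" by (rule negligible_subset[OF assms(1)]) auto
      then show ?thesis using negligible_imp_sets by blast
    qed
    ultimately show "g -` A \<inter> space lebesgue \<in> sets lebesgue"
      by (metis Int_UNIV_right sets.Un space_completion space_lborel space_borel)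
  qed simp
  show ?thesis
  proof (cases "f \<in> borel_measurable lebesgue")
    case True
    moreover have "g \<in> borel_measurable lebesgue" using meas[OF True] assms(2) by blast
    moreover have "AE x in lebesgue. f x = g x"
      using AE_not_in[OF N] by eventually_elim (use assms(2) in auto)
    ultimately show ?thesis by (rule integral_cong_AE)
  next
    case False
    moreover have "g \<notin> borel_measurable lebesgue" using meas[of g f] assms(2) False by metis
    ultimately show ?thesis
      by (metis borel_measurable_integrable not_integrable_integral_eq)
  qed
qed

lemma set_integral_interior_cong:
  fixes F G :: "'a::euclidean_space \<Rightarrow> 'b::{banach, second_countable_topology}"
  assumes "convex_body K" and "\<And>x. x \<in> interior K \<Longrightarrow> F x = G x"
  shows "set_lebesgue_integral lebesgue K F = set_lebesgue_integral lebesgue K G"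
  unfolding set_lebesgue_integral_def
  by (rule integral_AE_cong_lebesgue[OF negligible_diff_interior[OF assms(1)]])
     (use assms(2) in \<open>auto simp: indicator_def\<close>)

text \<open>Bridge between \<open>lebesgue\<close>, in which the scheme is formulated, and
  \<open>lborel\<close>, in which Fubini and the fundamental theorem of calculus are
  applied.\<close>

lemma set_lebesgue_integral_compact:
  fixes F :: "'a::euclidean_space \<Rightarrow> 'b::{banach, second_countable_topology}"
  assumes "compact K" "continuous_on K F"
  shows "set_integrable lebesgue K F"
    and "set_lebesgue_integral lebesgue K F = set_lebesgue_integral lborel K F"
    and "set_integrable lborel K F"
proof -
  have int: "integrable lborel (\<lambda>x. indicator K x *\<^sub>R F x)"
    by (rule borel_integrable_compact[OF assms])
  then have m: "(\<lambda>x. indicator K x *\<^sub>R F x) \<in> borel_measurable lborel"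
    by (rule borel_measurable_integrable)
  show "set_integrable lebesgue K F"
    using int integrable_completion[OF m] by (simp add: set_integrable_def)
  show "set_lebesgue_integral lebesgue K F = set_lebesgue_integral lborel K F"
    unfolding set_lebesgue_integral_def by (rule integral_completion[OF m])
  show "set_integrable lborel K F" using int by (simp add: set_integrable_def)
qed

section \<open>Planes and normals\<close>

text \<open>The condition under the choice operator in \<open>plane_chart\<close>, named so that the
  chosen chart can be compared with any other.\<close>

definition isometric_chart :: "(real^2 \<Rightarrow> real^3) \<Rightarrow> (real^3) set \<Rightarrow> bool" where
  "isometric_chart \<phi> e \<longleftrightarrow> (\<forall>u v. dist (\<phi> u) (\<phi> v) = dist u v) \<and> e \<subseteq> range \<phi>"

text \<open>Preserved distances give preserved inner products of \<open>\<phi> u - \<phi> 0\<close>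
  by polarization; the squared norm of the linearity defect then expands to 0.\<close>

lemma isometry_affine:
  fixes \<phi> :: "'a::euclidean_space \<Rightarrow> 'b::euclidean_space"
  assumes "\<And>u v. dist (\<phi> u) (\<phi> v) = dist u v"
  shows "linear (\<lambda>u. \<phi> u - \<phi> 0)" and "(\<phi> u - \<phi> 0) \<bullet> (\<phi> v - \<phi> 0) = u \<bullet> v"
proof -
  define g where "g = (\<lambda>u. \<phi> u - \<phi> 0)"
  have ng: "norm (g u) = norm u" for u
    using assms[of u 0] by (simp add: g_def dist_norm)
  have dg: "norm (g u - g v) = norm (u - v)" for u v
    using assms[of u v] by (simp add: g_def dist_norm)
  have gi: "g u \<bullet> g v = u \<bullet> v" for u v
    using dg[of u v] ng[of u] ng[of v] by (simp add: norm_eq_sqrt_inner inner_diff inner_commute)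
  show "(\<phi> u - \<phi> 0) \<bullet> (\<phi> v - \<phi> 0) = u \<bullet> v" using gi by (simp add: g_def)
  have "linear g"
  proof (rule linearI)
    fix u v
    have "(g (u + v) - g u - g v) \<bullet> (g (u + v) - g u - g v) = 0"
      by (simp add: inner_diff inner_add gi inner_commute)
    then have "g (u + v) - g u - g v = 0" by (simp only: inner_eq_zero_iff)
    then show "g (u + v) = g u + g v" by (simp add: algebra_simps)
  next
    fix c u
    have "(g (c *\<^sub>R u) - c *\<^sub>R g u) \<bullet> (g (c *\<^sub>R u) - c *\<^sub>R g u) = 0"
      by (simp add: inner_diff inner_add gi inner_commute)
    then show "g (c *\<^sub>R u) = c *\<^sub>R g u" by (simp only: inner_eq_zero_iff right_minus_eq)
  qed
  then show "linear (\<lambda>u. \<phi> u - \<phi> 0)" by (simp add: g_def)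
qed

lemma isometric_chart_frame:
  assumes "isometric_chart \<phi> e"
  obtains a b where "norm a = 1" "norm b = 1" "a \<bullet> b = 0"
    "\<forall>u. \<phi> u = \<phi> 0 + (u $ 1) *\<^sub>R a + (u $ 2) *\<^sub>R b"
proof -
  have iso: "\<And>u v. dist (\<phi> u) (\<phi> v) = dist u v" using assms by (simp add: isometric_chart_def)
  define g where "g = (\<lambda>u. \<phi> u - \<phi> 0)"
  have lin: "linear g" using isometry_affine(1)[OF iso] by (simp add: g_def)
  have gi: "g u \<bullet> g v = u \<bullet> v" for u v using isometry_affine(2)[OF iso] by (simp add: g_def)
  have u: "u = (u $ 1) *\<^sub>R axis 1 1 + (u $ 2) *\<^sub>R axis 2 1" for u :: "real^2"
    by (simp add: vec_eq_iff forall_2 axis_def)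
  have "g u = (u $ 1) *\<^sub>R g (axis 1 1) + (u $ 2) *\<^sub>R g (axis 2 1)" for u
    by (subst u) (simp add: linear_add[OF lin] linear_scale[OF lin])
  then have "\<phi> u = \<phi> 0 + (u $ 1) *\<^sub>R g (axis 1 1) + (u $ 2) *\<^sub>R g (axis 2 1)" for u
    by (simp add: g_def algebra_simps)
  moreover have "norm (g (axis 1 1)) = 1" "norm (g (axis 2 1)) = 1" "g (axis 1 1) \<bullet> g (axis 2 1) = 0"
    by (simp_all add: norm_eq_1 gi inner_axis_axis)
  ultimately show ?thesis using that by blast
qed

lemma aff_dim_chart_range:
  assumes "isometric_chart \<phi> e"
  shows "affine (range \<phi>)" "aff_dim (range \<phi>) = 2"
proof -
  have iso: "\<And>u v. dist (\<phi> u) (\<phi> v) = dist u v" using assms by (simp add: isometric_chart_def)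
  have lin: "linear (\<lambda>u. \<phi> u - \<phi> 0)" using isometry_affine(1)[OF iso] .
  have inj: "inj (\<lambda>u. \<phi> u - \<phi> 0)"
    by (rule injI) (use iso in \<open>metis dist_eq_0_iff diff_eq_eq diff_add_cancel\<close>)
  have r: "range \<phi> = (+) (\<phi> 0) ` range (\<lambda>u. \<phi> u - \<phi> 0)"
    by (auto simp: image_image)
  have "subspace (range (\<lambda>u. \<phi> u - \<phi> 0))"
    using lin by (simp add: subspace_UNIV linear_subspace_image)
  then show "affine (range \<phi>)"
    unfolding r using affine_translation subspace_imp_affine by blast
  have "aff_dim (range (\<lambda>u. \<phi> u - \<phi> 0)) = aff_dim (UNIV :: (real^2) set)"
    using aff_dim_injective_linear_image[OF lin inj] by blast
  then show "aff_dim (range \<phi>) = 2" unfolding r aff_dim_translation_eq by simp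
qed

lemma affine_hull_chart:
  assumes "isometric_chart \<phi> e" "aff_dim e = 2"
  shows "affine hull e = range \<phi>"
proof (rule affine_dim_equal)
  show "affine hull e \<subseteq> range \<phi>"
    using assms aff_dim_chart_range(1)[OF assms(1)]
    by (simp add: hull_minimal isometric_chart_def)
  show "affine hull e \<noteq> {}" using assms(2) by auto
qed (use assms aff_dim_chart_range[OF assms(1)] in auto)

lemma isometric_chart_exists:
  fixes e :: "(real^3) set"
  assumes "aff_dim e = 2"
  obtains \<phi> where "isometric_chart \<phi> e"
proof -
  have "e \<noteq> {}" using assms by auto
  then obtain x0 where x0: "x0 \<in> e" by blast
  let ?S = "span ((\<lambda>x. x - x0) ` e)"
  have "dim ((\<lambda>x. x - x0) ` e) = 2"
    using aff_dim_eq_dim_subtract[of x0 e] x0 assms by (simp add: hull_inc)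
  then have dim: "dim ?S = 2" by simp
  obtain B where B: "pairwise orthogonal B" "\<And>x. x \<in> B \<Longrightarrow> norm x = 1" "card B = dim ?S" "span B = ?S"
    using orthonormal_basis_subspace[OF subspace_span] by (metis (no_types, lifting))
  obtain a b where ab: "B = {a, b}" "a \<noteq> b" using B(3) dim by (auto simp: card_2_iff)
  have nab: "a \<bullet> a = 1" "b \<bullet> b = 1" "a \<bullet> b = 0"
    using B(1,2) ab by (auto simp: pairwise_def orthogonal_def norm_eq_1)
  define \<phi> :: "real^2 \<Rightarrow> real^3" where "\<phi> u = x0 + (u $ 1) *\<^sub>R a + (u $ 2) *\<^sub>R b" for u
  have "dist (\<phi> u) (\<phi> v) = dist u v" for u v
  proof -
    have "\<phi> u - \<phi> v = (u $ 1 - v $ 1) *\<^sub>R a + (u $ 2 - v $ 2) *\<^sub>R b"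
      by (simp add: \<phi>_def algebra_simps)
    then have "(\<phi> u - \<phi> v) \<bullet> (\<phi> u - \<phi> v) = (u $ 1 - v $ 1) * (u $ 1 - v $ 1) + (u $ 2 - v $ 2) * (u $ 2 - v $ 2)"
      using nab by (simp add: inner_add inner_commute)
    also have "\<dots> = (u - v) \<bullet> (u - v)" by (simp add: inner_vec_def sum_2)
    finally have "norm (\<phi> u - \<phi> v) = norm (u - v)" by (simp add: norm_eq_sqrt_inner)
    then show ?thesis by (simp add: dist_norm)
  qed
  moreover have "e \<subseteq> range \<phi>"
  proof
    fix x assume "x \<in> e"
    then have "x - x0 \<in> span {a, b}" using B(4) ab(1) by (auto intro: span_base)
    then obtain s t where "x - x0 = s *\<^sub>R a + t *\<^sub>R b"
      by (auto simp: span_insert span_singleton algebra_simps)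
    then have "x = \<phi> (vector [s, t])" by (simp add: \<phi>_def algebra_simps)
    then show "x \<in> range \<phi>" by blast
  qed
  ultimately show ?thesis using that unfolding isometric_chart_def by blast
qed

lemma isometric_chart_plane_chart:
  assumes "aff_dim e = 2"
  shows "isometric_chart (plane_chart e) e"
proof -
  have "\<exists>\<phi>. isometric_chart \<phi> e" using isometric_chart_exists[OF assms] by blast
  then show ?thesis unfolding isometric_chart_def plane_chart_def by (rule someI_ex)
qed

text \<open>With m = a x b, Lagrange's identity gives n x m = 0. A second use of it yields n = (m.n)
  m, and both vectors are unit vectors.\<close>

lemma normal_eq_frame_cross:
  fixes a b n :: "real^3"
  assumes "norm a = 1" "norm b = 1" "a \<bullet> b = 0" "norm n = 1" "n \<bullet> a = 0" "n \<bullet> b = 0"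
  shows "n = cross3 a b \<or> n = - cross3 a b"
proof -
  let ?m = "cross3 a b"
  have "cross3 n ?m = (n \<bullet> b) *\<^sub>R a - (n \<bullet> a) *\<^sub>R b" by (simp add: Lagrange)
  then have "cross3 n ?m = 0" using assms by simp
  moreover have m: "?m \<bullet> ?m = 1" "n \<bullet> n = 1"
    using assms by (simp_all add: dot_cross norm_eq_1 inner_commute)
  ultimately have "cross3 ?m (cross3 n ?m) = 0" by (simp add: cross_zero_right)
  then have "n = (?m \<bullet> n) *\<^sub>R ?m" using m Lagrange[of ?m n ?m] by simp
  moreover from this have "(?m \<bullet> n) * (?m \<bullet> n) = 1"
    using m by (metis inner_scaleR_left)
  then have "?m \<bullet> n = 1 \<or> ?m \<bullet> n = -1" using square_eq_1_iff by blast
  ultimately show ?thesis by (metis scaleR_minus1_left scaleR_one)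
qed

text \<open>The condition under the choice operator in \<open>edge_normal\<close>; for a
  two-dimensional \<open>e\<close> it fixes the normal up to sign.\<close>

definition plane_normal :: "(real^3) set \<Rightarrow> real^3 \<Rightarrow> bool" where
  "plane_normal e n \<longleftrightarrow> norm n = 1 \<and> (\<forall>x\<in>e. \<forall>y\<in>e. n \<bullet> (y - x) = 0)"

lemma plane_normal_affine_hull:
  assumes "plane_normal e n" "x \<in> affine hull e" "y \<in> affine hull e"
  shows "n \<bullet> (y - x) = 0"
proof -
  obtain z where z: "z \<in> e" using assms(2) by (cases "e = {}") auto
  have "e \<subseteq> {w. n \<bullet> w = n \<bullet> z}"
  proof
    fix w assume "w \<in> e"
    then have "n \<bullet> (w - z) = 0" using assms(1) z by (simp add: plane_normal_def)
    then show "w \<in> {w. n \<bullet> w = n \<bullet> z}" by (simp add: inner_diff_right)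
  qed
  then have "affine hull e \<subseteq> {w. n \<bullet> w = n \<bullet> z}" by (simp add: hull_minimal affine_hyperplane)
  then have "n \<bullet> x = n \<bullet> z" "n \<bullet> y = n \<bullet> z" using assms(2,3) by blast+
  then show ?thesis by (simp add: inner_diff_right)
qed

lemma plane_normal_frame:
  assumes "isometric_chart \<phi> e" "aff_dim e = 2" "plane_normal e n"
    and "norm a = 1" "norm b = 1" "a \<bullet> b = 0"
    and \<phi>: "\<forall>u. \<phi> u = \<phi> 0 + (u $ 1) *\<^sub>R a + (u $ 2) *\<^sub>R b"
  shows "n = cross3 a b \<or> n = - cross3 a b"
proof (rule normal_eq_frame_cross)
  have r: "n \<bullet> (\<phi> u - \<phi> 0) = 0" for u
    using plane_normal_affine_hull[OF assms(3)] affine_hull_chart[OF assms(1,2)] by blast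
  show "n \<bullet> a = 0" using r[of "axis 1 1"] by (subst (asm) spec[OF \<phi>]) (simp add: axis_def)
  show "n \<bullet> b = 0" using r[of "axis 2 1"] by (subst (asm) spec[OF \<phi>]) (simp add: axis_def)
qed (use assms(3-6) in \<open>auto simp: plane_normal_def\<close>)

lemma plane_normal_unique:
  assumes "aff_dim e = 2" "plane_normal e n" "plane_normal e n'"
  shows "n' = n \<or> n' = - n"
proof -
  obtain \<phi> where \<phi>: "isometric_chart \<phi> e" using isometric_chart_exists[OF assms(1)] .
  obtain a b where ab: "norm a = 1" "norm b = 1" "a \<bullet> b = 0"
    "\<forall>u. \<phi> u = \<phi> 0 + (u $ 1) *\<^sub>R a + (u $ 2) *\<^sub>R b"
    using isometric_chart_frame[OF \<phi>] .
  show ?thesis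
    using plane_normal_frame[OF \<phi> assms(1,2) ab] plane_normal_frame[OF \<phi> assms(1,3) ab] by auto
qed

lemma in_affine_hull_plane:
  assumes "aff_dim e = 2" "plane_normal e n" "x \<in> affine hull e" "n \<bullet> (y - x) = 0"
  shows "y \<in> affine hull e"
proof -
  have "affine hull e = {w. n \<bullet> w = n \<bullet> x}"
  proof (rule affine_dim_equal)
    show "affine hull e \<subseteq> {w. n \<bullet> w = n \<bullet> x}"
    proof
      fix w assume "w \<in> affine hull e"
      then have "n \<bullet> (w - x) = 0" using plane_normal_affine_hull[OF assms(2,3)] by blast
      then show "w \<in> {w. n \<bullet> w = n \<bullet> x}" by (simp add: inner_diff_right)
    qed
    have "n \<noteq> 0" using assms(2) by (auto simp: plane_normal_def)
    then show "aff_dim (affine hull e) = aff_dim {w. n \<bullet> w = n \<bullet> x}"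
      using assms(1) by simp
  qed (use assms(3) in \<open>auto simp: affine_hyperplane\<close>)
  then show ?thesis using assms(4) by (auto simp: inner_diff_right)
qed

text \<open>For an element \<open>K\<close> containing the edge \<open>e\<close> this says that \<open>n\<close> is the outward unit
  normal of \<open>K\<close> on \<open>e\<close>.\<close>

definition supporting_normal :: "(real^3) set \<Rightarrow> (real^3) set \<Rightarrow> real^3 \<Rightarrow> bool" where
  "supporting_normal K e n \<longleftrightarrow> norm n = 1 \<and> (\<forall>x\<in>e. \<forall>y\<in>K. n \<bullet> (y - x) \<le> 0)"

lemma supporting_normal_plane_normal:
  assumes "supporting_normal K e n" "e \<subseteq> K"
  shows "plane_normal e n"
proof -
  have "n \<bullet> (y - x) = 0" if "x \<in> e" "y \<in> e" for x y
  proof -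
    have "n \<bullet> (y - x) \<le> 0" "n \<bullet> (x - y) \<le> 0"
      using assms that by (auto simp: supporting_normal_def)
    then show ?thesis by (simp add: inner_diff_right)
  qed
  then show ?thesis using assms(1) by (simp add: plane_normal_def supporting_normal_def)
qed

text \<open>From an interior point a short step in direction \<open>n\<close> stays in
  \<open>K\<close>, which makes the supporting inequality strict.\<close>

lemma supporting_normal_interior:
  assumes "supporting_normal K e n" "x \<in> e" "z \<in> interior K"
  shows "n \<bullet> (z - x) < 0"
proof -
  obtain \<epsilon> where \<epsilon>: "\<epsilon> > 0" "cball z \<epsilon> \<subseteq> K" using assms(3) mem_interior_cball by blast
  have n: "norm n = 1" "n \<bullet> n = 1" using assms(1) by (auto simp: supporting_normal_def norm_eq_1)
  have "z + \<epsilon> *\<^sub>R n \<in> K" using \<epsilon> n by (intro subsetD[OF \<epsilon>(2)]) (simp add: dist_norm)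
  then have "n \<bullet> (z + \<epsilon> *\<^sub>R n - x) \<le> 0" using assms(1,2) by (auto simp: supporting_normal_def)
  then show ?thesis using \<epsilon>(1) n by (simp add: algebra_simps)
qed

text \<open>The segment from \<open>x\<close> through \<open>x0\<close> can be prolonged inside
  \<open>e\<close>. A value at \<open>x\<close> above the minimum would force a value below it at
  the prolonged end.\<close>

lemma rel_interior_min_const:
  fixes e :: "'a::euclidean_space set"
  assumes e: "convex e" "x0 \<in> rel_interior e" and a: "\<And>y. y \<in> e \<Longrightarrow> a \<bullet> x0 \<le> a \<bullet> y" and x: "x \<in> e"
  shows "a \<bullet> x = a \<bullet> x0"
proof (rule antisym)
  obtain m where m: "m > 1" "(1 - m) *\<^sub>R x + m *\<^sub>R x0 \<in> e"
    using convex_rel_interior_iff[OF e(1), of x0] e(2) x by (metis empty_iff)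
  then have "a \<bullet> x0 \<le> a \<bullet> ((1 - m) *\<^sub>R x + m *\<^sub>R x0)" using a by blast
  then have "(m - 1) * (a \<bullet> x) \<le> (m - 1) * (a \<bullet> x0)" by (simp add: inner_add_right algebra_simps)
  then show "a \<bullet> x \<le> a \<bullet> x0" using m(1) by simp
qed (rule a[OF x])

text \<open>The supporting plane of \<open>K\<close> at a relative interior point of
  \<open>e\<close> contains all of \<open>e\<close>, because the functional is minimal there and
  hence constant on \<open>e\<close>.\<close>

lemma supporting_normal_exists:
  fixes e K :: "(real^3) set"
  assumes K: "convex K" "interior K \<noteq> {}" and e: "convex e" "e \<subseteq> K"
    and x0: "x0 \<in> rel_interior e" "x0 \<notin> interior K"
  obtains n where "supporting_normal K e n"
proof -
  have "rel_interior K = interior K" using K(2) by (simp add: rel_interior_nonempty_interior)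
  then have "x0 \<in> closure K" "x0 \<notin> rel_interior K"
    using x0 e(2) rel_interior_subset[of e] closure_subset[of K] by auto
  then obtain a where a: "a \<noteq> 0" "\<And>y. y \<in> closure K \<Longrightarrow> a \<bullet> x0 \<le> a \<bullet> y"
    using supporting_hyperplane_relative_frontier[OF K(1)] by metis
  have const: "a \<bullet> x = a \<bullet> x0" if "x \<in> e" for x
    using rel_interior_min_const[OF e(1) x0(1) _ that] a(2) e(2) closure_subset[of K] by blast
  define n where "n = - (1 / norm a) *\<^sub>R a"
  have "supporting_normal K e n"
    unfolding supporting_normal_def
  proof (intro conjI ballI)
    show "norm n = 1" using a(1) by (simp add: n_def)
    fix x y assume "x \<in> e" "y \<in> K"
    then have "a \<bullet> (y - x) \<ge> 0"
      using a(2)[of y] const[of x] closure_subset[of K] by (auto simp: inner_diff_right)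
    then show "n \<bullet> (y - x) \<le> 0" by (simp add: n_def)
  qed
  then show ?thesis by (rule that)
qed

text \<open>Normals of the plane differ at most by a sign, and an interior point of \<open>K\<close>
  decides the sign.\<close>

lemma supporting_normal_unique:
  assumes "aff_dim e = 2" "e \<subseteq> K" "interior K \<noteq> {}" "supporting_normal K e n" "supporting_normal K e n'"
  shows "n' = n"
proof (rule ccontr)
  assume "n' \<noteq> n"
  then have n': "n' = - n"
    using plane_normal_unique[OF assms(1)] supporting_normal_plane_normal assms by blast
  obtain x where "x \<in> e" using assms(1) aff_dim_empty by fastforce
  moreover obtain z where "z \<in> interior K" using assms(3) by blast
  ultimately show False
    using supporting_normal_interior[OF assms(4), of x z] supporting_normal_interior[OF assms(5), of x z] n'
    by simp
qed

lemma outer_normal_eq: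
  assumes "aff_dim e = 2" "e \<subseteq> K" "interior K \<noteq> {}" "supporting_normal K e n"
  shows "outer_normal K e = n"
  unfolding outer_normal_def
  by (rule the_equality) (use supporting_normal_unique[OF assms(1-3)] assms(4) in \<open>auto simp: supporting_normal_def\<close>)

lemma edge_normal_cases:
  assumes "aff_dim e = 2" "plane_normal e n"
  shows "edge_normal e = n \<or> edge_normal e = - n"
proof -
  have "plane_normal e (edge_normal e)"
    using someI[of "plane_normal e", OF assms(2)] unfolding edge_normal_def plane_normal_def .
  then show ?thesis using plane_normal_unique[OF assms] by blast
qed

text \<open>Near a point of the relative interior of \<open>e\<close> both bodies contain a half ball below the
  plane of \<open>e\<close>.\<close>

lemma same_normal_interiors_meet:
  fixes K L e :: "(real^3) set"
  assumes "aff_dim e = 2" "convex e" and K: "convex K" "e \<subseteq> K" "interior K \<noteq> {}" "supporting_normal K e n"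
    and L: "convex L" "e \<subseteq> L" "interior L \<noteq> {}" "supporting_normal L e n"
  shows "interior K \<inter> interior L \<noteq> {}"
proof -
  have "e \<noteq> {}" using assms(1) by auto
  then obtain x where x: "x \<in> rel_interior e" using \<open>convex e\<close> rel_interior_eq_empty by blast
  then have xe: "x \<in> e" using rel_interior_subset by blast
  obtain \<epsilon> where \<epsilon>: "\<epsilon> > 0" "cball x \<epsilon> \<inter> affine hull e \<subseteq> e" using x mem_rel_interior_cball by blast
  obtain z z' where z: "z \<in> interior K" "z' \<in> interior L" using K(3) L(3) by blast
  define p q where "p = - (n \<bullet> (z - x))" and "q = - (n \<bullet> (z' - x))"
  have pq: "p > 0" "q > 0"
    using supporting_normal_interior[OF K(4) xe z(1)] supporting_normal_interior[OF L(4) xe z(2)]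
    by (auto simp: p_def q_def)
  \<comment> \<open>The weights bring both interior points to the same depth p q / (p + q) below the
    plane of \<open>e\<close>, so that \<open>w' - w\<close> is parallel to it.\<close>
  define w where "w = x + (q / (p + q)) *\<^sub>R (z - x)"
  define w' where "w' = x + (p / (p + q)) *\<^sub>R (z' - x)"
  have shrink: "x + c *\<^sub>R (v - x) \<in> interior C"
    if "convex C" "v \<in> interior C" "x \<in> C" "0 < c" "c \<le> 1" for C and v :: "real^3" and c
  proof -
    have "x - c *\<^sub>R (x - v) \<in> interior C" using mem_interior_convex_shrink[of C v x c] that by blast
    then show ?thesis by (simp add: algebra_simps)
  qed
  have w: "w \<in> interior K" "w' \<in> interior L"
    unfolding w_def w'_def using pq z K(1,2) L(1,2) xe by (auto intro!: shrink)
  have "n \<bullet> (w - x) = - (q / (p + q)) * p" "n \<bullet> (w' - x) = - (p / (p + q)) * q"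
    by (simp_all add: w_def w'_def p_def q_def)
  then have "n \<bullet> (w' - w) = 0" by (simp add: inner_diff_right mult.commute)
  \<comment> \<open>The scale keeps the displaced point \<open>x + d *\<^sub>R (w' - w)\<close>
    within distance \<epsilon> of \<open>x\<close>, hence in \<open>e\<close>.\<close>
  define d where "d = \<epsilon> / (norm (w' - w) + 1)"
  have d: "d > 0" "norm (d *\<^sub>R (w' - w)) \<le> \<epsilon>"
  proof -
    have pos: "norm (w' - w) + 1 > 0" using norm_ge_zero[of "w' - w"] by linarith
    then show "d > 0" using \<epsilon>(1) by (simp add: d_def del: norm_ge_zero)
    have "norm (d *\<^sub>R (w' - w)) = d * norm (w' - w)" using \<open>d > 0\<close> by simp
    also have "\<dots> \<le> d * (norm (w' - w) + 1)" using \<open>d > 0\<close> by simp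
    also have "\<dots> = \<epsilon>" using pos by (simp add: d_def)
    finally show "norm (d *\<^sub>R (w' - w)) \<le> \<epsilon>" .
  qed
  have "x + d *\<^sub>R (w' - w) \<in> affine hull e"
    using in_affine_hull_plane[OF assms(1) supporting_normal_plane_normal[OF K(4,2)], of x "x + d *\<^sub>R (w' - w)"]
      hull_inc[OF xe] \<open>n \<bullet> (w' - w) = 0\<close> by (metis add_diff_cancel_left' inner_scaleR_right mult_zero_right)
  then have "x + d *\<^sub>R (w' - w) \<in> e" using \<epsilon>(2) d(2) by (auto simp: dist_norm)
  \<comment> \<open>This solves (1 - c) d = c. The point of the segment from the displaced point to
    \<open>w\<close> and that of the segment from \<open>x\<close> to \<open>w'\<close>, both at
    parameter \<open>c\<close>, then coincide. The first lies in the interior of \<open>K\<close>,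
    the second in that of \<open>L\<close>.\<close>
  define c where "c = d / (1 + d)"
  have c: "0 < c" "c < 1" "(1 - c) * d = c" using d(1) by (auto simp: c_def field_simps)
  have "(x + d *\<^sub>R (w' - w)) - c *\<^sub>R ((x + d *\<^sub>R (w' - w)) - w) \<in> interior K"
    using mem_interior_convex_shrink[of K w "x + d *\<^sub>R (w' - w)" c] w(1) K(1,2) \<open>x + d *\<^sub>R (w' - w) \<in> e\<close> c by auto
  moreover have "x + c *\<^sub>R (w' - x) \<in> interior L" using shrink[OF L(1) w(2)] L(2) xe c by auto
  moreover have "(x + d *\<^sub>R (w' - w)) - c *\<^sub>R ((x + d *\<^sub>R (w' - w)) - w) = x + c *\<^sub>R (w' - x)"
  proof -
    have "(x + d *\<^sub>R (w' - w)) - c *\<^sub>R ((x + d *\<^sub>R (w' - w)) - w) = (1 - c) *\<^sub>R x + ((1 - c) * d) *\<^sub>R (w' - w) + c *\<^sub>R w"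
      by (simp add: algebra_simps)
    also have "\<dots> = x + c *\<^sub>R (w' - x)" unfolding c(3) by (simp add: algebra_simps)
    finally show ?thesis .
  qed
  ultimately show ?thesis by auto
qed

text \<open>Both bodies have a supporting normal on \<open>e\<close>, and the two agree up to sign.
  Equal normals would put both bodies on the same side and make their interiors meet.\<close>

lemma interface_normals:
  fixes K L :: "(real^3) set"
  assumes K: "convex_body K" and L: "convex_body L" and disj: "interior K \<inter> interior L = {}"
    and e: "convex e" "e \<subseteq> K" "e \<subseteq> L" "aff_dim e = 2"
  obtains n where "supporting_normal K e n" "supporting_normal L e (- n)"
proof -
  \<comment> \<open>An open set disjoint from the interior of \<open>D\<close> is disjoint from its
    closure, which is \<open>D\<close>. Hence no point of the common set \<open>e\<close> is
    interior to either body.\<close>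
  have disj': "interior C \<inter> D = {}" if "interior C \<inter> interior D = {}" "convex_body D" for C D :: "(real^3) set"
  proof -
    have "interior C \<inter> closure (interior D) = {}"
      using that(1) by (simp add: open_Int_closure_eq_empty)
    then show ?thesis using closure_interior_convex_body[OF that(2)] by simp
  qed
  have "e \<noteq> {}" using e(4) by auto
  then obtain x where x: "x \<in> rel_interior e" using e(1) rel_interior_eq_empty by blast
  then have "x \<in> e" using rel_interior_subset by blast
  then have "x \<notin> interior K" "x \<notin> interior L" using disj'[of K L] disj'[of L K] K L disj e(2,3) by blast+
  then obtain n m where n: "supporting_normal K e n" and m: "supporting_normal L e m"
    using supporting_normal_exists[of K e x] supporting_normal_exists[of L e x] K L e x convex_bodyD by metis
  have "m = n \<or> m = - n"
    using plane_normal_unique[OF e(4)] supporting_normal_plane_normal n m e by blast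
  moreover have "m \<noteq> n"
    using same_normal_interiors_meet[OF e(4,1), of K n L] disj n m e K L convex_bodyD by blast
  ultimately show ?thesis using that n m by blast
qed

text \<open>Relative to \<open>K\<close>, both \<open>L\<close> and \<open>M\<close> would have the
  opposite normal on \<open>e\<close>, so they would lie on the same side and overlap.\<close>

lemma no_third_side:
  fixes K L M :: "(real^3) set"
  assumes "convex_body K" "convex_body L" "convex_body M"
    and "interior K \<inter> interior L = {}" "interior K \<inter> interior M = {}" "interior L \<inter> interior M = {}"
    and e: "convex e" "e \<subseteq> K" "e \<subseteq> L" "e \<subseteq> M" 
  shows "aff_dim e \<noteq> 2"
proof
  assume dim: "aff_dim e = 2"
  obtain n where n: "supporting_normal K e n" "supporting_normal L e (- n)"
    using interface_normals[OF assms(1,2,4) e(1-3) dim] .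
  obtain m where m: "supporting_normal K e m" "supporting_normal M e (- m)"
    using interface_normals[OF assms(1,3,5) e(1,2,4) dim] .
  have "m = n" using supporting_normal_unique[OF dim e(2) _ n(1) m(1)] assms(1) convex_bodyD by blast
  then show False
    using same_normal_interiors_meet[OF dim e(1) convex_bodyD(1)[OF assms(2)] e(3) convex_bodyD(5)[OF assms(2)] n(2)
        convex_bodyD(1)[OF assms(3)] e(4) convex_bodyD(5)[OF assms(3)]] m(2) assms(6) by simp
qed

section \<open>Projections along a coordinate axis\<close>

text \<open>The points of space are written as \<open>emb i (y, s)\<close>, where \<open>s\<close> is the coordinate with
  index \<open>i\<close> and \<open>y\<close> consists of the other two. Indices are taken modulo 3, so that
  \<open>i + 1\<close> and \<open>i + 2\<close> are the cyclic successors of \<open>i\<close>, and the component \<open>i\<close> of a cross product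
  is the minor with these two rows.\<close>

definition emb :: "3 \<Rightarrow> (real^2) \<times> real \<Rightarrow> real^3" where
  "emb i z = (\<chi> m. if m = i then snd z else if m = i + 1 then fst z $ 1 else fst z $ 2)"

definition proj :: "3 \<Rightarrow> real^3 \<Rightarrow> real^2" where
  "proj i x = vector [x $ (i + 1), x $ (i + 2)]"

lemma cyclic_index:
  fixes i :: 3
  shows "i + 1 \<noteq> i" "i + 2 \<noteq> i" "i + 1 \<noteq> i + 2"
    and "m = i \<or> m = i + 1 \<or> m = i + 2" and "UNIV = {i, i + 1, i + 2}"
proof -
  show *: "i + 1 \<noteq> i" "i + 2 \<noteq> i" "i + 1 \<noteq> i + 2" by simp_all
  have **: "m = i \<or> m = i + 1 \<or> m = i + 2" for m
    using exhaust_3[of i] exhaust_3[of m] by auto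
  show "m = i \<or> m = i + 1 \<or> m = i + 2" by (rule **)
  show "UNIV = {i, i + 1, i + 2}" using ** by auto
qed

lemma proj_emb [simp]: "proj i (emb i (y, s)) = y"
  by (simp add: proj_def emb_def vec_eq_iff forall_2 cyclic_index)

lemma emb_nth_same [simp]: "emb i (y, s) $ i = s"
  by (simp add: emb_def)

lemma emb_proj [simp]: "emb i (proj i x, x $ i) = x"
proof (rule iffD2[OF vec_eq_iff], rule allI)
  fix m
  show "emb i (proj i x, x $ i) $ m = x $ m"
    using cyclic_index(4)[of m i] by (elim disjE) (simp_all add: proj_def emb_def cyclic_index)
qed

lemma linear_emb: "linear (emb i)"
  by (rule linearI) (simp_all add: emb_def vec_eq_iff)

lemma linear_proj: "linear (proj i)"
  by (rule linearI) (simp_all add: proj_def vec_eq_iff forall_2)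

lemma continuous_emb: "continuous_on S (emb i)"
  using linear_emb linear_continuous_on linear_linear by blast

lemma continuous_proj: "continuous_on S (proj i)"
  using linear_proj linear_continuous_on linear_linear by blast

lemma emb_diff_eq: "emb i (y, s) - emb i (y, s') = (s - s') *\<^sub>R axis i 1"
  by (simp add: emb_def vec_eq_iff axis_def)

lemma prod_Basis_cart:
  fixes g :: "real^'n \<Rightarrow> real"
  shows "(\<Prod>b\<in>Basis. g b) = (\<Prod>m\<in>UNIV. g (axis m 1))"
proof -
  have B: "(Basis :: (real^'n) set) = range (\<lambda>m. axis m 1)" by (auto simp: Basis_vec_def)
  have inj: "inj (\<lambda>m. axis m 1 :: real^'n)" by (rule injI) (simp add: axis_eq_axis)
  show ?thesis unfolding B prod.reindex[OF inj] by simp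
qed

text \<open>\<open>emb i\<close> only rearranges coordinates. Preimages of boxes are products of
  boxes with the same edge lengths, and box volumes determine Lebesgue measure.\<close>

lemma lborel_distr_emb: "distr lborel borel (emb i) = lborel"
proof (rule lborel_eqI[symmetric])
  have meas: "emb i \<in> borel_measurable borel"
    by (rule borel_measurable_continuous_onI[OF continuous_emb])
  fix l u :: "real^3" assume le: "\<And>b. b \<in> Basis \<Longrightarrow> l \<bullet> b \<le> u \<bullet> b"
  have le': "l $ m \<le> u $ m" for m using le[of "axis m 1"] by (simp add: cart_eq_inner_axis axis_in_Basis_iff)
  have lep: "proj i l $ m \<le> proj i u $ m" for m
    using le' exhaust_2[of m] by (auto simp: proj_def)
  have eq: "emb i -` box l u = box (proj i l) (proj i u) \<times> box (l $ i) (u $ i)"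
  proof (rule set_eqI)
    fix z :: "(real^2) \<times> real"
    obtain y s where z: "z = (y, s)" by (cases z)
    have "emb i z \<in> box l u \<longleftrightarrow> (\<forall>m\<in>{i, i + 1, i + 2}. l $ m < emb i z $ m \<and> emb i z $ m < u $ m)"
      by (simp only: mem_box_cart cyclic_index(5)[of i, symmetric] ball_UNIV)
    also have "\<dots> \<longleftrightarrow> z \<in> box (proj i l) (proj i u) \<times> box (l $ i) (u $ i)"
      by (auto simp: z emb_def mem_box_cart forall_2 proj_def cyclic_index box_real)
    finally show "z \<in> emb i -` box l u \<longleftrightarrow> z \<in> box (proj i l) (proj i u) \<times> box (l $ i) (u $ i)" by simp
  qed
  have "emeasure (distr lborel borel (emb i)) (box l u)
      = emeasure (lborel \<Otimes>\<^sub>M lborel) (box (proj i l) (proj i u) \<times> box (l $ i) (u $ i))"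
    by (subst emeasure_distr) (simp_all add: meas eq lborel_prod)
  also have "\<dots> = emeasure lborel (box (proj i l) (proj i u)) * emeasure lborel (box (l $ i) (u $ i))"
    by (rule lborel.emeasure_pair_measure_Times) simp_all
  also have "\<dots> = ennreal (\<Prod>m\<in>UNIV. proj i u $ m - proj i l $ m) * ennreal (u $ i - l $ i)"
  proof -
    have "emeasure lborel (box (proj i l) (proj i u)) = ennreal (\<Prod>b\<in>Basis. (proj i u - proj i l) \<bullet> b)"
      by (rule emeasure_lborel_box)
        (use lep in \<open>auto simp: Basis_vec_def cart_eq_inner_axis[symmetric]\<close>)
    also have "(\<Prod>b\<in>Basis. (proj i u - proj i l) \<bullet> b) = (\<Prod>m\<in>UNIV. proj i u $ m - proj i l $ m)"
      by (simp add: prod_Basis_cart inner_axis)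
    finally show ?thesis using le' by (simp add: box_real)
  qed
  also have "\<dots> = ennreal (\<Prod>m\<in>{i, i + 1, i + 2}. u $ m - l $ m)"
    using le' by (simp add: UNIV_2 proj_def ennreal_mult[symmetric] cyclic_index mult_ac)
  also have "(\<Prod>m\<in>{i, i + 1, i + 2}. u $ m - l $ m) = (\<Prod>b\<in>Basis. (u - l) \<bullet> b)"
    unfolding prod_Basis_cart cyclic_index(5)[of i, symmetric] by (simp add: inner_axis)
  finally show "emeasure (distr lborel borel (emb i)) (box l u) = (\<Prod>b\<in>Basis. (u - l) \<bullet> b)" .
qed simp

lemma integral_emb:
  fixes G :: "real^3 \<Rightarrow> real"
  assumes "integrable lborel G"
  shows "integral\<^sup>L lborel G = (LINT y|lborel. LINT s|lborel. G (emb i (y, s)))"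
    and "integrable lborel (\<lambda>y. LINT s|lborel. G (emb i (y, s)))"
proof -
  have meas: "emb i \<in> borel_measurable lborel"
    using borel_measurable_continuous_onI[OF continuous_emb[of UNIV]] by simp
  have "integrable lborel (\<lambda>z. G (emb i z))"
    using assms integrable_distr_eq[OF meas, of G] lborel_distr_emb[of i] borel_measurable_integrable[OF assms] by simp
  then have int: "integrable (lborel \<Otimes>\<^sub>M lborel) (\<lambda>z. G (emb i z))" by (simp add: lborel_prod)
  have "integral\<^sup>L lborel G = (LINT z|lborel. G (emb i z))"
    using integral_distr[OF meas, of G] lborel_distr_emb[of i] borel_measurable_integrable[OF assms] by simp
  also have "\<dots> = (LINT y|lborel. LINT s|lborel. G (emb i (y, s)))"
    using lborel_pair.integral_fst'[OF int] by (simp add: lborel_prod)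
  finally show "integral\<^sup>L lborel G = (LINT y|lborel. LINT s|lborel. G (emb i (y, s)))" .
  show "integrable lborel (\<lambda>y. LINT s|lborel. G (emb i (y, s)))"
    by (rule lborel_pair.integrable_fst'[OF int])
qed

text \<open>Makes the lines in direction \<open>i\<close> that hit a low-dimensional contact set
  negligible.\<close>

lemma aff_dim_le_1_negligible_proj:
  fixes e :: "(real^3) set"
  assumes "aff_dim e \<le> 1"
  shows "negligible (proj i ` e)"
proof (cases "e = {}")
  case False
  have "aff_dim (proj i ` e) < 2"
    using aff_dim_linear_image_le[OF linear_proj, of i e] assms by simp
  then show ?thesis
  proof -
    obtain x where x: "x \<in> proj i ` e" using False by blast
    have "dim ((\<lambda>y. y - x) ` (proj i ` e)) < DIM(real^2)"
      using aff_dim_eq_dim_subtract[of x "proj i ` e"] hull_inc[OF x] \<open>aff_dim (proj i ` e) < 2\<close> by simp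
    then have "negligible ((\<lambda>y. y - x) ` (proj i ` e))" by (rule negligible_lowdim)
    then have "negligible ((+) x ` (\<lambda>y. y - x) ` (proj i ` e))" by (rule negligible_translation)
    then show ?thesis by (simp add: image_image)
  qed
qed simp

text \<open>Serves twice: as the Jacobian of the projection in a frame \<open>a\<close>,
  \<open>b\<close> of an edge plane, and to write the components of E x B as polynomials.\<close>

lemma det_frame:
  fixes a b :: "real^3"
  shows "a $ (i + 1) * b $ (i + 2) - b $ (i + 1) * a $ (i + 2) = cross3 a b $ i"
proof -
  \<comment> \<open>Index arithmetic is modulo 3; the sums \<open>i + 1\<close> and
    \<open>i + 2\<close> produce the numerals 4 and 5.\<close>
  have [simp]: "(4 :: 3) = 1" "(5 :: 3) = 2" by simp_all
  show ?thesis using exhaust_3[of i] by (auto simp: cross3_def)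
qed

section \<open>Surface integrals in isometric charts\<close>

lemma continuous_on_chart: "isometric_chart \<phi> e \<Longrightarrow> continuous_on A \<phi>"
  unfolding continuous_on_iff isometric_chart_def by metis

lemma compact_chart_vimage:
  assumes \<phi>: "isometric_chart \<phi> e" and e: "compact e"
  shows "compact (\<phi> -` e)"
proof -
  have iso: "dist (\<phi> u) (\<phi> v) = dist u v" for u v using \<phi> by (simp add: isometric_chart_def)
  have "closed (\<phi> -` e)" using e continuous_on_chart[OF \<phi>, of UNIV]
    by (simp add: closed_vimage compact_imp_closed)
  moreover have "bounded (\<phi> -` e)"
  proof -
    obtain c R where R: "\<And>x. x \<in> e \<Longrightarrow> dist c x \<le> R" using compact_imp_bounded[OF e] unfolding bounded_def by blast
    have "dist u v \<le> 2 * R" if "u \<in> \<phi> -` e" "v \<in> \<phi> -` e" for u v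
    proof -
      have "dist (\<phi> u) (\<phi> v) \<le> dist c (\<phi> u) + dist c (\<phi> v)" by (rule dist_triangle3)
      then show ?thesis using R[of "\<phi> u"] R[of "\<phi> v"] that iso[of u v] by simp
    qed
    then show ?thesis unfolding bounded_two_points by blast
  qed
  ultimately show ?thesis by (simp add: compact_eq_bounded_closed)
qed

text \<open>The factor \<open>\<bar>n $ i\<bar>\<close> is the Jacobian of the projection restricted to the plane of \<open>e\<close>. As the
  right-hand side does not involve the chart, all charts give the same surface integral.\<close>

lemma chart_integral_proj:
  fixes F :: "real^3 \<Rightarrow> real" and \<l> :: "real^2 \<Rightarrow> real^3"
  assumes \<phi>: "isometric_chart \<phi> e" and dim: "aff_dim e = 2" and n: "plane_normal e n"
    and e: "compact e" and F: "continuous_on e F" and ni: "n $ i \<noteq> 0"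
    and \<l>: "\<And>x. x \<in> e \<Longrightarrow> \<l> (proj i x) = x"
  shows "set_lebesgue_integral lebesgue (\<phi> -` e) (\<lambda>u. F (\<phi> u)) * \<bar>n $ i\<bar>
       = set_lebesgue_integral lebesgue (proj i ` e) (\<lambda>y. F (\<l> y))" (is "?L * _ = ?R")
    and "set_integrable lebesgue (proj i ` e) (\<lambda>y. F (\<l> y))"
proof -
  obtain a b where ab: "norm a = 1" "norm b = 1" "a \<bullet> b = 0"
    and \<phi>ab: "\<forall>u. \<phi> u = \<phi> 0 + (u $ 1) *\<^sub>R a + (u $ 2) *\<^sub>R b"
    using isometric_chart_frame[OF \<phi>] .
  define T where "T = proj i \<circ> \<phi>"
  define T' where "T' u = (u $ 1) *\<^sub>R proj i a + (u $ 2) *\<^sub>R proj i b" for u :: "real^2"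
  have linT': "linear T'" by (rule linearI) (simp_all add: T'_def algebra_simps)
  have T: "T u = proj i (\<phi> 0) + T' u" for u
    unfolding T_def T'_def o_def by (subst spec[OF \<phi>ab]) (simp add: linear_add[OF linear_proj] linear_scale[OF linear_proj])
  have der: "(T has_derivative T') (at u within S)" for u S
  proof -
    have "bounded_linear T'" using linT' by (simp add: linear_linear)
    then have "((\<lambda>u. proj i (\<phi> 0) + T' u) has_derivative T') (at u within S)"
      using bounded_linear_imp_has_derivative by (auto intro!: derivative_eq_intros)
    moreover have "T = (\<lambda>u. proj i (\<phi> 0) + T' u)" using T by blast
    ultimately show ?thesis by simp
  qed
  have "det (matrix T') = cross3 a b $ i"
    by (simp add: det_2 matrix_def T'_def axis_def proj_def det_frame[symmetric])
  moreover have "n = cross3 a b \<or> n = - cross3 a b"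
    by (rule plane_normal_frame[OF \<phi> dim n ab \<phi>ab])
  ultimately have det: "\<bar>det (matrix T')\<bar> = \<bar>n $ i\<bar>" by auto
  have "inj T'"
    using det ni linT' by (metis abs_eq_0 det_nz_iff_inj)
  then have inj: "inj T" unfolding inj_def T by simp
  define S where "S = \<phi> -` e"
  note cont\<phi> = continuous_on_chart[OF \<phi>]
  have "compact S" unfolding S_def by (rule compact_chart_vimage[OF \<phi> e])
  have \<phi>S: "\<phi> ` S = e" using \<phi> by (auto simp: S_def isometric_chart_def)
  have TS: "T ` S = proj i ` e" unfolding T_def image_comp[symmetric] \<phi>S ..
  have FS: "F (\<l> (T u)) = F (\<phi> u)" if "u \<in> S" for u using that \<l> by (simp add: T_def S_def)
  have contF: "continuous_on S (\<lambda>u. F (\<phi> u))"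
    using continuous_on_compose2[OF F cont\<phi>[of S]] \<phi>S by blast
  \<comment> \<open>The change-of-variables theorem is applied to vector values, so scalars are
    passed through \<open>real^1\<close>.\<close>
  let ?v = "vec :: real \<Rightarrow> real^1"
  have intS: "(\<lambda>u. \<bar>det (matrix T')\<bar> * F (\<phi> u)) absolutely_integrable_on S"
    by (rule set_lebesgue_integral_compact(1)[OF \<open>compact S\<close>]) (intro continuous_intros contF)
  then have "(\<lambda>u. \<bar>det (matrix T')\<bar> * F (\<l> (T u))) absolutely_integrable_on S"
    using FS by (simp cong: set_integrable_cong)
  then have *: "(\<lambda>u. \<bar>det (matrix T')\<bar> *\<^sub>R ?v (F (\<l> (T u)))) absolutely_integrable_on S"
    by (simp add: absolutely_integrable_on_1_iff)
  have "(\<lambda>y. ?v (F (\<l> y))) absolutely_integrable_on T ` S \<and>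
      integral (T ` S) (\<lambda>y. ?v (F (\<l> y))) = integral S (\<lambda>u. \<bar>det (matrix T')\<bar> *\<^sub>R ?v (F (\<l> (T u))))"
  proof -
    have "S \<in> sets lebesgue" using \<open>compact S\<close> by (simp add: lmeasurable_compact fmeasurableD)
    moreover have "inj_on T S" using inj by (rule inj_on_subset) simp
    ultimately show ?thesis
      using has_absolute_integral_change_of_variables[of S T "\<lambda>_. T'" "\<lambda>y. ?v (F (\<l> y))"] * der by blast
  qed
  then have cv: "(\<lambda>y. F (\<l> y)) absolutely_integrable_on T ` S"
    "integral (T ` S) (\<lambda>y. F (\<l> y)) = integral S (\<lambda>u. \<bar>det (matrix T')\<bar> * F (\<l> (T u)))"
    by (simp_all add: absolutely_integrable_on_1_iff integral_on_1_eq vec_eq_iff)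
  show "set_integrable lebesgue (proj i ` e) (\<lambda>y. F (\<l> y))" using cv(1) by (simp add: TS)
  have "?R = integral (T ` S) (\<lambda>y. F (\<l> y))" using set_lebesgue_integral_eq_integral(2)[OF cv(1)] by (simp add: TS)
  also have "\<dots> = integral S (\<lambda>u. \<bar>n $ i\<bar> * F (\<phi> u))" unfolding cv(2) det
    by (rule integral_cong) (simp add: FS)
  also have "\<dots> = set_lebesgue_integral lebesgue S (\<lambda>u. \<bar>n $ i\<bar> * F (\<phi> u))"
    by (rule set_lebesgue_integral_eq_integral(2)[OF intS, unfolded det, symmetric])
  also have "\<dots> = ?L * \<bar>n $ i\<bar>" by (simp add: S_def mult.commute)
  finally show "?L * \<bar>n $ i\<bar> = ?R" by simp
qed

text \<open>Some component of the unit normal is nonzero. Projecting along that axis sends the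
  integrals in both charts to the same planar integral, and the factor
  \<open>\<bar>n $ i\<bar>\<close> cancels.\<close>

lemma surface_integral_chart:
  fixes F :: "real^3 \<Rightarrow> real"
  assumes \<phi>: "isometric_chart \<phi> e" and dim: "aff_dim e = 2" and n: "plane_normal e n"
    and e: "compact e" and F: "continuous_on e F"
  shows "surface_integral e F = set_lebesgue_integral lebesgue (\<phi> -` e) (\<lambda>u. F (\<phi> u))"
proof -
  have "n \<noteq> 0" using n by (auto simp: plane_normal_def)
  then obtain i where i: "n $ i \<noteq> 0" by (auto simp: vec_eq_iff)
  have inj: "inj_on (proj i) e"
  proof (rule inj_onI)
    fix x y assume xy: "x \<in> e" "y \<in> e" "proj i x = proj i y"
    have "emb i (proj i x, x $ i) - emb i (proj i y, y $ i) = (x $ i - y $ i) *\<^sub>R axis i 1"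
      unfolding xy(3) by (rule emb_diff_eq)
    then have d: "x - y = (x $ i - y $ i) *\<^sub>R axis i 1" by simp
    have "n \<bullet> (x - y) = 0" using n xy by (simp add: plane_normal_def)
    then have "(x $ i - y $ i) * n $ i = 0" unfolding d by (simp add: inner_axis)
    then have "x $ i - y $ i = 0" using i by simp
    then show "x = y" using d by simp
  qed
  then have \<l>: "the_inv_into e (proj i) (proj i x) = x" if "x \<in> e" for x
    using that the_inv_into_f_f by fast
  note * = chart_integral_proj(1)[OF _ dim n e F i \<l>]
  show ?thesis
    using trans[OF *[OF isometric_chart_plane_chart[OF dim]] *[OF \<phi>, symmetric]] i
    by (simp add: surface_integral_def)
qed

text \<open>A translated chart of \<open>e\<close> is a chart of the translated edge; chart
  independence lets it replace the one chosen by \<open>plane_chart\<close>.\<close>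

lemma surface_integral_translation:
  fixes F :: "real^3 \<Rightarrow> real"
  assumes dim: "aff_dim e = 2" and n: "plane_normal e n"
    and e: "compact e" and F: "continuous_on e F" and G: "\<And>x. x \<in> e \<Longrightarrow> G (x + s) = F x"
  shows "surface_integral ((\<lambda>x. x + s) ` e) G = surface_integral e F"
proof -
  let ?e = "(\<lambda>x. x + s) ` e"
  have eq: "(\<lambda>x. x + s) ` e = (+) s ` e" by (simp add: add.commute)
  obtain \<phi> where \<phi>: "isometric_chart \<phi> e" using isometric_chart_exists[OF dim] .
  have "isometric_chart (\<lambda>u. \<phi> u + s) ?e" using \<phi> by (auto simp: isometric_chart_def)
  moreover have "aff_dim ?e = 2" using dim unfolding eq aff_dim_translation_eq .
  moreover have "plane_normal ?e n" using n by (simp add: plane_normal_def)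
  moreover have "compact ?e" using e compact_translation[of e s] by (simp add: add.commute)
  moreover have "continuous_on ?e G"
  proof -
    have "continuous_on ?e (\<lambda>x. F (x - s))"
      by (rule continuous_on_compose2[OF F]) (auto intro!: continuous_intros)
    moreover have "G x = F (x - s)" if "x \<in> ?e" for x using that G by auto
    ultimately show ?thesis by (simp cong: continuous_on_cong)
  qed
  ultimately have "surface_integral ?e G
      = set_lebesgue_integral lebesgue ((\<lambda>u. \<phi> u + s) -` ?e) (\<lambda>u. G (\<phi> u + s))"
    by (rule surface_integral_chart)
  also have "(\<lambda>u. \<phi> u + s) -` ?e = \<phi> -` e" by auto
  also have "set_lebesgue_integral lebesgue (\<phi> -` e) (\<lambda>u. G (\<phi> u + s))
      = set_lebesgue_integral lebesgue (\<phi> -` e) (\<lambda>u. F (\<phi> u))"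
    unfolding set_lebesgue_integral_def
    by (rule Bochner_Integration.integral_cong) (auto simp: indicator_def G)
  also have "\<dots> = surface_integral e F"
    using surface_integral_chart[OF \<phi> dim n e F] by simp
  finally show ?thesis .
qed

lemma surface_integral_cong:
  "(\<And>x. x \<in> e \<Longrightarrow> F x = G x) \<Longrightarrow> surface_integral e F = surface_integral e G"
  unfolding surface_integral_def set_lebesgue_integral_def
  by (rule Bochner_Integration.integral_cong) (auto simp: indicator_def)

lemma surface_integral_linear:
  assumes dim: "aff_dim e = 2" and e: "compact e"
    and F: "continuous_on e F" and G: "continuous_on e G"
  shows "surface_integral e (\<lambda>x. F x + G x) = surface_integral e F + surface_integral e G"
    and "surface_integral e (\<lambda>x. c * F x) = c * surface_integral e F"
proof -
  let ?\<phi> = "plane_chart e"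
  have \<phi>: "isometric_chart ?\<phi> e" by (rule isometric_chart_plane_chart[OF dim])
  note cont = continuous_on_chart[OF \<phi>]
  have "compact (?\<phi> -` e)" by (rule compact_chart_vimage[OF \<phi> e])
  then have int: "set_integrable lebesgue (?\<phi> -` e) (\<lambda>u. H (?\<phi> u))" if "continuous_on e H" for H :: "real^3 \<Rightarrow> real"
    by (rule set_lebesgue_integral_compact(1)) (rule continuous_on_compose2[OF that cont], auto)
  show "surface_integral e (\<lambda>x. F x + G x) = surface_integral e F + surface_integral e G"
    unfolding surface_integral_def by (rule set_integral_add(2)[OF int[OF F] int[OF G]])
  show "surface_integral e (\<lambda>x. c * F x) = c * surface_integral e F"
    unfolding surface_integral_def by simp
qed

section \<open>Divergence theorem on a convex body\<close>

text \<open>Edges are contacts with neighbours rather than faces of \<open>K\<close>, so one face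
  may be split among several of them.\<close>

definition edges_of :: "(real^3) set \<Rightarrow> (real^3) set set \<Rightarrow> (real^3) set set" where
  "edges_of K N = {K \<inter> K' | K'. K' \<in> N \<and> aff_dim (K \<inter> K') = 2}"

text \<open>The local data of the divergence theorem. The last clause guarantees that no part of the
  boundary is missed, and finiteness keeps the union of exceptional sets negligible.\<close>

definition body_neighbours :: "(real^3) set \<Rightarrow> (real^3) set set \<Rightarrow> bool" where
  "body_neighbours K N \<longleftrightarrow> convex_body K \<and> finite N \<and> (\<forall>L\<in>N. convex_body L \<and> interior K \<inter> interior L = {}) \<and>
     pairwise (\<lambda>L L'. interior L \<inter> interior L' = {}) N \<and> K - interior K \<subseteq> \<Union>N"

lemma edges_ofD:
  assumes N: "body_neighbours K N" and e: "e \<in> edges_of K N"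
  shows "convex e" "compact e" "e \<subseteq> K" "aff_dim e = 2"
    and "supporting_normal K e (outer_normal K e)" "plane_normal e (outer_normal K e)"
proof -
  obtain L where L: "e = K \<inter> L" "L \<in> N" "aff_dim e = 2" using e by (auto simp: edges_of_def)
  have K: "convex_body K" and L': "convex_body L" "interior K \<inter> interior L = {}"
    using N L(2) by (auto simp: body_neighbours_def)
  show 1: "convex e" "compact e" "e \<subseteq> K" "aff_dim e = 2"
    using L K L' convex_bodyD by (auto intro!: convex_Int compact_Int)
  obtain n where n: "supporting_normal K e n"
    using interface_normals[OF K L' 1(1,3) _ 1(4)] L(1) by blast
  then show 2: "supporting_normal K e (outer_normal K e)"
    using outer_normal_eq[OF 1(4,3) _ n] convex_bodyD[OF K] by simp
  show "plane_normal e (outer_normal K e)" using supporting_normal_plane_normal[OF 2 1(3)] .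
qed

lemma finite_edges_of: "body_neighbours K N \<Longrightarrow> finite (edges_of K N)"
  by (rule finite_subset[of _ "(\<lambda>L. K \<inter> L) ` N"]) (auto simp: edges_of_def body_neighbours_def)

text \<open>A three-dimensional convex intersection would have an interior point, which would be
  interior to both bodies.\<close>

lemma aff_dim_Int_le_2:
  fixes K L :: "(real^3) set"
  assumes "convex K" "convex L" "interior K \<inter> interior L = {}"
  shows "aff_dim (K \<inter> L) \<le> 2"
proof (rule ccontr)
  assume "\<not> aff_dim (K \<inter> L) \<le> 2"
  then have dim: "aff_dim (K \<inter> L) = 3" using aff_dim_le_DIM[of "K \<inter> L"] by simp
  then have "interior (K \<inter> L) = rel_interior (K \<inter> L)" by (simp add: interior_rel_interior)
  moreover have "K \<inter> L \<noteq> {}" using dim by auto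
  ultimately show False
    using assms rel_interior_eq_empty[of "K \<inter> L"] by (simp add: convex_Int)
qed

text \<open>A two-dimensional overlap would have the three sides \<open>K\<close>, \<open>L\<close>
  and \<open>L'\<close>.\<close>

lemma aff_dim_Int_edges:
  assumes N: "body_neighbours K N" and e: "e \<in> edges_of K N" "e' \<in> edges_of K N" "e \<noteq> e'"
  shows "aff_dim (e \<inter> e') \<le> 1"
proof -
  obtain L L' where L: "e = K \<inter> L" "L \<in> N" "e' = K \<inter> L'" "L' \<in> N" using e(1,2) by (auto simp: edges_of_def)
  then have "L \<noteq> L'" using e(3) by auto
  then have "aff_dim (e \<inter> e') \<noteq> 2"
    using N L edges_ofD(1)[OF N e(1)] edges_ofD(1)[OF N e(2)]
    by (intro no_third_side[of K L L']) (auto simp: body_neighbours_def pairwise_def convex_Int)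
  moreover have "aff_dim (e \<inter> e') \<le> 2"
    using aff_dim_subset[of "e \<inter> e'" e] edges_ofD(4)[OF N e(1)] by simp
  ultimately show ?thesis by simp
qed

text \<open>The projected interior is open, convex and dense in the projection of \<open>K\<close>,
  so the difference lies in the frontier of a convex set. This discards the lines that meet
  \<open>K\<close> without entering its interior.\<close>

lemma negligible_proj_boundary:
  assumes K: "convex_body K"
  shows "negligible (proj i ` K - proj i ` interior K)"
proof -
  have "surj (proj i)" using proj_emb by (rule surjI[where f = "\<lambda>y. emb i (y, 0)"])
  then have op: "open (proj i ` interior K)"
    using open_surjective_linear_image[OF open_interior linear_proj] by blast
  have "proj i ` K \<subseteq> closure (proj i ` interior K)"
    using image_closure_subset[of "interior K" "proj i" "closure (proj i ` interior K)"]
    by (simp add: closure_interior_convex_body[OF K] continuous_proj closure_subset)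
  then have "proj i ` K - proj i ` interior K \<subseteq> frontier (proj i ` interior K)"
    using op by (auto simp: frontier_def interior_open)
  moreover have "convex (proj i ` interior K)"
    using convex_bodyD(1)[OF K] by (simp add: convex_interior convex_linear_image linear_proj)
  ultimately show ?thesis using negligible_convex_frontier negligible_subset by blast
qed

text \<open>The sign \<open>\<sigma> = 1\<close> selects the upper and \<open>\<sigma> = - 1\<close> the lower end of the segment in which
  \<open>K\<close> meets a line in direction \<open>i\<close>.\<close>

definition extremal :: "(real^3) set \<Rightarrow> 3 \<Rightarrow> real \<Rightarrow> (real^2 \<Rightarrow> real) \<Rightarrow> bool" where
  "extremal K i \<sigma> h \<longleftrightarrow> \<bar>\<sigma>\<bar> = 1 \<and> (\<forall>y\<in>proj i ` K. emb i (y, h y) \<in> K \<and> (\<forall>s. emb i (y, s) \<in> K \<longrightarrow> \<sigma> * s \<le> \<sigma> * h y))"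

text \<open>A point of \<open>K\<close> beyond \<open>x\<close> in the direction selected by
  \<sigma> would violate the supporting inequality. Hence \<open>h\<close> inverts the projection on
  every edge facing that direction and can serve as the lift in
  \<open>chart_integral_proj\<close>.\<close>

lemma extremal_lift:
  assumes h: "extremal K i \<sigma> h" and e: "supporting_normal K e n" "e \<subseteq> K" "\<sigma> * n $ i > 0" and x: "x \<in> e"
  shows "emb i (proj i x, h (proj i x)) = x"
proof -
  let ?y = "proj i x"
  have y: "?y \<in> proj i ` K" using x e(2) by blast
  have x': "emb i (?y, x $ i) = x" by simp
  have "emb i (?y, h ?y) \<in> K" "\<sigma> * x $ i \<le> \<sigma> * h ?y"
    using h y subsetD[OF e(2) x] unfolding extremal_def by (blast, metis x')
  then have "n \<bullet> (emb i (?y, h ?y) - x) \<le> 0" using e(1) x by (simp add: supporting_normal_def)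
  moreover have "emb i (?y, h ?y) - x = (h ?y - x $ i) *\<^sub>R axis i 1" using emb_diff_eq[of i ?y "h ?y" "x $ i"] by simp
  ultimately have "(h ?y - x $ i) * n $ i \<le> 0" by (simp add: inner_axis)
  moreover have "\<sigma> = 1 \<or> \<sigma> = -1" using h by (auto simp: extremal_def)
  ultimately have "h ?y = x $ i"
    using e(3) \<open>\<sigma> * x $ i \<le> \<sigma> * h ?y\<close> by (auto simp: mult_le_0_iff)
  then show ?thesis by simp
qed

text \<open>Outside the projections of the rim of \<open>K\<close> and of the lower-dimensional intersections, a line in
  direction \<open>i\<close> leaves \<open>K\<close> through exactly one edge. No face structure of \<open>K\<close> is needed.\<close>

lemma exit_edge_unique:
  fixes K :: "(real^3) set" and \<sigma> :: real
  assumes N: "body_neighbours K N" and h: "extremal K i \<sigma> h"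
  obtains Z where "negligible Z" "\<And>y. y \<notin> Z \<Longrightarrow>
    (\<Sum>e\<in>{e \<in> edges_of K N. \<sigma> * outer_normal K e $ i > 0}. indicator (proj i ` e) y) = (indicator (proj i ` K) y :: real)"
proof -
  let ?E = "edges_of K N"
  define Z where "Z = \<Union>((\<lambda>L. proj i ` (K \<inter> L)) ` {L \<in> N. aff_dim (K \<inter> L) \<le> 1}) \<union>
    \<Union>((\<lambda>(e, e'). proj i ` (e \<inter> e')) ` {(e, e') \<in> ?E \<times> ?E. e \<noteq> e'}) \<union> (proj i ` K - proj i ` interior K)"
  have K: "convex_body K" and finN: "finite N" using N by (auto simp: body_neighbours_def)
  have finE: "finite ?E" by (rule finite_edges_of[OF N])
  have "negligible Z"
    unfolding Z_def
  proof (intro negligible_Un negligible_Union negligible_proj_boundary[OF K])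
    have "finite (?E \<times> ?E)" using finE by simp
    then have "finite {(e, e') \<in> ?E \<times> ?E. e \<noteq> e'}" by (rule rev_finite_subset) auto
    then show "finite ((\<lambda>(e, e'). proj i ` (e \<inter> e')) ` {(e, e') \<in> ?E \<times> ?E. e \<noteq> e'})" by (rule finite_imageI)
  next
    fix T assume "T \<in> (\<lambda>(e, e'). proj i ` (e \<inter> e')) ` {(e, e') \<in> ?E \<times> ?E. e \<noteq> e'}"
    then show "negligible T"
      using aff_dim_le_1_negligible_proj[OF aff_dim_Int_edges[OF N]] by auto
  qed (use finN in \<open>auto intro: aff_dim_le_1_negligible_proj\<close>)
  moreover have "(\<Sum>e\<in>{e \<in> ?E. \<sigma> * outer_normal K e $ i > 0}. indicator (proj i ` e) y) = (indicator (proj i ` K) y :: real)"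
    if y: "y \<notin> Z" for y
  proof -
    let ?P = "{e \<in> ?E. \<sigma> * outer_normal K e $ i > 0 \<and> y \<in> proj i ` e}"
    have "(\<Sum>e\<in>{e \<in> ?E. \<sigma> * outer_normal K e $ i > 0}. indicator (proj i ` e) y) = (\<Sum>e\<in>?P. 1 :: real)"
      using finE by (intro sum.mono_neutral_cong_right) (auto simp: indicator_def)
    also have "\<dots> = card ?P" by simp
    also have "\<dots> = (indicator (proj i ` K) y :: real)"
    proof (cases "y \<in> proj i ` K")
      case False
      then have "?P = {}" using edges_ofD(3)[OF N] by blast
      then have "card ?P = 0" by (simp only: card.empty)
      then show ?thesis using False by simp
    next
      case True
      then have "y \<in> proj i ` interior K" using y by (auto simp: Z_def)
      \<comment> \<open>An interior point on the same line as the exit point. Comparing the two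
        along direction \<open>i\<close> yields the strict sign of the normal component.\<close>
      then obtain w where w: "w \<in> interior K" "proj i w = y" by blast
      have \<sigma>: "\<sigma> = 1 \<or> \<sigma> = -1" using h by (auto simp: extremal_def)
      define x where "x = emb i (y, h y)"
      have x: "x \<in> K" "\<And>s. emb i (y, s) \<in> K \<Longrightarrow> \<sigma> * s \<le> \<sigma> * h y"
        using h True by (auto simp: extremal_def x_def)
      have "x \<notin> interior K"
      proof
        assume "x \<in> interior K"
        then obtain \<epsilon> where \<epsilon>: "\<epsilon> > 0" "cball x \<epsilon> \<subseteq> K" using mem_interior_cball by blast
        have "emb i (y, h y) - emb i (y, h y + \<sigma> * \<epsilon>) = (- \<sigma> * \<epsilon>) *\<^sub>R axis i 1"
          by (simp add: emb_diff_eq)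
        then have "dist x (emb i (y, h y + \<sigma> * \<epsilon>)) = \<epsilon>"
          using \<epsilon>(1) \<sigma> by (auto simp: x_def dist_norm)
        then have "emb i (y, h y + \<sigma> * \<epsilon>) \<in> K" using \<epsilon>(2) by auto
        from x(2)[OF this] show False using \<epsilon>(1) \<sigma> by auto
      qed
      then obtain L where L: "L \<in> N" "x \<in> L" using x(1) N by (auto simp: body_neighbours_def)
      have px: "proj i x = y" by (simp add: x_def)
      have Lb: "convex_body L" "interior K \<inter> interior L = {}" using N L(1) by (auto simp: body_neighbours_def)
      have "\<not> aff_dim (K \<inter> L) \<le> 1"
        using y L x(1) px by (auto simp: Z_def)
      then have "aff_dim (K \<inter> L) = 2"
        using aff_dim_Int_le_2[OF convex_bodyD(1)[OF K] convex_bodyD(1)[OF Lb(1)] Lb(2)] by linarith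
      then have E: "K \<inter> L \<in> ?E" using L(1) by (auto simp: edges_of_def)
      let ?n = "outer_normal K (K \<inter> L)"
      have "?n \<bullet> (w - x) < 0"
        using supporting_normal_interior[OF edges_ofD(5)[OF N E] _ w(1)] x(1) L(2) by blast
      moreover have w': "w = emb i (y, w $ i)" using w(2) by auto
      then have "w - x = (w $ i - h y) *\<^sub>R axis i 1" unfolding x_def by (metis emb_diff_eq)
      ultimately have "(w $ i - h y) * ?n $ i < 0" by (simp add: inner_axis)
      moreover have "\<sigma> * w $ i \<le> \<sigma> * h y" 
      proof (rule x(2))
        show "emb i (y, w $ i) \<in> K" using w(1) interior_subset[of K] by (simp only: w'[symmetric]) blast
      qed
      ultimately have "\<sigma> * ?n $ i > 0" using \<sigma> by (auto simp: mult_less_0_iff)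
      then have mem: "K \<inter> L \<in> ?P" using E x(1) L(2) px by blast
      \<comment> \<open>Any other edge counted in \<open>?P\<close> contains the same exit point by
        \<open>extremal_lift\<close>, so \<open>y\<close> would lie in the excluded projection of
        the overlap of two edges.\<close>
      have "e = K \<inter> L" if e: "e \<in> ?P" for e
      proof (rule ccontr)
        assume ne: "e \<noteq> K \<inter> L"
        obtain z where z: "z \<in> e" "proj i z = y" using e by blast
        have eE: "e \<in> ?E" using e by blast
        have "emb i (proj i z, h (proj i z)) = z"
          using extremal_lift[OF h edges_ofD(5,3)[OF N eE] _ z(1)] e by blast
        then have "z = x" using z(2) by (simp add: x_def)
        then have "y \<in> proj i ` (e \<inter> (K \<inter> L))" using z x(1) L(2) by blast
        moreover have "(e, K \<inter> L) \<in> {(e, e') \<in> ?E \<times> ?E. e \<noteq> e'}" using ne E eE by blast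
        ultimately have "y \<in> Z" unfolding Z_def by blast
        then show False using y by simp
      qed
      then have "?P = {K \<inter> L}" using mem by blast
      then show ?thesis using True by (simp only: card.empty card_insert_disjoint) simp
    qed
    finally show ?thesis .
  qed
  ultimately show ?thesis by (rule that)
qed

lemma slice_interval:
  assumes K: "convex_body K" and y: "y \<in> proj i ` K"
  defines "S \<equiv> {s. emb i (y, s) \<in> K}"
  shows "S = {Inf S..Sup S}" "Inf S \<in> S" "Sup S \<in> S"
proof -
  obtain x where x: "x \<in> K" "y = proj i x" using y by blast
  then have "x $ i \<in> S" by (simp add: S_def)
  then have "S \<noteq> {}" by blast
  have cont: "continuous_on UNIV (\<lambda>s. emb i (y, s))"
    by (rule continuous_on_compose2[OF continuous_emb[of UNIV]]) (auto intro!: continuous_intros)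
  have "closed S"
    using closed_vimage[OF convex_bodyD(3)[OF K] cont] by (simp add: S_def vimage_def)
  moreover have "bounded S"
  proof -
    obtain B where B: "\<And>x. x \<in> K \<Longrightarrow> norm x \<le> B" using convex_bodyD(4)[OF K] bounded_iff by blast
    have "norm s \<le> B" if "s \<in> S" for s
      using B[of "emb i (y, s)"] component_le_norm_cart[of "emb i (y, s)" i] that by (simp add: S_def)
    then show ?thesis using bounded_iff by blast
  qed
  ultimately have cpt: "compact S" by (simp add: compact_eq_bounded_closed)
  then show I: "Inf S \<in> S" and J: "Sup S \<in> S"
    using closed_contains_Inf[OF \<open>S \<noteq> {}\<close> bounded_imp_bdd_below] closed_contains_Sup[OF \<open>S \<noteq> {}\<close> bounded_imp_bdd_above]
      compact_imp_closed[OF cpt] compact_imp_bounded[OF cpt] by simp_all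
  have "convex S"
    unfolding convex_alt
  proof (intro ballI allI impI)
    fix s t u :: real assume s: "s \<in> S" "t \<in> S" and u: "0 \<le> u \<and> u \<le> 1"
    have "(1 - u) *\<^sub>R emb i (y, s) + u *\<^sub>R emb i (y, t) \<in> K"
      using convex_bodyD(1)[OF K] s u unfolding convex_alt S_def by blast
    moreover have "(1 - u) *\<^sub>R emb i (y, s) + u *\<^sub>R emb i (y, t) = emb i (y, (1 - u) *\<^sub>R s + u *\<^sub>R t)"
      by (simp add: emb_def vec_eq_iff algebra_simps)
    ultimately show "(1 - u) *\<^sub>R s + u *\<^sub>R t \<in> S" by (simp add: S_def)
  qed
  then have "is_interval S" by (simp add: is_interval_convex_1)
  then have *: "s \<in> S" if "Inf S \<le> s" "s \<le> Sup S" for s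
    using I J that unfolding is_interval_1 by blast
  have "s \<in> {Inf S..Sup S}" if "s \<in> S" for s
    using that compact_imp_bounded[OF cpt]
    by (simp add: cInf_lower cSup_upper bounded_imp_bdd_below bounded_imp_bdd_above)
  moreover have "s \<in> S" if "s \<in> {Inf S..Sup S}" for s using that * by (meson atLeastAtMost_iff)
  ultimately show "S = {Inf S..Sup S}" by blast
qed

text \<open>Integrating the partial derivative along a line leaves the value of \<open>p\<close> at
  the upper end minus that at the lower end. The projection Jacobian converts these into edge
  integrals, with the sign of the normal component telling upper from lower edges.\<close>

lemma divergence_convex_body:
  fixes p :: "real^3 \<Rightarrow> real"
  assumes N: "body_neighbours K N"
    and p: "\<And>x. (p has_derivative D x) (at x)" and cont: "continuous_on UNIV (\<lambda>x. D x (axis i 1))"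
  shows "set_lebesgue_integral lebesgue K (\<lambda>x. D x (axis i 1))
       = (\<Sum>e\<in>edges_of K N. surface_integral e p * outer_normal K e $ i)"
proof -
  have K: "convex_body K" using N by (simp add: body_neighbours_def)
  let ?E = "edges_of K N" and ?n = "\<lambda>e. outer_normal K e $ i"
  have finE: "finite ?E" by (rule finite_edges_of[OF N])
  define top bot where "top y = Sup {s. emb i (y, s) \<in> K}" and "bot y = Inf {s. emb i (y, s) \<in> K}" for y
  have slice: "{s. emb i (y, s) \<in> K} = {bot y..top y}" "bot y \<in> {s. emb i (y, s) \<in> K}" "top y \<in> {s. emb i (y, s) \<in> K}"
    if "y \<in> proj i ` K" for y
    using slice_interval[OF K that] by (simp_all add: top_def bot_def)
  have slice': "emb i (y, s) \<in> K \<longleftrightarrow> bot y \<le> s \<and> s \<le> top y" if "y \<in> proj i ` K" for y s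
    using slice(1)[OF that] by (simp add: set_eq_iff)
  have top: "extremal K i 1 top" and bot: "extremal K i (-1) bot"
    unfolding extremal_def using slice(2,3) slice' by auto
  have contp: "continuous_on A p" for A
    by (meson p continuous_at_imp_continuous_on has_derivative_continuous)
  have edge: "surface_integral e p * ?n e = \<sigma> * set_lebesgue_integral lebesgue (proj i ` e) (\<lambda>y. p (emb i (y, h y)))"
    "set_integrable lebesgue (proj i ` e) (\<lambda>y. p (emb i (y, h y)))"
    if h: "extremal K i \<sigma> h" and e: "e \<in> ?E" "\<sigma> * ?n e > 0" for \<sigma> h e
  proof -
    have lift: "emb i (proj i x, h (proj i x)) = x" if "x \<in> e" for x
      using extremal_lift[OF h edges_ofD(5,3)[OF N e(1)] e(2) that] .
    have n0: "?n e \<noteq> 0" using e(2) by auto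
    note * = chart_integral_proj[OF isometric_chart_plane_chart edges_ofD(4,6,2)[OF N e(1)] contp n0 lift,
        OF edges_ofD(4)[OF N e(1)]]
    show "set_integrable lebesgue (proj i ` e) (\<lambda>y. p (emb i (y, h y)))" by (rule *(2))
    have "\<sigma> = 1 \<or> \<sigma> = -1" using h by (auto simp: extremal_def)
    then have "\<bar>?n e\<bar> = \<sigma> * ?n e" "\<sigma> * \<sigma> = 1" using e(2) by auto
    then have "surface_integral e p * ?n e = \<sigma> * (surface_integral e p * \<bar>?n e\<bar>)" by (simp add: mult_ac)
    also have "surface_integral e p * \<bar>?n e\<bar> = set_lebesgue_integral lebesgue (proj i ` e) (\<lambda>y. p (emb i (y, h y)))"
      unfolding surface_integral_def by (rule *(1))
    finally show "surface_integral e p * ?n e = \<sigma> * set_lebesgue_integral lebesgue (proj i ` e) (\<lambda>y. p (emb i (y, h y)))" .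
  qed
  let ?Ep = "{e \<in> ?E. 1 * ?n e > 0}" and ?Em = "{e \<in> ?E. -1 * ?n e > 0}"
  obtain Z1 where Z1: "negligible Z1"
    "\<And>y. y \<notin> Z1 \<Longrightarrow> (\<Sum>e\<in>?Ep. indicator (proj i ` e) y) = (indicator (proj i ` K) y :: real)"
    using exit_edge_unique[OF N top] by blast
  obtain Z2 where Z2: "negligible Z2"
    "\<And>y. y \<notin> Z2 \<Longrightarrow> (\<Sum>e\<in>?Em. indicator (proj i ` e) y) = (indicator (proj i ` K) y :: real)"
    using exit_edge_unique[OF N bot] by blast
  let ?gt = "\<lambda>y. p (emb i (y, top y))" and ?gb = "\<lambda>y. p (emb i (y, bot y))"
  let ?G = "\<lambda>x. indicator K x *\<^sub>R D x (axis i 1)"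
  have intG: "integrable lborel ?G"
    by (rule borel_integrable_compact[OF convex_bodyD(2)[OF K]]) (rule continuous_on_subset[OF cont subset_UNIV])
  have inner: "(LINT s|lborel. ?G (emb i (y, s))) = indicator (proj i ` K) y * (?gt y - ?gb y)" for y
  proof (cases "y \<in> proj i ` K")
    case False
    then have "emb i (y, s) \<notin> K" for s by (metis imageI proj_emb)
    then show ?thesis using False by simp
  next
    case True
    have "(LINT s|lborel. ?G (emb i (y, s))) = (LINT s|lborel. indicator {bot y..top y} s *\<^sub>R D (emb i (y, s)) (axis i 1))"
      by (rule Bochner_Integration.integral_cong) (auto simp: indicator_def slice'[OF True])
    also have "\<dots> = ?gt y - ?gb y"
    proof (rule integral_FTC_atLeastAtMost)
      show "bot y \<le> top y" using slice'[OF True] slice(2)[OF True] by blast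
      have c: "continuous_on A (\<lambda>s. emb i (y, s))" for A
        by (rule continuous_on_compose2[OF continuous_emb[of UNIV]]) (auto intro!: continuous_intros)
      show "continuous_on {bot y..top y} (\<lambda>s. D (emb i (y, s)) (axis i 1))"
        by (rule continuous_on_compose2[OF cont c]) auto
      fix s
      have "((\<lambda>s. emb i (y, s)) has_derivative (\<lambda>s. s *\<^sub>R axis i 1)) (at s within {bot y..top y})"
      proof -
        have "emb i (y, s) = emb i (y, 0) + s *\<^sub>R axis i 1" for s
          using emb_diff_eq[of i y s 0] by (simp add: algebra_simps)
        then have eq: "(\<lambda>s. emb i (y, s)) = (\<lambda>s. emb i (y, 0) + s *\<^sub>R axis i 1)" by blast
        show ?thesis by (subst eq) (auto intro!: derivative_eq_intros)
      qed
      from has_derivative_compose[OF this p]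
      have "((\<lambda>s. p (emb i (y, s))) has_derivative (\<lambda>s'. D (emb i (y, s)) (s' *\<^sub>R axis i 1))) (at s within {bot y..top y})" .
      moreover have "D (emb i (y, s)) (s' *\<^sub>R axis i 1) = s' *\<^sub>R D (emb i (y, s)) (axis i 1)" for s'
        using linear_scale[OF has_derivative_linear[OF p]] .
      ultimately show "((\<lambda>s. p (emb i (y, s))) has_vector_derivative D (emb i (y, s)) (axis i 1)) (at s within {bot y..top y})"
        by (simp add: has_vector_derivative_def)
    qed
    finally show ?thesis using True by simp
  qed
  have "integrable lborel (\<lambda>y. indicator (proj i ` K) y * (?gt y - ?gb y))"
    using integral_emb(2)[OF intG, of i] unfolding inner .
  then have meas: "(\<lambda>y. indicator (proj i ` K) y * (?gt y - ?gb y)) \<in> borel_measurable lborel"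
    by (rule borel_measurable_integrable)
  have "set_lebesgue_integral lebesgue K (\<lambda>x. D x (axis i 1)) = integral\<^sup>L lborel ?G"
    using set_lebesgue_integral_compact(2)[OF convex_bodyD(2)[OF K] continuous_on_subset[OF cont subset_UNIV]]
    by (simp add: set_lebesgue_integral_def)
  also have "\<dots> = (LINT y|lborel. indicator (proj i ` K) y * (?gt y - ?gb y))"
    unfolding integral_emb(1)[OF intG, of i] inner ..
  also have "\<dots> = (LINT y|lebesgue. indicator (proj i ` K) y * (?gt y - ?gb y))"
    using integral_completion[OF meas] by simp
  \<comment> \<open>Almost everywhere the indicator of the whole projection splits over the upper
    edges and, separately, over the lower ones.\<close>
  also have "\<dots> = (LINT y|lebesgue. (\<Sum>e\<in>?Ep. indicator (proj i ` e) y *\<^sub>R ?gt y) - (\<Sum>e\<in>?Em. indicator (proj i ` e) y *\<^sub>R ?gb y))"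
  proof (rule integral_AE_cong_lebesgue[OF negligible_Un[OF Z1(1) Z2(1)]])
    fix y assume "y \<notin> Z1 \<union> Z2"
    then show "indicator (proj i ` K) y * (?gt y - ?gb y)
      = (\<Sum>e\<in>?Ep. indicator (proj i ` e) y *\<^sub>R ?gt y) - (\<Sum>e\<in>?Em. indicator (proj i ` e) y *\<^sub>R ?gb y)"
      using Z1(2)[of y] Z2(2)[of y] by (simp add: sum_distrib_right[symmetric] right_diff_distrib)
  qed
  also have "\<dots> = (\<Sum>e\<in>?Ep. set_lebesgue_integral lebesgue (proj i ` e) ?gt) - (\<Sum>e\<in>?Em. set_lebesgue_integral lebesgue (proj i ` e) ?gb)"
  proof -
    have 1: "integrable lebesgue (\<lambda>y. indicator (proj i ` e) y *\<^sub>R ?gt y)" if "e \<in> ?Ep" for e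
      using edge(2)[OF top] that unfolding set_integrable_def by simp
    have 2: "integrable lebesgue (\<lambda>y. indicator (proj i ` e) y *\<^sub>R ?gb y)" if "e \<in> ?Em" for e
      using edge(2)[OF bot] that unfolding set_integrable_def by simp
    have "integrable lebesgue (\<lambda>y. \<Sum>e\<in>?Ep. indicator (proj i ` e) y *\<^sub>R ?gt y)"
      by (rule Bochner_Integration.integrable_sum) (rule 1)
    moreover have "integrable lebesgue (\<lambda>y. \<Sum>e\<in>?Em. indicator (proj i ` e) y *\<^sub>R ?gb y)"
      by (rule Bochner_Integration.integrable_sum) (rule 2)
    moreover have "integral\<^sup>L lebesgue (\<lambda>y. \<Sum>e\<in>?Ep. indicator (proj i ` e) y *\<^sub>R ?gt y)
        = (\<Sum>e\<in>?Ep. integral\<^sup>L lebesgue (\<lambda>y. indicator (proj i ` e) y *\<^sub>R ?gt y))"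
      by (rule Bochner_Integration.integral_sum) (rule 1)
    moreover have "integral\<^sup>L lebesgue (\<lambda>y. \<Sum>e\<in>?Em. indicator (proj i ` e) y *\<^sub>R ?gb y)
        = (\<Sum>e\<in>?Em. integral\<^sup>L lebesgue (\<lambda>y. indicator (proj i ` e) y *\<^sub>R ?gb y))"
      by (rule Bochner_Integration.integral_sum) (rule 2)
    ultimately show ?thesis
      unfolding set_lebesgue_integral_def by (simp only: Bochner_Integration.integral_diff)
  qed
  also have "\<dots> = (\<Sum>e\<in>?Ep. surface_integral e p * ?n e) + (\<Sum>e\<in>?Em. surface_integral e p * ?n e)"
  proof -
    have 1: "(\<Sum>e\<in>?Ep. surface_integral e p * ?n e) = (\<Sum>e\<in>?Ep. set_lebesgue_integral lebesgue (proj i ` e) ?gt)"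
      by (rule sum.cong[OF refl]) (use edge(1)[OF top] in auto)
    have 2: "(\<Sum>e\<in>?Em. surface_integral e p * ?n e) = (\<Sum>e\<in>?Em. - set_lebesgue_integral lebesgue (proj i ` e) ?gb)"
      by (rule sum.cong[OF refl]) (use edge(1)[OF bot] in auto)
    show ?thesis unfolding 1 2 by (simp add: sum_negf)
  qed
  also have "\<dots> = (\<Sum>e\<in>?Ep \<union> ?Em. surface_integral e p * ?n e)"
    using finE by (intro sum.union_disjoint[symmetric]) auto
  \<comment> \<open>The edges added here are parallel to direction \<open>i\<close> and carry the
    factor 0.\<close>
  also have "\<dots> = (\<Sum>e\<in>?E. surface_integral e p * ?n e)"
    using finE by (intro sum.mono_neutral_left) auto
  finally show ?thesis .
qed

section \<open>Edges of a mesh and periodicity\<close>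

text \<open>Asks for no covering and no finiteness, so that it applies both to a mesh and to the
  infinite set of its periodic translates.\<close>

definition packing :: "(real^3) set set \<Rightarrow> bool" where
  "packing T \<longleftrightarrow> (\<forall>K\<in>T. convex_body K) \<and> pairwise (\<lambda>K L. interior K \<inter> interior L = {}) T"

lemma packing_mesh: "is_mesh D T \<Longrightarrow> packing T"
  using convex_body_mesh by (auto simp: packing_def is_mesh_def)

text \<open>\<open>interface_normals\<close> supplies the opposite normals and
  \<open>no_third_side\<close> excludes any further element containing \<open>e\<close>.\<close>

lemma interior_edge_sides:
  assumes T: "packing T" and e: "e \<in> interior_edges T"
  obtains K L n where "K \<in> T" "L \<in> T" "K \<noteq> L" "e = K \<inter> L" "sides T e = {K, L}"
    "outer_normal K e = n" "outer_normal L e = - n" "norm n = 1"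
    "convex e" "compact e" "aff_dim e = 2" "plane_normal e n"
proof -
  obtain K L where KL: "K \<in> T" "L \<in> T" "K \<noteq> L" "e = K \<inter> L" and dim: "aff_dim e = 2"
    using e by (auto simp: interior_edges_def)
  have body: "convex_body M" if "M \<in> T" for M using T that by (auto simp: packing_def)
  have disj: "interior M \<inter> interior M' = {}" if "M \<in> T" "M' \<in> T" "M \<noteq> M'" for M M'
    using T that by (auto simp: packing_def pairwise_def)
  have ce: "convex e" "compact e"
    using KL(4) convex_bodyD[OF body[OF KL(1)]] convex_bodyD[OF body[OF KL(2)]] by (auto intro: convex_Int compact_Int)
  have sub: "e \<subseteq> K" "e \<subseteq> L" using KL(4) by auto
  obtain n where n: "supporting_normal K e n" "supporting_normal L e (- n)"
    using interface_normals[OF body[OF KL(1)] body[OF KL(2)] disj[OF KL(1-3)] ce(1) sub dim] .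
  have "M = K \<or> M = L" if "M \<in> T" "e \<subseteq> M" for M
    using no_third_side[OF body[OF KL(1)] body[OF KL(2)] body[OF that(1)] disj[OF KL(1-3)] _ _ ce(1) sub that(2)]
      disj[OF KL(1) that(1)] disj[OF KL(2) that(1)] dim by blast
  then have "sides T e = {K, L}" using KL(1,2) sub by (auto simp: sides_def)
  moreover have "outer_normal K e = n" "outer_normal L e = - n"
    using outer_normal_eq[OF dim sub(1) _ n(1)] outer_normal_eq[OF dim sub(2) _ n(2)] convex_bodyD(5) body KL(1,2) by auto
  moreover have "norm n = 1" using n(1) by (simp add: supporting_normal_def)
  ultimately show ?thesis using that KL ce dim supporting_normal_plane_normal[OF n(1) sub(1)] by blast
qed

lemma interior_edge_side:
  assumes T: "packing T" and e: "e \<in> interior_edges T" and K: "K \<in> sides T e"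
  shows "\<exists>L\<in>T. L \<noteq> K \<and> e = K \<inter> L"
proof -
  obtain A B n where "A \<in> T" "B \<in> T" "A \<noteq> B" "e = A \<inter> B" "sides T e = {A, B}"
    by (rule interior_edge_sides[OF T e])
  then show ?thesis using K by (metis Int_commute insertE singletonD)
qed

lemma closed_cube_cbox: "closed_cube L = cbox (\<chi> i. - L) (\<chi> i. L)"
  by (auto simp: closed_cube_def mem_box_cart)

lemma interior_closed_cube: "interior (closed_cube L) = {x. \<forall>i. - L < x $ i \<and> x $ i < L}"
  by (auto simp: closed_cube_cbox mem_box_cart)

text \<open>All elements lie in the cube, so the normal of the cube on the facet supports each of
  them. Two elements containing \<open>e\<close> would share this normal and overlap; hence there is
  one side, and \<open>e\<close> is no interior edge.\<close>

lemma boundary_edge_side: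
  assumes L: "L > 0" and T: "is_mesh (closed_cube L) T" and e: "e \<in> boundary_edges (closed_cube L) T"
  obtains K n where "K \<in> T" "sides T e = {K}" "boundary_side T e = K" "outer_normal K e = n" "norm n = 1"
    "e \<subseteq> K" "aff_dim e = 2" "plane_normal e n" "e \<notin> interior_edges T"
proof -
  let ?C = "closed_cube L"
  obtain K F where K: "K \<in> T" "e = K \<inter> F" "aff_dim e = 2" and F: "F facet_of ?C"
    using e by (auto simp: boundary_edges_def)
  have C: "convex ?C" "interior ?C \<noteq> {}"
  proof -
    show "convex ?C" by (simp add: closed_cube_cbox)
    have "0 \<in> interior ?C" using L by (simp add: interior_closed_cube)
    then show "interior ?C \<noteq> {}" by blast
  qed
  have face: "F face_of ?C" "F \<noteq> ?C" using F by (auto simp: facet_of_def)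
  have body: "convex_body M" if "M \<in> T" for M using convex_body_mesh[OF T that] .
  have conv: "convex e" using K convex_bodyD(1)[OF body] face_of_imp_convex[OF face(1)] by (auto intro: convex_Int)
  have eC: "e \<subseteq> ?C" using K(2) face_of_imp_subset[OF face(1)] by blast
  have "e \<noteq> {}" using K(3) by auto
  then obtain x where x: "x \<in> rel_interior e" using conv rel_interior_eq_empty by blast
  then have "x \<in> F" using rel_interior_subset K(2) by blast
  then have "x \<notin> interior ?C" using face_of_disjoint_interior[OF face] by blast
  then obtain n where n: "supporting_normal ?C e n"
    using supporting_normal_exists[OF C conv eC x] by blast
  have nM: "supporting_normal M e n" if "M \<in> T" for M
    using n T that unfolding supporting_normal_def is_mesh_def by blast
  have sub: "e \<subseteq> K" using K(2) by blast
  have "M = K" if "M \<in> T" "e \<subseteq> M" for M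
  proof (rule ccontr)
    assume "M \<noteq> K"
    then have "interior M \<inter> interior K = {}" using T that(1) K(1) by (auto simp: is_mesh_def pairwise_def)
    moreover have "interior M \<inter> interior K \<noteq> {}"
      using same_normal_interiors_meet[OF K(3) conv convex_bodyD(1)[OF body[OF that(1)]] that(2)
          convex_bodyD(5)[OF body[OF that(1)]] nM[OF that(1)] convex_bodyD(1)[OF body[OF K(1)]] sub
          convex_bodyD(5)[OF body[OF K(1)]] nM[OF K(1)]] .
    ultimately show False by blast
  qed
  then have sides: "sides T e = {K}" using K(1) sub unfolding sides_def by blast
  moreover have "boundary_side T e = K" unfolding boundary_side_def sides by simp
  moreover have "outer_normal K e = n" using outer_normal_eq[OF K(3) sub convex_bodyD(5)[OF body[OF K(1)]] nM[OF K(1)]] .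
  moreover have "e \<notin> interior_edges T"
  proof
    assume "e \<in> interior_edges T"
    then obtain A B n where "A \<noteq> B" "sides T e = {A, B}"
      by (rule interior_edge_sides[OF packing_mesh[OF T]])
    then show False using sides by auto
  qed
  ultimately show ?thesis
    using that[of K n] K(1,3) sub n supporting_normal_plane_normal[OF nM[OF K(1)] sub] by (auto simp: supporting_normal_def)
qed

lemma finite_interior_edges: "finite T \<Longrightarrow> finite (interior_edges T)"
  by (rule finite_subset[of _ "(\<lambda>(K, L). K \<inter> L) ` (T \<times> T)"]) (auto simp: interior_edges_def)

lemma finite_boundary_edges: "finite T \<Longrightarrow> finite (boundary_edges (closed_cube L) T)"
proof -
  assume T: "finite T"
  have "polyhedron (closed_cube L)" by (simp add: closed_cube_cbox polytope_imp_polyhedron polytope_interval)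
  then have "finite {F. F facet_of closed_cube L}" by (rule finite_polyhedron_facets)
  then show ?thesis
    using T by (intro finite_subset[of "boundary_edges (closed_cube L) T" "(\<lambda>(K, F). K \<inter> F) ` (T \<times> {F. F facet_of closed_cube L})"])
      (auto simp: boundary_edges_def)
qed

section \<open>The period lattice and the unrolled mesh\<close>

lemma period_lattice_0 [simp]: "0 \<in> period_lattice L"
  unfolding period_lattice_def by (auto intro: exI[of _ 0])

lemma period_lattice_add:
  assumes "s \<in> period_lattice L" "t \<in> period_lattice L"
  shows "s + t \<in> period_lattice L"
  unfolding period_lattice_def
proof (intro CollectI allI)
  fix i
  obtain m n :: int where "s $ i = 2 * L * of_int m" "t $ i = 2 * L * of_int n"
    using assms unfolding period_lattice_def by blast
  then have "(s + t) $ i = 2 * L * of_int (m + n)" by (simp add: algebra_simps)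
  then show "\<exists>m. (s + t) $ i = 2 * L * of_int m" by blast
qed

lemma period_lattice_minus:
  assumes "s \<in> period_lattice L"
  shows "- s \<in> period_lattice L"
  unfolding period_lattice_def
proof (intro CollectI allI)
  fix i
  obtain m :: int where "s $ i = 2 * L * of_int m"
    using assms unfolding period_lattice_def by blast
  then have "(- s) $ i = 2 * L * of_int (- m)" by simp
  then show "\<exists>m. (- s) $ i = 2 * L * of_int m" by blast
qed

lemma period_lattice_diff:
  "s \<in> period_lattice L \<Longrightarrow> t \<in> period_lattice L \<Longrightarrow> s - t \<in> period_lattice L"
  using period_lattice_add[of s L "- t"] period_lattice_minus by simp

lemma period_lattice_eq_0:
  assumes "L > 0" "s \<in> period_lattice L" "\<And>i. \<bar>s $ i\<bar> < 2 * L"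
  shows "s = 0"
proof (rule iffD2[OF vec_eq_iff], rule allI)
  fix i
  obtain m :: int where m: "s $ i = 2 * L * of_int m" using assms(2) unfolding period_lattice_def by blast
  have "2 * L * \<bar>of_int m\<bar> < 2 * L * 1" using assms(3)[of i] assms(1) unfolding m by (simp add: abs_mult)
  then have "\<bar>real_of_int m\<bar> < 1" using assms(1) by simp
  then have "m = 0" by linarith
  then show "s $ i = 0 $ i" using m by simp
qed

lemma finite_small_period_lattice:
  assumes "L > 0"
  shows "finite {s \<in> period_lattice L. \<forall>i. \<bar>s $ i\<bar> < 4 * L}"
proof -
  let ?F = "{- 2 * L, 0, 2 * L}"
  have fin: "finite (vec_lambda ` PiE (UNIV :: 3 set) (\<lambda>_. ?F))"
    by (intro finite_imageI finite_PiE) auto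
  have "s \<in> vec_lambda ` PiE (UNIV :: 3 set) (\<lambda>_. ?F)"
    if s: "s \<in> period_lattice L" "\<forall>i. \<bar>s $ i\<bar> < 4 * L" for s
  proof (rule image_eqI[of _ _ "vec_nth s"])
    have "s $ i \<in> ?F" for i
    proof -
      obtain m :: int where m: "s $ i = 2 * L * of_int m" using s(1) unfolding period_lattice_def by blast
      have "2 * L * \<bar>of_int m\<bar> < 2 * L * 2" using spec[OF s(2), of i] assms unfolding m by (simp add: abs_mult)
      then have "\<bar>real_of_int m\<bar> < 2" using assms by simp
      then have "m = -1 \<or> m = 0 \<or> m = 1" by linarith
      then show ?thesis using m by auto
    qed
    then show "vec_nth s \<in> PiE UNIV (\<lambda>_. ?F)" by (simp add: PiE_UNIV_domain)
  qed simp
  then have "{s \<in> period_lattice L. \<forall>i. \<bar>s $ i\<bar> < 4 * L} \<subseteq> vec_lambda ` PiE (UNIV :: 3 set) (\<lambda>_. ?F)"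
    by blast
  then show ?thesis using fin by (rule finite_subset)
qed

text \<open>The torus is unrolled: the lattice translates \<open>Tp\<close> of the mesh cover the
  whole space, and an edge on the boundary of the cell becomes an ordinary interior edge of
  \<open>Tp\<close>.\<close>

locale torus_mesh =
  fixes L :: real and T :: "(real^3) set set"
  assumes L: "L > 0" and mesh: "is_mesh (closed_cube L) T"
begin

abbreviation "Tp \<equiv> periodic_mesh L T"
abbreviation "\<Lambda> \<equiv> period_lattice L"
abbreviation "shift s K \<equiv> (\<lambda>x. x + s) ` K" for s :: "real^3" and K :: "(real^3) set"

lemma shift_shift: "shift s (shift t K) = shift (t + s) K"
  by (auto simp: image_image add_ac)

lemma shift_0: "shift 0 K = K"
  by simp

lemma interior_shift: "interior (shift s K) = shift s (interior K)"
  using interior_translation[of s K] by (simp add: add.commute)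

lemma aff_dim_shift: "aff_dim (shift s K) = aff_dim K"
  using aff_dim_translation_eq[of s K] by (simp add: add.commute)

lemma shift_Int: "shift s (A \<inter> B) = shift s A \<inter> shift s B"
  by (rule image_Int) (auto intro: injI)

lemma shift_subset: "shift s A \<subseteq> shift s B \<longleftrightarrow> A \<subseteq> B"
  by (rule inj_image_subset_iff) (auto intro: injI)

lemma mesh_subset: "K \<in> T \<Longrightarrow> K \<subseteq> closed_cube L"
  using mesh by (auto simp: is_mesh_def)

lemma finite_mesh: "finite T"
  using mesh by (simp add: is_mesh_def)

lemma body: "K \<in> T \<Longrightarrow> convex_body K"
  by (rule convex_body_mesh[OF mesh])

text \<open>Interior points of elements have coordinates strictly between -L and L. The two shifts
  therefore differ by less than one period in every coordinate, and only 0 is such a lattice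
  vector.\<close>

lemma overlap:
  assumes "K \<in> T" "K' \<in> T" "s \<in> \<Lambda>" "s' \<in> \<Lambda>" "interior (shift s K) \<inter> interior (shift s' K') \<noteq> {}"
  shows "s = s'" "K = K'"
proof -
  obtain x y where xy: "x \<in> interior K" "y \<in> interior K'" "x + s = y + s'"
    using assms(5) unfolding interior_shift by blast
  have "interior K \<subseteq> interior (closed_cube L)" "interior K' \<subseteq> interior (closed_cube L)"
    using mesh_subset assms(1,2) interior_mono by blast+
  then have c: "- L < x $ i \<and> x $ i < L" "- L < y $ i \<and> y $ i < L" for i
    using xy unfolding interior_closed_cube by blast+
  have "s - s' = y - x" using xy(3) by (simp add: algebra_simps)
  then have "\<bar>(s - s') $ i\<bar> < 2 * L" for i using c[of i] by (simp add: abs_less_iff)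
  then have "s - s' = 0" using period_lattice_eq_0[OF L period_lattice_diff[OF assms(3,4)]] by blast
  then show "s = s'" by simp
  then have "x = y" using xy(3) by simp
  then have "interior K \<inter> interior K' \<noteq> {}" using xy by blast
  then show "K = K'" using packing_mesh[OF mesh] assms(1,2) unfolding packing_def pairwise_def by blast
qed

lemma periodic_meshE:
  assumes "K \<in> Tp"
  obtains s K0 where "s \<in> \<Lambda>" "K0 \<in> T" "K = shift s K0"
  using assms unfolding periodic_mesh_def by blast

lemma periodic_meshI: "s \<in> \<Lambda> \<Longrightarrow> K \<in> T \<Longrightarrow> shift s K \<in> Tp"
  unfolding periodic_mesh_def by blast

lemma shift_mem:
  assumes "K \<in> Tp" "s \<in> \<Lambda>"
  shows "shift s K \<in> Tp"
proof -
  obtain t K0 where "t \<in> \<Lambda>" "K0 \<in> T" "K = shift t K0" using assms(1) by (rule periodic_meshE)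
  then show ?thesis using periodic_meshI[OF period_lattice_add[of t L s]] assms(2) by (simp add: shift_shift)
qed

lemma mesh_subset_periodic: "T \<subseteq> Tp"
  unfolding periodic_mesh_def using shift_0 period_lattice_0 by blast

lemma packing_periodic: "packing Tp"
  unfolding packing_def
proof (intro conjI ballI)
  fix K assume "K \<in> Tp"
  then show "convex_body K" using convex_body_translation body by (auto simp: periodic_mesh_def)
next
  show "pairwise (\<lambda>K L. interior K \<inter> interior L = {}) Tp"
    unfolding pairwise_def periodic_mesh_def using overlap by blast
qed

lemma shift_to_mesh_unique:
  assumes "K \<in> T" "s \<in> \<Lambda>" "shift s K \<in> T"
  shows "s = 0"
proof -
  have "interior (shift s K) \<noteq> {}"
    using convex_bodyD(5)[OF body[OF assms(3)]] .
  then show ?thesis using overlap(1)[OF assms(1,3,2) period_lattice_0] by simp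
qed

lemma point_in_shift:
  obtains s z where "s \<in> \<Lambda>" "z \<in> closed_cube L" "x = z + s"
proof -
  define s :: "real^3" where "s = (\<chi> i. 2 * L * of_int \<lfloor>(x $ i + L) / (2 * L)\<rfloor>)"
  have "s \<in> \<Lambda>" by (auto simp: s_def period_lattice_def)
  moreover have "x - s \<in> closed_cube L"
    unfolding closed_cube_def
  proof (intro CollectI allI)
    fix i
    let ?q = "(x $ i + L) / (2 * L)"
    have "2 * L * of_int \<lfloor>?q\<rfloor> \<le> 2 * L * ?q"
      by (rule mult_left_mono[OF of_int_floor_le]) (use L in simp)
    moreover have "2 * L * ?q \<le> 2 * L * (of_int \<lfloor>?q\<rfloor> + 1)"
      by (rule mult_left_mono[OF real_of_int_floor_add_one_ge]) (use L in simp)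
    moreover have "2 * L * ?q = x $ i + L" using L by simp
    ultimately show "- L \<le> (x - s) $ i \<and> (x - s) $ i \<le> L" by (simp add: s_def algebra_simps)
  qed
  ultimately show ?thesis using that[of s "x - s"] by simp
qed

text \<open>A finite stock of translates containing all neighbours of elements of the cell. If a
  point has coordinates below 3L in modulus, a translate containing it is shifted by less than 3L +
  L in each coordinate.\<close>

definition near :: "(real^3) set set" where
  "near = {shift s K | s K. s \<in> \<Lambda> \<and> (\<forall>i. \<bar>s $ i\<bar> < 4 * L) \<and> K \<in> T}"

lemma finite_near: "finite near"
proof -
  have "near = (\<lambda>(s, K). shift s K) ` ({s \<in> \<Lambda>. \<forall>i. \<bar>s $ i\<bar> < 4 * L} \<times> T)" by (auto simp: near_def)
  then show ?thesis using finite_small_period_lattice[OF L] finite_mesh by simp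
qed

lemma near_subset: "near \<subseteq> Tp"
  by (auto simp: near_def periodic_mesh_def)

lemma in_near:
  assumes "K \<in> Tp" "x \<in> K" "\<And>i. \<bar>x $ i\<bar> < 3 * L"
  shows "K \<in> near"
proof -
  obtain s K0 where K: "K = shift s K0" "s \<in> \<Lambda>" "K0 \<in> T" using assms(1) by (auto simp: periodic_mesh_def)
  obtain z where z: "z \<in> K0" "x = z + s" using K(1) assms(2) by blast
  have "\<bar>s $ i\<bar> < 4 * L" for i
  proof -
    have "- L \<le> z $ i" "z $ i \<le> L" using z(1) mesh_subset[OF K(3)] by (auto simp: closed_cube_def)
    then show ?thesis using assms(3)[of i] z(2) by (simp add: abs_less_iff)
  qed
  then show ?thesis using K by (auto simp: near_def)
qed

text \<open>The nontrivial clause is the covering of the boundary. Finitely many closed sets missing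
  a boundary point miss a ball around it. The translates cover that ball, so it lies in
  \<open>K\<close>, and the point would be interior.\<close>

lemma body_neighbours_near:
  assumes K: "K \<in> T"
  shows "body_neighbours K (near - {K})"
  unfolding body_neighbours_def
proof (intro conjI ballI)
  show "convex_body K" by (rule body[OF K])
  show "finite (near - {K})" using finite_near by simp
  show "convex_body M" if "M \<in> near - {K}" for M
    using that near_subset packing_periodic by (auto simp: packing_def)
  show "interior K \<inter> interior M = {}" if "M \<in> near - {K}" for M
    using that near_subset packing_periodic K mesh_subset_periodic unfolding packing_def pairwise_def by blast
  show "pairwise (\<lambda>K L. interior K \<inter> interior L = {}) (near - {K})"
    using packing_periodic near_subset unfolding packing_def pairwise_def by blast
  show "K - interior K \<subseteq> \<Union> (near - {K})"
  proof
    fix x assume x: "x \<in> K - interior K"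
    show "x \<in> \<Union> (near - {K})"
    proof (rule ccontr)
      assume nx: "x \<notin> \<Union> (near - {K})"
      have "closed M" if "M \<in> near - {K}" for M
        using that near_subset packing_periodic convex_bodyD(3) unfolding packing_def by blast
      then have "closed (\<Union> (near - {K}))" using finite_near by (intro closed_Union) auto
      then have "open (- \<Union> (near - {K}))" by (simp add: open_Compl)
      then obtain \<epsilon> where \<epsilon>: "\<epsilon> > 0" "ball x \<epsilon> \<subseteq> - \<Union> (near - {K})" using nx open_contains_ball by blast
      \<comment> \<open>Radius at most L keeps the coordinates within the bound of
        \<open>in_near\<close>, so only elements of \<open>near\<close> can meet the ball.\<close>
      have "ball x (min \<epsilon> L) \<subseteq> K"
      proof
        fix y assume y: "y \<in> ball x (min \<epsilon> L)"
        obtain s z where s: "s \<in> \<Lambda>" "z \<in> closed_cube L" "y = z + s" by (rule point_in_shift)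
        have "z \<in> \<Union>T" using s(2) mesh by (simp add: is_mesh_def)
        then obtain K0 where K0: "K0 \<in> T" "z \<in> K0" by blast
        have "\<bar>y $ i\<bar> < 3 * L" for i
        proof -
          have "\<bar>(x - y) $ i\<bar> < L" using y component_le_norm_cart[of "x - y" i] by (simp add: dist_norm)
          moreover have "- L \<le> x $ i" "x $ i \<le> L" using x mesh_subset[OF K] by (auto simp: closed_cube_def)
          ultimately show ?thesis using L by (simp add: abs_less_iff)
        qed
        moreover have "shift s K0 \<in> Tp" "y \<in> shift s K0" using K0 s by (auto simp: periodic_mesh_def)
        ultimately have "shift s K0 \<in> near" using in_near by blast
        moreover have "y \<notin> \<Union> (near - {K})" using \<epsilon>(2) y by auto
        ultimately show "y \<in> K" using \<open>y \<in> shift s K0\<close> by blast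
      qed
      then have "x \<in> interior K" unfolding mem_interior using \<epsilon>(1) L by (intro exI[of _ "min \<epsilon> L"]) simp
      then show False using x by simp
    qed
  qed
qed

text \<open>Identifies the edges used in the divergence theorem with the global edges of the
  unrolled mesh; an element sharing an edge with \<open>K\<close> meets the cell and hence is
  near.\<close>

lemma edges_of_near:
  assumes K: "K \<in> T"
  shows "edges_of K (near - {K}) = {e \<in> interior_edges Tp. K \<in> sides Tp e}"
proof (intro equalityI subsetI)
  fix e assume "e \<in> edges_of K (near - {K})"
  then obtain M where M: "e = K \<inter> M" "M \<in> near" "M \<noteq> K" "aff_dim e = 2" by (auto simp: edges_of_def)
  then show "e \<in> {e \<in> interior_edges Tp. K \<in> sides Tp e}"
    using K mesh_subset_periodic near_subset unfolding interior_edges_def sides_def by blast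
next
  fix e assume e: "e \<in> {e \<in> interior_edges Tp. K \<in> sides Tp e}"
  then obtain M where M: "M \<in> Tp" "M \<noteq> K" "e = K \<inter> M"
    using interior_edge_side[OF packing_periodic] by blast
  have dim: "aff_dim e = 2" using e by (auto simp: interior_edges_def)
  then have "e \<noteq> {}" by auto
  then obtain x where x: "x \<in> K" "x \<in> M" using M(3) by blast
  have "\<bar>x $ i\<bar> < 3 * L" for i
  proof -
    have "- L \<le> x $ i" "x $ i \<le> L" using x mesh_subset[OF K] by (auto simp: closed_cube_def)
    then show ?thesis using L by simp
  qed
  then have "M \<in> near" using in_near[OF M(1) x(2)] by blast
  then show "e \<in> edges_of K (near - {K})" using M dim by (auto simp: edges_of_def)
qed

lemma periodic_edges_subset: "periodic_edges L T \<subseteq> interior_edges Tp"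
  using mesh_subset_periodic by (auto simp: periodic_edges_def interior_edges_def)

lemma finite_periodic_edges: "finite (periodic_edges L T)"
proof (rule finite_subset)
  show "periodic_edges L T \<subseteq> (\<lambda>(K, M). K \<inter> M) ` (T \<times> near)"
  proof
    fix e assume "e \<in> periodic_edges L T"
    then obtain K M where KM: "e = K \<inter> M" "K \<in> T" "M \<in> Tp" "K \<inter> M \<inter> periodic_cell L \<noteq> {}"
      by (auto simp: periodic_edges_def)
    then obtain x where x: "x \<in> K" "x \<in> M" by blast
    have "\<bar>x $ i\<bar> < 3 * L" for i
    proof -
      have "- L \<le> x $ i" "x $ i \<le> L" using x mesh_subset[OF KM(2)] by (auto simp: closed_cube_def)
      then show ?thesis using L by simp
    qed
    then have "M \<in> near" using in_near[OF KM(3) x(2)] by blast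
    then show "e \<in> (\<lambda>(K, M). K \<inter> M) ` (T \<times> near)" using KM by auto
  qed
  show "finite ((\<lambda>(K, M). K \<inter> M) ` (T \<times> near))" using finite_mesh finite_near by simp
qed

lemma shift_interior_edge:
  assumes "e \<in> interior_edges Tp" "s \<in> \<Lambda>"
  shows "shift s e \<in> interior_edges Tp"
proof -
  obtain A B where AB: "e = A \<inter> B" "A \<in> Tp" "B \<in> Tp" "A \<noteq> B" "aff_dim e = 2"
    using assms(1) by (auto simp: interior_edges_def)
  have "shift s A \<noteq> shift s B" using AB(4) shift_subset[of s A B] shift_subset[of s B A] by blast
  moreover have "aff_dim (shift s A \<inter> shift s B) = 2" using AB(5) unfolding AB(1) shift_Int[symmetric] aff_dim_shift .
  ultimately show ?thesis
    unfolding AB(1) shift_Int interior_edges_def using shift_mem[OF AB(2) assms(2)] shift_mem[OF AB(3) assms(2)] by blast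
qed

lemma sides_shift:
  assumes "s \<in> \<Lambda>" "K \<in> sides Tp e"
  shows "shift s K \<in> sides Tp (shift s e)"
  using assms shift_mem by (auto simp: sides_def shift_subset)

lemma periodic_edge_subset_cube: "e \<in> periodic_edges L T \<Longrightarrow> e \<subseteq> closed_cube L"
  using mesh_subset by (auto simp: periodic_edges_def)

text \<open>Both edges lie in the closed cube and meet the half-open cell. The strict lower bound of
  the cell, used for each edge in turn, keeps every coordinate of the shift below one
  period.\<close>

lemma periodic_edge_unique:
  assumes e: "e \<in> periodic_edges L T" and s: "s \<in> \<Lambda>" "shift s e \<in> periodic_edges L T"
  shows "s = 0"
proof (rule period_lattice_eq_0[OF L s(1)])
  fix i
  obtain x where x: "x \<in> e" "x \<in> periodic_cell L" using e by (auto simp: periodic_edges_def)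
  then have "x + s \<in> closed_cube L" using periodic_edge_subset_cube[OF s(2)] by blast
  then have 1: "s $ i < 2 * L" using x(2) by (auto simp: closed_cube_def periodic_cell_def dest!: spec[of _ i])
  have "shift s e \<inter> periodic_cell L \<noteq> {}" using s(2) unfolding periodic_edges_def by blast
  then obtain y where y: "y \<in> e" "y + s \<in> periodic_cell L" by blast
  then have "y \<in> closed_cube L" using periodic_edge_subset_cube[OF e] by blast
  then have "- 2 * L < s $ i" using y(2) by (auto simp: closed_cube_def periodic_cell_def dest!: spec[of _ i])
  then show "\<bar>s $ i\<bar> < 2 * L" using 1 by simp
qed

text \<open>If neither translate of the edge into the closed cube meets the half-open cell, then both
  adjacent elements lie on the upper side of the same coordinate plane.\<close>

lemma periodic_edge_exists:
  assumes e: "e \<in> interior_edges Tp"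
  obtains s where "s \<in> \<Lambda>" "shift s e \<in> periodic_edges L T"
proof -
  obtain A B n where AB: "A \<in> Tp" "B \<in> Tp" "A \<noteq> B" "e = A \<inter> B" "convex e" "aff_dim e = 2"
    by (rule interior_edge_sides[OF packing_periodic e])
  obtain p where p: "p \<in> rel_interior e" using AB(5,6) rel_interior_eq_empty by fastforce
  then have pe: "p \<in> e" using rel_interior_subset by blast
  \<comment> \<open>If translating \<open>e\<close> along with the element into the cube yields no
    representative, a relative interior point of \<open>e\<close> lands on some lower plane with
    coordinate -L. This coordinate is minimal over the element, so \<open>e\<close> lies in that
    plane and the outward normal is the negative axis vector.\<close>
  have lower: "\<exists>i. supporting_normal (shift s K) e (- axis i 1)"
    if K: "K \<in> T" "s \<in> \<Lambda>" "e = shift s K \<inter> M" "M \<in> Tp" "shift s K \<noteq> M" "shift (- s) e \<notin> periodic_edges L T" for K s M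
  proof -
    have eq: "shift (- s) e = K \<inter> shift (- s) M" unfolding K(3) shift_Int shift_shift by simp
    have "K \<noteq> shift (- s) M" using K(5) by (auto simp: image_image)
    moreover have "aff_dim (K \<inter> shift (- s) M) = 2" using AB(6) aff_dim_shift[of "- s" e] unfolding eq by simp
    ultimately have "K \<inter> shift (- s) M \<in> periodic_edges L T" if "K \<inter> shift (- s) M \<inter> periodic_cell L \<noteq> {}"
      unfolding periodic_edges_def using that shift_mem[OF K(4) period_lattice_minus[OF K(2)]] K(1)
      by (intro CollectI exI[of _ K] exI[of _ "shift (- s) M"] conjI refl)
    then have "K \<inter> shift (- s) M \<inter> periodic_cell L = {}" using K(6) unfolding eq by blast
    then have "shift (- s) e \<inter> periodic_cell L = {}" unfolding eq .
    then have "p - s \<notin> periodic_cell L" using pe by auto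
    then obtain i where i': "\<not> (- L < (p - s) $ i \<and> (p - s) $ i \<le> L)" unfolding periodic_cell_def by blast
    have cube: "- L \<le> (x - s) $ i" "(x - s) $ i \<le> L" if "x \<in> shift s K" for x i
      using that mesh_subset[OF K(1)] by (auto simp: closed_cube_def)
    have "p \<in> shift s K" using pe K(3) by blast
    then have i: "(p - s) $ i = - L" using i' cube[of p i] by linarith
    have "supporting_normal (shift s K) e (- axis i 1)"
      unfolding supporting_normal_def
    proof (intro conjI ballI)
      fix x y assume x: "x \<in> e" and y: "y \<in> shift s K"
      have "axis i 1 \<bullet> x = axis i 1 \<bullet> p"
      proof (rule rel_interior_min_const[OF AB(5) p _ x])
        fix z assume "z \<in> e"
        then show "axis i 1 \<bullet> p \<le> axis i 1 \<bullet> z" using cube(1)[of z i] i K(3) by (simp add: inner_axis')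
      qed
      then show "- axis i 1 \<bullet> (y - x) \<le> 0" using cube(1)[OF y, of i] i by (simp add: inner_axis' inner_diff_right)
    qed simp
    then show ?thesis by blast
  qed
  obtain s K where A: "A = shift s K" "s \<in> \<Lambda>" "K \<in> T" using AB(1) by (auto simp: periodic_mesh_def)
  obtain s' K' where B: "B = shift s' K'" "s' \<in> \<Lambda>" "K' \<in> T" using AB(2) by (auto simp: periodic_mesh_def)
  have sub: "e \<subseteq> A" "e \<subseteq> B" using AB(4) by auto
  have bodyAB: "convex_body A" "convex_body B" and disj: "interior A \<inter> interior B = {}"
    using packing_periodic AB(1-3) by (auto simp: packing_def pairwise_def)
  show ?thesis
  proof (rule ccontr)
    assume "\<not> thesis"
    then have n: "shift (- s) e \<notin> periodic_edges L T" "shift (- s') e \<notin> periodic_edges L T"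
      using that period_lattice_minus A(2) B(2) by blast+
    obtain i where i: "supporting_normal A e (- axis i 1)"
      using lower[OF A(3,2) _ AB(2) _ n(1)] AB(3,4) A(1) by blast
    obtain j where j: "supporting_normal B e (- axis j 1)"
      using lower[OF B(3,2) _ AB(1) _ n(2)] AB(3,4) B(1) by blast
    have "- axis j 1 = (- axis i 1 :: real^3) \<or> - axis j 1 = - (- axis i 1 :: real^3)"
      using plane_normal_unique[OF AB(6) supporting_normal_plane_normal[OF i sub(1)] supporting_normal_plane_normal[OF j sub(2)]] .
    then have "- axis j 1 = (- axis i 1 :: real^3)"
    proof
      \<comment> \<open>The opposite sign is impossible: component \<open>j\<close> is -1 on the
        left and 0 or 1 on the right.\<close>
      assume "- axis j 1 = - (- axis i 1 :: real^3)"
      then have "(- axis j 1 :: real^3) $ j = (axis i 1 :: real^3) $ j" by simp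
      then show ?thesis by (simp add: axis_def split: if_splits)
    qed
    then have "interior A \<inter> interior B \<noteq> {}"
      using same_normal_interiors_meet[OF AB(6,5) convex_bodyD(1)[OF bodyAB(1)] sub(1) convex_bodyD(5)[OF bodyAB(1)] i
          convex_bodyD(1)[OF bodyAB(2)] sub(2) convex_bodyD(5)[OF bodyAB(2)]] j by simp
    then show False using disj by simp
  qed
qed

text \<open>The left side normalises the element of each pair to lie in \<open>T\<close>, the right
  side normalises the edge to be a representative. Shifting a pair by a period passes from one
  normal form to the other, and \<open>h\<close> is invariant under it.\<close>

lemma sum_edges_periodic:
  fixes h :: "(real^3) set \<Rightarrow> (real^3) set \<Rightarrow> real"
  assumes h: "\<And>K e s. e \<in> interior_edges Tp \<Longrightarrow> K \<in> sides Tp e \<Longrightarrow> s \<in> \<Lambda> \<Longrightarrow> h (shift s K) (shift s e) = h K e"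
  shows "(\<Sum>K\<in>T. \<Sum>e\<in>edges_of K (near - {K}). h K e) = (\<Sum>e\<in>periodic_edges L T. \<Sum>K\<in>sides Tp e. h K e)"
proof -
  let ?A = "Sigma T (\<lambda>K. edges_of K (near - {K}))"
  let ?B = "Sigma (periodic_edges L T) (sides Tp)"
  have A: "(K, e) \<in> ?A \<longleftrightarrow> K \<in> T \<and> e \<in> interior_edges Tp \<and> K \<in> sides Tp e" for K e
    using edges_of_near by auto
  define \<sigma> where "\<sigma> K = (SOME s. s \<in> \<Lambda> \<and> shift s K \<in> T)" for K
  have \<sigma>: "\<sigma> K \<in> \<Lambda>" "shift (\<sigma> K) K \<in> T" if K: "K \<in> Tp" for K
  proof -
    obtain s K0 where "s \<in> \<Lambda>" "K0 \<in> T" "K = shift s K0" using periodic_meshE[OF K] .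
    then have "- s \<in> \<Lambda> \<and> shift (- s) K \<in> T" using period_lattice_minus shift_shift[of "- s" s K0] by simp
    then have "\<sigma> K \<in> \<Lambda> \<and> shift (\<sigma> K) K \<in> T" unfolding \<sigma>_def by (rule someI)
    then show "\<sigma> K \<in> \<Lambda>" "shift (\<sigma> K) K \<in> T" by blast+
  qed
  define g where "g = (\<lambda>(e, K). (shift (\<sigma> K) K, shift (\<sigma> K) e))"
  have inE: "e \<in> interior_edges Tp" "K \<in> Tp" "K \<in> sides Tp e" if "(e, K) \<in> ?B" for e K
    using that periodic_edges_subset by (auto simp: sides_def)
  have "bij_betw g ?B ?A"
    unfolding bij_betw_def
  proof
    show "inj_on g ?B"
    proof (rule inj_onI, clarify)
      fix e K e' K' assume m: "e \<in> periodic_edges L T" "K \<in> sides Tp e" "e' \<in> periodic_edges L T" "K' \<in> sides Tp e'"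
        and g: "g (e, K) = g (e', K')"
      have K: "K \<in> Tp" "K' \<in> Tp" using m(2,4) by (auto simp: sides_def)
      let ?s = "\<sigma> K + - \<sigma> K'"
      have s: "?s \<in> \<Lambda>" using period_lattice_diff[OF \<sigma>(1)[OF K(1)] \<sigma>(1)[OF K(2)]] by simp
      have "shift (- \<sigma> K') (shift (\<sigma> K) e) = shift (- \<sigma> K') (shift (\<sigma> K') e')"
        "shift (- \<sigma> K') (shift (\<sigma> K) K) = shift (- \<sigma> K') (shift (\<sigma> K') K')"
        using g by (simp_all add: g_def)
      then have *: "shift ?s e = e'" "shift ?s K = K'" unfolding shift_shift by simp_all
      \<comment> \<open>Two pairs with the same image differ by a lattice shift that carries one
        representative edge to another.\<close>
      then have "?s = 0" using periodic_edge_unique[OF m(1) s] m(3) by simp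
      then show "e = e' \<and> K = K'" using * by (simp del: add_uminus_conv_diff)
    qed
    show "g ` ?B = ?A"
    proof (intro equalityI subsetI)
      fix z assume "z \<in> g ` ?B"
      then obtain e K where z: "(e, K) \<in> ?B" "z = (shift (\<sigma> K) K, shift (\<sigma> K) e)" by (auto simp: g_def)
      note E = inE[OF z(1)]
      have "(shift (\<sigma> K) K, shift (\<sigma> K) e) \<in> ?A"
        unfolding A using \<sigma>[OF E(2)] shift_interior_edge[OF E(1)] sides_shift[OF _ E(3)] by blast
      then show "z \<in> ?A" unfolding z(2) .
    next
      fix z assume "z \<in> ?A"
      moreover obtain K e where "z = (K, e)" by (cases z)
      ultimately have z: "z = (K, e)" "K \<in> T" "e \<in> interior_edges Tp" "K \<in> sides Tp e"
        using A by simp_all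
      obtain s where s: "s \<in> \<Lambda>" "shift s e \<in> periodic_edges L T" using periodic_edge_exists[OF z(3)] .
      let ?K = "shift s K"
      have KT: "?K \<in> Tp" using z(2) s(1) mesh_subset_periodic shift_mem by blast
      have "s + \<sigma> ?K = 0"
        using shift_to_mesh_unique[OF z(2) period_lattice_add[OF s(1) \<sigma>(1)[OF KT]]] \<sigma>(2)[OF KT] unfolding shift_shift by blast
      then have "g (shift s e, ?K) = z" unfolding g_def z(1) prod.case shift_shift by simp
      moreover have "(shift s e, ?K) \<in> ?B" using s(2) sides_shift[OF s(1) z(4)] by blast
      ultimately show "z \<in> g ` ?B" by (metis imageI)
    qed
  qed
  then have "(\<Sum>z\<in>?B. case_prod h (g z)) = (\<Sum>z\<in>?A. case_prod h z)" by (rule sum.reindex_bij_betw)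
  moreover have "(\<Sum>z\<in>?B. case_prod h (g z)) = (\<Sum>(e, K)\<in>?B. h K e)"
  proof (rule sum.cong[OF refl], clarify)
    fix e K assume "e \<in> periodic_edges L T" "K \<in> sides Tp e"
    then have "(e, K) \<in> ?B" by blast
    note E = inE[OF this]
    show "case_prod h (g (e, K)) = h K e" unfolding g_def prod.case by (rule h[OF E(1,3) \<sigma>(1)[OF E(2)]])
  qed
  moreover have "(\<Sum>K\<in>T. \<Sum>e\<in>edges_of K (near - {K}). h K e) = (\<Sum>z\<in>?A. case_prod h z)"
    using finite_mesh finite_edges_of[OF body_neighbours_near] by (subst sum.Sigma) auto
  moreover have "(\<Sum>e\<in>periodic_edges L T. \<Sum>K\<in>sides Tp e. h K e) = (\<Sum>(e, K)\<in>?B. h K e)"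
  proof (subst sum.Sigma)
    show "\<forall>e\<in>periodic_edges L T. finite (sides Tp e)"
    proof
      fix e assume "e \<in> periodic_edges L T"
      then have "e \<in> interior_edges Tp" using periodic_edges_subset by blast
      then obtain A B n where "sides Tp e = {A, B}" by (rule interior_edge_sides[OF packing_periodic])
      then show "finite (sides Tp e)" by simp
    qed
  qed (use finite_periodic_edges in auto)
  ultimately show ?thesis by simp
qed

end

section \<open>Polynomials on an element\<close>

lemma finite_multi_indices: "finite (multi_indices m :: ('a::euclidean_space \<Rightarrow> nat) set)"
proof (rule finite_subset)
  show "finite {\<alpha>. \<forall>b. (b \<in> (Basis :: 'a set) \<longrightarrow> \<alpha> b \<in> {..m}) \<and> (b \<notin> Basis \<longrightarrow> \<alpha> b = 0)}"
    by (rule finite_set_of_finite_funs) auto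
  show "multi_indices m \<subseteq> {\<alpha>. \<forall>b. (b \<in> (Basis :: 'a set) \<longrightarrow> \<alpha> b \<in> {..m}) \<and> (b \<notin> Basis \<longrightarrow> \<alpha> b = 0)}"
  proof (intro subsetI CollectI allI conjI impI)
    fix \<alpha> :: "'a \<Rightarrow> nat" and b assume \<alpha>: "\<alpha> \<in> multi_indices m"
    show "\<alpha> b \<in> {..m}" if "b \<in> Basis"
      using member_le_sum[of b Basis \<alpha>] that \<alpha> by (auto simp: multi_indices_def)
    show "\<alpha> b = 0" if "b \<notin> Basis" using that \<alpha> by (auto simp: multi_indices_def)
  qed
qed

lemma real_polynomial_function_monomial:
  "real_polynomial_function (\<lambda>x::'a::euclidean_space. \<Prod>b\<in>Basis. (x \<bullet> b) ^ \<alpha> b)"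
  by (intro real_polynomial_function_prod real_polynomial_function_power real_polynomial_function.intros(1)
      bounded_linear_inner_left) simp

text \<open>The polynomial is defined on the whole space and thus provides continuous extensions,
  with derivatives, up to the element boundary.\<close>

lemma poly_on_polynomial:
  assumes "poly_on m D u"
  obtains p where "real_polynomial_function p" "\<forall>x\<in>D. u x = p x"
proof -
  obtain c where c: "\<And>x. x \<in> D \<Longrightarrow> u x = (\<Sum>\<alpha>\<in>multi_indices m. c \<alpha> * (\<Prod>b\<in>Basis. (x \<bullet> b) ^ \<alpha> b))"
    using assms unfolding poly_on_def by blast
  have "real_polynomial_function (\<lambda>x. \<Sum>\<alpha>\<in>multi_indices m. c \<alpha> * (\<Prod>b\<in>Basis. (x \<bullet> b) ^ \<alpha> b))"
    by (intro real_polynomial_function_sum finite_multi_indices real_polynomial_function.intros(4)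
        real_polynomial_function.intros(2) real_polynomial_function_monomial)
  then show ?thesis using that c by blast
qed

lemma real_polynomial_function_continuous:
  fixes p :: "'a::euclidean_space \<Rightarrow> real"
  assumes "real_polynomial_function p"
  shows "continuous_on S p"
  using assms
  by induction (auto intro: linear_continuous_on continuous_on_const continuous_on_add continuous_on_mult)

lemma real_polynomial_function_derivative:
  fixes p :: "'a::euclidean_space \<Rightarrow> real"
  assumes "real_polynomial_function p"
  shows "\<exists>D. (\<forall>x. (p has_derivative D x) (at x)) \<and> (\<forall>v. continuous_on UNIV (\<lambda>x. D x v))"
  using assms
proof induction
  case (linear f)
  then have "\<forall>x. (f has_derivative f) (at x)" using bounded_linear_imp_has_derivative by blast
  then show ?case by (intro exI[of _ "\<lambda>x. f"]) simp
next
  case (const c)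
  show ?case by (intro exI[of _ "\<lambda>x v. 0"]) simp
next
  case (add f g)
  then obtain D D' where "\<forall>x. (f has_derivative D x) (at x)" "\<forall>v. continuous_on UNIV (\<lambda>x. D x v)"
    "\<forall>x. (g has_derivative D' x) (at x)" "\<forall>v. continuous_on UNIV (\<lambda>x. D' x v)" by blast
  then show ?case
    by (intro exI[of _ "\<lambda>x v. D x v + D' x v"]) (auto intro!: derivative_eq_intros continuous_intros)
next
  case (mult f g)
  then obtain D D' where D: "\<forall>x. (f has_derivative D x) (at x)" "\<forall>v. continuous_on UNIV (\<lambda>x. D x v)"
    "\<forall>x. (g has_derivative D' x) (at x)" "\<forall>v. continuous_on UNIV (\<lambda>x. D' x v)" by blast
  moreover have "continuous_on UNIV f" "continuous_on UNIV g"
    using mult.hyps real_polynomial_function_continuous by blast+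
  ultimately show ?case
    by (intro exI[of _ "\<lambda>x v. f x * D' x v + D x v * g x"]) (auto intro!: has_derivative_mult continuous_intros)
qed

text \<open>This turns differentiability in time of point values into differentiability of coefficients.\<close>

lemma interpolation_span:
  fixes v :: "'i \<Rightarrow> 'a::euclidean_space \<Rightarrow> real"
  assumes "finite A" "\<And>i. i \<in> A \<Longrightarrow> real_polynomial_function (v i)"
  shows "\<exists>(n::nat) z \<phi>. (\<forall>j<n. z j \<in> S \<and> real_polynomial_function (\<phi> j)) \<and>
    (\<forall>c. \<forall>x\<in>S. (\<Sum>i\<in>A. c i * v i x) = (\<Sum>j<n. (\<Sum>i\<in>A. c i * v i (z j)) * \<phi> j x))"
  using assms
proof (induction A)
  case empty
  show ?case by (intro exI[of _ 0]) simp
next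
  case (insert b A)
  have "\<exists>(n::nat) z \<phi>. (\<forall>j<n. z j \<in> S \<and> real_polynomial_function (\<phi> j)) \<and>
    (\<forall>c. \<forall>x\<in>S. (\<Sum>i\<in>A. c i * v i x) = (\<Sum>j<n. (\<Sum>i\<in>A. c i * v i (z j)) * \<phi> j x))"
    using insert.IH insert.prems by simp
  then obtain n :: nat and z \<phi> where "(\<forall>j<n. z j \<in> S \<and> real_polynomial_function (\<phi> j)) \<and>
    (\<forall>c. \<forall>x\<in>S. (\<Sum>i\<in>A. c i * v i x) = (\<Sum>j<n. (\<Sum>i\<in>A. c i * v i (z j)) * \<phi> j x))"
    by (elim exE)
  then have n: "\<And>j. j < n \<Longrightarrow> z j \<in> S" "\<And>j. j < n \<Longrightarrow> real_polynomial_function (\<phi> j)"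
    "\<And>c x. x \<in> S \<Longrightarrow> (\<Sum>i\<in>A. c i * v i x) = (\<Sum>j<n. (\<Sum>i\<in>A. c i * v i (z j)) * \<phi> j x)"
    by blast+
  \<comment> \<open>The error of interpolating \<open>v b\<close> at the nodes found so far. If it
    vanishes on \<open>S\<close>, these nodes suffice also for the enlarged family.\<close>
  define w where "w x = v b x - (\<Sum>j<n. v b (z j) * \<phi> j x)" for x
  have pw: "real_polynomial_function w"
    unfolding w_def using insert.prems n(2) by (intro real_polynomial_function_diff real_polynomial_function_sum) auto
  have rem: "(\<Sum>i\<in>insert b A. c i * v i x) = (\<Sum>j<n. (\<Sum>i\<in>insert b A. c i * v i (z j)) * \<phi> j x) + c b * w x"
    if "x \<in> S" for c x
  proof -
    have "(\<Sum>i\<in>insert b A. c i * v i x) = c b * v b x + (\<Sum>j<n. (\<Sum>i\<in>A. c i * v i (z j)) * \<phi> j x)"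
      using insert.hyps n(3)[OF that, of c] by simp
    also have "c b * v b x = (\<Sum>j<n. c b * v b (z j) * \<phi> j x) + c b * w x"
      by (simp add: w_def right_diff_distrib sum_distrib_left mult.assoc)
    also have "(\<Sum>j<n. c b * v b (z j) * \<phi> j x) + c b * w x + (\<Sum>j<n. (\<Sum>i\<in>A. c i * v i (z j)) * \<phi> j x)
        = (\<Sum>j<n. (c b * v b (z j) + (\<Sum>i\<in>A. c i * v i (z j))) * \<phi> j x) + c b * w x"
      by (simp add: distrib_right sum.distrib)
    also have "(\<Sum>j<n. (c b * v b (z j) + (\<Sum>i\<in>A. c i * v i (z j))) * \<phi> j x) = (\<Sum>j<n. (\<Sum>i\<in>insert b A. c i * v i (z j)) * \<phi> j x)"
      using insert.hyps by simp
    finally show ?thesis .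
  qed
  show ?case
  proof (cases "\<forall>x\<in>S. w x = 0")
    case True
    then show ?thesis using n rem by (intro exI[of _ n] exI[of _ z] exI[of _ \<phi>]) auto
  next
    case False
    then obtain x0 where x0: "x0 \<in> S" "w x0 \<noteq> 0" by blast
    \<comment> \<open>A point where the error is nonzero becomes a new node. The normalised error
      \<psi> is its basis function, and each old basis function is corrected to vanish
      there.\<close>
    define \<psi> where "\<psi> x = w x / w x0" for x
    define z' where "z' = z(n := x0)"
    define \<phi>' where "\<phi>' j = (if j = n then \<psi> else (\<lambda>x. \<phi> j x - \<phi> j x0 * \<psi> x))" for j
    have p\<psi>: "real_polynomial_function \<psi>" unfolding \<psi>_def using pw by (rule real_polynomial_function_divide)
    have "real_polynomial_function (\<lambda>x. \<phi> j x - \<phi> j x0 * \<psi> x)" if "j < n" for j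
      using n(2)[OF that] p\<psi> by (intro real_polynomial_function_diff real_polynomial_function.intros(4)
          real_polynomial_function.intros(2))
    then have "z' j \<in> S \<and> real_polynomial_function (\<phi>' j)" if "j < Suc n" for j
      using that n(1,2) x0(1) p\<psi> by (auto simp: z'_def \<phi>'_def less_Suc_eq)
    moreover have "(\<Sum>i\<in>insert b A. c i * v i x) = (\<Sum>j<Suc n. (\<Sum>i\<in>insert b A. c i * v i (z' j)) * \<phi>' j x)"
      if x: "x \<in> S" for c x
    proof -
      let ?p = "\<lambda>x. \<Sum>i\<in>insert b A. c i * v i x"
      have "(\<Sum>j<Suc n. ?p (z' j) * \<phi>' j x) = (\<Sum>j<n. ?p (z j) * (\<phi> j x - \<phi> j x0 * \<psi> x)) + ?p x0 * \<psi> x"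
        by (simp add: z'_def \<phi>'_def)
      also have "\<dots> = (\<Sum>j<n. ?p (z j) * \<phi> j x) + (?p x0 - (\<Sum>j<n. ?p (z j) * \<phi> j x0)) * \<psi> x"
        by (simp add: right_diff_distrib left_diff_distrib sum_subtractf sum_distrib_right mult.assoc)
      also have "?p x0 - (\<Sum>j<n. ?p (z j) * \<phi> j x0) = c b * w x0" using rem[OF x0(1), of c] by simp
      also have "c b * w x0 * \<psi> x = c b * w x" using x0(2) by (simp add: \<psi>_def)
      finally show ?thesis using rem[OF x, of c] by simp
    qed
    ultimately show ?thesis by blast
  qed
qed

text \<open>Nodes and basis functions depend only on the degree and the set, not on
  \<open>u\<close>, so one formula serves at all times.\<close>

lemma poly_on_interpolation:
  fixes S :: "'a::euclidean_space set"
  obtains n :: nat and z and \<phi> where "\<forall>j<n. z j \<in> S" "\<forall>j<n. real_polynomial_function (\<phi> j)"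
    "\<forall>u. poly_on m S u \<longrightarrow> (\<forall>x\<in>S. u x = (\<Sum>j<n. u (z j) * \<phi> j x))"
proof -
  let ?m = "\<lambda>\<alpha> (x::'a). \<Prod>b\<in>Basis. (x \<bullet> b) ^ \<alpha> b"
  have "\<exists>(n::nat) z \<phi>. (\<forall>j<n. z j \<in> S \<and> real_polynomial_function (\<phi> j)) \<and>
    (\<forall>c. \<forall>x\<in>S. (\<Sum>\<alpha>\<in>multi_indices m. c \<alpha> * ?m \<alpha> x) = (\<Sum>j<n. (\<Sum>\<alpha>\<in>multi_indices m. c \<alpha> * ?m \<alpha> (z j)) * \<phi> j x))"
    by (rule interpolation_span[OF finite_multi_indices real_polynomial_function_monomial])
  then obtain n :: nat and z \<phi> where n: "\<forall>j<n. z j \<in> S \<and> real_polynomial_function (\<phi> j)"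
    and eq: "\<forall>c. \<forall>x\<in>S. (\<Sum>\<alpha>\<in>multi_indices m. c \<alpha> * ?m \<alpha> x)
      = (\<Sum>j<n. (\<Sum>\<alpha>\<in>multi_indices m. c \<alpha> * ?m \<alpha> (z j)) * \<phi> j x)"
    by (elim exE conjE)
  have "u x = (\<Sum>j<n. u (z j) * \<phi> j x)" if u: "poly_on m S u" "x \<in> S" for u x
  proof -
    obtain c where c: "\<And>x. x \<in> S \<Longrightarrow> u x = (\<Sum>\<alpha>\<in>multi_indices m. c \<alpha> * (\<Prod>b\<in>Basis. (x \<bullet> b) ^ \<alpha> b))"
      using u(1) unfolding poly_on_def by blast
    have "u x = (\<Sum>j<n. (\<Sum>\<alpha>\<in>multi_indices m. c \<alpha> * ?m \<alpha> (z j)) * \<phi> j x)"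
      by (rule trans[OF c[OF u(2)] bspec[OF spec[OF eq, of c] u(2)]])
    also have "\<dots> = (\<Sum>j<n. u (z j) * \<phi> j x)" using n c by (intro sum.cong) auto
    finally show ?thesis .
  qed
  note * = this
  show ?thesis
  proof (rule that[of n z \<phi>])
    show "\<forall>u. poly_on m S u \<longrightarrow> (\<forall>x\<in>S. u x = (\<Sum>j<n. u (z j) * \<phi> j x))"
      by (intro allI impI ballI) (rule *)
  qed (use n in simp_all)
qed

section \<open>Integrals and traces of elementwise polynomials\<close>

lemma set_integrable_interior:
  fixes F G :: "'a::euclidean_space \<Rightarrow> real"
  assumes K: "convex_body K" and G: "continuous_on K G" and eq: "\<And>x. x \<in> interior K \<Longrightarrow> F x = G x"
  shows "set_integrable lebesgue K F"
  by (rule absolutely_integrable_spike[OF set_lebesgue_integral_compact(1)[OF convex_bodyD(2)[OF K] G] negligible_diff_interior[OF K]])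
    (use eq in blast)

text \<open>Separation of variables reduces differentiation under the integral to a finite sum. The
  given pointwise derivative \<open>F'\<close> agrees with the termwise one by uniqueness of
  derivatives, for which \<open>at t within I\<close> must be nontrivial.\<close>

lemma has_derivative_integral_separable:
  fixes K :: "'a::euclidean_space set" and \<phi> :: "'j \<Rightarrow> 'a \<Rightarrow> real"
  assumes K: "convex_body K" and J: "finite J" and \<phi>: "\<And>j. j \<in> J \<Longrightarrow> continuous_on K (\<phi> j)"
    and a: "\<And>j. j \<in> J \<Longrightarrow> (a j has_real_derivative a' j) (at t within I)"
    and F: "\<And>\<tau> x. \<tau> \<in> I \<Longrightarrow> x \<in> interior K \<Longrightarrow> F \<tau> x = (\<Sum>j\<in>J. a j \<tau> * \<phi> j x)"
    and F': "\<And>x. x \<in> interior K \<Longrightarrow> ((\<lambda>\<tau>. F \<tau> x) has_real_derivative F' x) (at t within I)"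
    and t: "t \<in> I" "at t within I \<noteq> bot"
  shows "((\<lambda>\<tau>. set_lebesgue_integral lebesgue K (F \<tau>)) has_real_derivative set_lebesgue_integral lebesgue K F') (at t within I)"
proof -
  have int: "set_integrable lebesgue K (\<phi> j)" if "j \<in> J" for j
    by (rule set_lebesgue_integral_compact(1)[OF convex_bodyD(2)[OF K] \<phi>[OF that]])
  have sum: "set_lebesgue_integral lebesgue K (\<lambda>x. \<Sum>j\<in>J. c j * \<phi> j x) = (\<Sum>j\<in>J. c j * set_lebesgue_integral lebesgue K (\<phi> j))" for c
  proof -
    have "set_lebesgue_integral lebesgue K (\<lambda>x. \<Sum>j\<in>J. c j * \<phi> j x)
        = integral\<^sup>L lebesgue (\<lambda>x. \<Sum>j\<in>J. c j * (indicator K x *\<^sub>R \<phi> j x))"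
      unfolding set_lebesgue_integral_def by (simp add: sum_distrib_left mult_ac)
    also have "\<dots> = (\<Sum>j\<in>J. integral\<^sup>L lebesgue (\<lambda>x. c j * (indicator K x *\<^sub>R \<phi> j x)))"
      by (rule Bochner_Integration.integral_sum) (use int in \<open>simp add: set_integrable_def\<close>)
    also have "\<dots> = (\<Sum>j\<in>J. c j * set_lebesgue_integral lebesgue K (\<phi> j))"
      by (simp add: set_lebesgue_integral_def)
    finally show ?thesis .
  qed
  have "((\<lambda>\<tau>. \<Sum>j\<in>J. a j \<tau> * set_lebesgue_integral lebesgue K (\<phi> j)) has_real_derivative
      (\<Sum>j\<in>J. a' j * set_lebesgue_integral lebesgue K (\<phi> j))) (at t within I)"
    using a by (auto intro!: DERIV_sum DERIV_cmult_right)
  then have "((\<lambda>\<tau>. set_lebesgue_integral lebesgue K (F \<tau>)) has_real_derivative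
      (\<Sum>j\<in>J. a' j * set_lebesgue_integral lebesgue K (\<phi> j))) (at t within I)"
  proof (rule has_field_derivative_transform_within[OF _ zero_less_one t(1)])
    fix \<tau> assume "\<tau> \<in> I"
    then show "(\<Sum>j\<in>J. a j \<tau> * set_lebesgue_integral lebesgue K (\<phi> j)) = set_lebesgue_integral lebesgue K (F \<tau>)"
      using set_integral_interior_cong[OF K F] sum[of "\<lambda>j. a j \<tau>"] by simp
  qed
  moreover have "F' x = (\<Sum>j\<in>J. a' j * \<phi> j x)" if x: "x \<in> interior K" for x
  proof -
    have "((\<lambda>\<tau>. \<Sum>j\<in>J. a j \<tau> * \<phi> j x) has_real_derivative (\<Sum>j\<in>J. a' j * \<phi> j x)) (at t within I)"
      using a by (auto intro!: DERIV_sum DERIV_cmult_right)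
    then have "((\<lambda>\<tau>. F \<tau> x) has_real_derivative (\<Sum>j\<in>J. a' j * \<phi> j x)) (at t within I)"
      by (rule has_field_derivative_transform_within[OF _ zero_less_one t(1)]) (simp add: F x)
    then show ?thesis
      using has_field_derivative_unique[OF F'[OF x] _ t(2)] by blast
  qed
  then have "set_lebesgue_integral lebesgue K F' = (\<Sum>j\<in>J. a' j * set_lebesgue_integral lebesgue K (\<phi> j))"
    using set_integral_interior_cong[OF K, of F' "\<lambda>x. \<Sum>j\<in>J. a' j * \<phi> j x"] sum[of a'] by simp
  ultimately show ?thesis by simp
qed

text \<open>Fubini is applied to the continuous \<open>G\<close>. For interior \<open>x\<close> the
  slices of \<open>F\<close> and \<open>G\<close> agree in the interior of \<open>M\<close>, so both
  the inner and the outer integral may be switched back to \<open>F\<close>.\<close>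

lemma set_integral_Times:
  fixes F :: "'a::euclidean_space \<times> 'b::euclidean_space \<Rightarrow> real"
  assumes K: "convex_body K" and M: "convex_body M"
    and G: "continuous_on (K \<times> M) G" and eq: "\<And>z. z \<in> interior (K \<times> M) \<Longrightarrow> F z = G z"
  shows "set_lebesgue_integral lebesgue (K \<times> M) F
    = set_lebesgue_integral lebesgue K (\<lambda>x. set_lebesgue_integral lebesgue M (\<lambda>\<xi>. F (x, \<xi>)))"
    and "set_integrable lebesgue K (\<lambda>x. set_lebesgue_integral lebesgue M (\<lambda>\<xi>. F (x, \<xi>)))"
proof -
  have KM: "convex_body (K \<times> M)" by (rule convex_body_Times[OF K M])
  have cpt: "compact (K \<times> M)" by (rule convex_bodyD(2)[OF KM])
  let ?H = "\<lambda>z. indicator (K \<times> M) z *\<^sub>R G z"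
  have "integrable lborel ?H" using set_lebesgue_integral_compact(3)[OF cpt G] by (simp add: set_integrable_def)
  then have int: "integrable (lborel \<Otimes>\<^sub>M lborel) ?H" by (simp add: lborel_prod)
  have contx: "continuous_on M (\<lambda>\<xi>. G (x, \<xi>))" if "x \<in> K" for x
    by (rule continuous_on_compose2[OF G]) (use that in \<open>auto intro!: continuous_intros\<close>)
  have inner: "(LINT \<xi>|lborel. ?H (x, \<xi>)) = indicator K x *\<^sub>R set_lebesgue_integral lebesgue M (\<lambda>\<xi>. G (x, \<xi>))" for x
  proof (cases "x \<in> K")
    case True
    then show ?thesis
      using set_lebesgue_integral_compact(2)[OF convex_bodyD(2)[OF M] contx[OF True]]
      by (simp add: set_lebesgue_integral_def indicator_times)
  qed (simp add: indicator_times)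
  have intb: "integrable lborel (\<lambda>x. indicator K x *\<^sub>R set_lebesgue_integral lebesgue M (\<lambda>\<xi>. G (x, \<xi>)))"
    using lborel_pair.integrable_fst'[OF int] unfolding inner .
  then have meas: "(\<lambda>x. indicator K x *\<^sub>R set_lebesgue_integral lebesgue M (\<lambda>\<xi>. G (x, \<xi>))) \<in> borel_measurable lborel"
    by (rule borel_measurable_integrable)
  have eq_inner: "set_lebesgue_integral lebesgue M (\<lambda>\<xi>. G (x, \<xi>)) = set_lebesgue_integral lebesgue M (\<lambda>\<xi>. F (x, \<xi>))"
    if "x \<in> interior K" for x
    by (rule set_integral_interior_cong[OF M]) (use that in \<open>simp add: eq interior_Times\<close>)
  have "set_integrable lebesgue K (\<lambda>x. set_lebesgue_integral lebesgue M (\<lambda>\<xi>. G (x, \<xi>)))"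
    using intb integrable_completion[OF meas] by (simp add: set_integrable_def)
  then show "set_integrable lebesgue K (\<lambda>x. set_lebesgue_integral lebesgue M (\<lambda>\<xi>. F (x, \<xi>)))"
    by (rule absolutely_integrable_spike[OF _ negligible_diff_interior[OF K]]) (simp add: eq_inner)
  have "set_lebesgue_integral lebesgue (K \<times> M) F = set_lebesgue_integral lebesgue (K \<times> M) G"
    by (rule set_integral_interior_cong[OF KM eq])
  also have "\<dots> = integral\<^sup>L (lborel \<Otimes>\<^sub>M lborel) ?H"
    using set_lebesgue_integral_compact(2)[OF cpt G] by (simp add: set_lebesgue_integral_def lborel_prod)
  also have "\<dots> = (LINT x|lborel. LINT \<xi>|lborel. ?H (x, \<xi>))"
    using lborel_pair.integral_fst'[OF int] by simp
  also have "\<dots> = set_lebesgue_integral lebesgue K (\<lambda>x. set_lebesgue_integral lebesgue M (\<lambda>\<xi>. G (x, \<xi>)))"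
    unfolding inner set_lebesgue_integral_def[of lebesgue K] by (rule integral_completion[OF meas, symmetric])
  also have "\<dots> = set_lebesgue_integral lebesgue K (\<lambda>x. set_lebesgue_integral lebesgue M (\<lambda>\<xi>. F (x, \<xi>)))"
    by (rule set_integral_interior_cong[OF K eq_inner])
  finally show "set_lebesgue_integral lebesgue (K \<times> M) F
    = set_lebesgue_integral lebesgue K (\<lambda>x. set_lebesgue_integral lebesgue M (\<lambda>\<xi>. F (x, \<xi>)))" .
qed

lemma islimpt_interior_convex:
  fixes K :: "'a::euclidean_space set"
  assumes "convex K" "interior K \<noteq> {}" "x \<in> K"
  shows "x islimpt interior K"
proof -
  have "x \<in> closure (interior K)" using convex_closure_interior[OF assms(1,2)] assms(3) closure_subset by blast
  then have "x \<in> interior K \<or> x islimpt interior K" by (simp add: closure_def)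
  then show ?thesis using interior_limit_point[of x "interior K"] by auto
qed

text \<open>Every point of a convex body is a limit point of its interior, so the limit defining the
  trace is unique and equals the value of the continuous extension.\<close>

lemma elem_trace_eq:
  fixes u P :: "real^3 \<Rightarrow> 'b::real_normed_vector"
  assumes K: "convex_body K" and x: "x \<in> K" and P: "isCont P x" and eq: "\<And>y. y \<in> interior K \<Longrightarrow> u y = P y"
  shows "elem_trace K u x = P x"
proof -
  have "x islimpt interior K" using islimpt_interior_convex[OF convex_bodyD(1,5)[OF K] x] .
  then have nt: "\<not> trivial_limit (at x within interior K)" by (simp add: trivial_limit_within)
  have "(P \<longlongrightarrow> P x) (at x within interior K)"
    using P by (simp add: isCont_def tendsto_within_subset[where S = UNIV])
  moreover have "\<forall>\<^sub>F y in at x within interior K. u y = P y"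
    using eq by (simp add: eventually_at_filter)
  ultimately have "(u \<longlongrightarrow> P x) (at x within interior K)" using tendsto_cong by fast
  then show ?thesis unfolding elem_trace_def using tendsto_Lim[OF nt] by blast
qed

section \<open>Maxwell part\<close>

lemma curl_eq:
  fixes U P :: "real^3 \<Rightarrow> real^3"
  assumes D: "\<And>i. ((\<lambda>x. P x $ i) has_derivative D i) (at x)"
    and S: "open S" "x \<in> S" "\<And>y. y \<in> S \<Longrightarrow> U y = P y"
  shows "curl U x = vector [D 3 (axis 2 1) - D 2 (axis 3 1), D 1 (axis 3 1) - D 3 (axis 1 1), D 2 (axis 1 1) - D 1 (axis 2 1)]"
proof -
  have "(P has_derivative (\<lambda>h. \<chi> i. D i h)) (at x)"
    unfolding has_derivative_componentwise_within[of P]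
    using D by (auto simp: Basis_vec_def inner_axis)
  then have "(U has_derivative (\<lambda>h. \<chi> i. D i h)) (at x)"
    by (rule has_derivative_transform_within_open[OF _ S(1,2)]) (simp add: S(3))
  then have "frechet_derivative U (at x) = (\<lambda>h. \<chi> i. D i h)"
    using frechet_derivative_at by metis
  then show ?thesis by (simp add: curl_def Let_def jacobian_def matrix_def)
qed

lemma surface_integral_inner:
  fixes F :: "real^3 \<Rightarrow> real^3"
  assumes e: "aff_dim e = 2" "compact e" and F: "continuous_on e F"
  shows "surface_integral e (\<lambda>x. F x \<bullet> n) = (\<Sum>i\<in>UNIV. surface_integral e (\<lambda>x. F x $ i) * n $ i)"
proof -
  have c: "continuous_on e (\<lambda>x. F x $ i)" for i using F by (intro continuous_intros)
  have c': "continuous_on e (\<lambda>x. n $ i * F x $ i)" for i by (intro continuous_intros c)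
  have "surface_integral e (\<lambda>x. F x \<bullet> n) = surface_integral e (\<lambda>x. (n $ 1 * F x $ 1 + n $ 2 * F x $ 2) + n $ 3 * F x $ 3)"
    by (rule surface_integral_cong) (simp add: inner_vec_def sum_3 mult.commute)
  also have "\<dots> = surface_integral e (\<lambda>x. n $ 1 * F x $ 1 + n $ 2 * F x $ 2) + surface_integral e (\<lambda>x. n $ 3 * F x $ 3)"
    by (rule surface_integral_linear(1)[OF e]) (intro continuous_intros c' c)+
  also have "surface_integral e (\<lambda>x. n $ 1 * F x $ 1 + n $ 2 * F x $ 2) = surface_integral e (\<lambda>x. n $ 1 * F x $ 1) + surface_integral e (\<lambda>x. n $ 2 * F x $ 2)"
    by (rule surface_integral_linear(1)[OF e c' c'])
  finally show ?thesis
    unfolding surface_integral_linear(2)[OF e c c] by (simp add: sum_3 mult.commute)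
qed

lemma outer_normal_translation:
  "outer_normal ((\<lambda>x. x + s) ` K) ((\<lambda>x. x + s) ` e) = outer_normal K e"
  by (simp add: outer_normal_def)

lemma continuous_on_polynomial_components:
  fixes P :: "real^3 \<Rightarrow> real^3"
  assumes "\<And>i. real_polynomial_function (\<lambda>x. P x $ i)"
  shows "continuous_on S P"
  by (subst continuous_on_componentwise)
    (use assms real_polynomial_function_continuous in \<open>auto simp: Basis_vec_def inner_axis\<close>)

text \<open>Here \<open>a\<close>, \<open>a'\<close> are the traces of E and \<open>b\<close>,
  \<open>b'\<close> those of B. The averages produce the jump of the normal component of E x B; the
  upwind corrections produce half of the squared tangential jumps.\<close>

lemma maxwell_flux_identity:
  fixes a a' b b' n :: "real^3"
  defines "E \<equiv> cross3 a n + cross3 a' (- n)" and "B \<equiv> cross3 b n + cross3 b' (- n)"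
  shows "((1/2) *\<^sub>R (a + a') + (1/2) *\<^sub>R B) \<bullet> B - ((1/2) *\<^sub>R (b + b') - (1/2) *\<^sub>R E) \<bullet> E
    = 1/2 * ((norm E)\<^sup>2 + (norm B)\<^sup>2) + (cross3 a b \<bullet> n + cross3 a' b' \<bullet> (- n))"
proof -
  have "1/2 * ((a + a') \<bullet> B - (b + b') \<bullet> E) = cross3 a b \<bullet> n + cross3 a' b' \<bullet> (- n)"
    by (simp add: E_def B_def inner_vec_def sum_3 cross3_def algebra_simps)
  moreover have "((1/2) *\<^sub>R (a + a') + (1/2) *\<^sub>R B) \<bullet> B - ((1/2) *\<^sub>R (b + b') - (1/2) *\<^sub>R E) \<bullet> E
      = 1/2 * (E \<bullet> E + B \<bullet> B) + 1/2 * ((a + a') \<bullet> B - (b + b') \<bullet> E)"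
    unfolding inner_add_left inner_diff_left inner_scaleR_left by (simp add: field_simps)
  ultimately show ?thesis unfolding power2_norm_eq_inner by simp
qed

context torus_mesh
begin

lemma U_space_polynomial:
  assumes U: "U \<in> U_space L T r" and K: "K \<in> T"
  obtains P where "\<forall>i. real_polynomial_function (\<lambda>x. P x $ i)" "\<forall>x\<in>interior K. U x = P x"
proof -
  have "\<exists>p. real_polynomial_function p \<and> (\<forall>x\<in>interior K. U x $ i = p x)" for i
  proof -
    have "poly_on r (interior K) (\<lambda>x. U x $ i)" using U K by (simp add: U_space_def)
    then obtain p where "real_polynomial_function p" "\<forall>x\<in>interior K. U x $ i = p x"
      by (rule poly_on_polynomial)
    then show ?thesis by blast
  qed
  then obtain p where p: "\<And>i. real_polynomial_function (p i) \<and> (\<forall>x\<in>interior K. U x $ i = p i x)" by metis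
  show ?thesis by (rule that[of "\<lambda>x. \<chi> i. p i x"]) (use p in \<open>simp_all add: vec_eq_iff\<close>)
qed

text \<open>One \<open>P\<close> describes the traces on all translates of \<open>K\<close>. The
  shift 0 gives continuity of the trace, and comparing shifts gives its periodicity.\<close>

lemma U_space_trace:
  assumes U: "U \<in> U_space L T r" and K: "K \<in> Tp"
  obtains P where "continuous_on UNIV P" "\<forall>s\<in>\<Lambda>. \<forall>x\<in>K. elem_trace (shift s K) U (x + s) = P x"
proof -
  obtain t K0 where K0: "t \<in> \<Lambda>" "K0 \<in> T" "K = shift t K0" using periodic_meshE[OF K] .
  obtain P where "\<forall>i. real_polynomial_function (\<lambda>x. P x $ i)" "\<forall>x\<in>interior K0. U x = P x"
    using U_space_polynomial[OF U K0(2)] .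
  then have P: "\<And>i. real_polynomial_function (\<lambda>x. P x $ i)" "\<And>x. x \<in> interior K0 \<Longrightarrow> U x = P x"
    by blast+
  have cont: "continuous_on UNIV P" by (rule continuous_on_polynomial_components[OF P(1)])
  have shifted: "continuous_on UNIV (\<lambda>x. P (x - a))" for a
    by (rule continuous_on_compose2[OF cont]) (auto intro!: continuous_intros)
  have "elem_trace (shift s K) U (x + s) = P (x - t)" if s: "s \<in> \<Lambda>" and x: "x \<in> K" for s x
  proof -
    have "elem_trace (shift s K) U (x + s) = P (x + s - (t + s))"
    proof (rule elem_trace_eq)
      show "convex_body (shift s K)"
        using shift_mem[OF K s] packing_periodic by (simp add: packing_def)
      show "x + s \<in> shift s K" using x by simp
      show "isCont (\<lambda>x. P (x - (t + s))) (x + s)"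
        using shifted by (simp add: continuous_on_eq_continuous_at)
      fix y assume "y \<in> interior (shift s K)"
      then have y: "y - (t + s) \<in> interior K0"
        unfolding K0(3) shift_shift interior_shift by auto
      have "U y = U ((y - (t + s)) + (t + s))" by simp
      also have "\<dots> = U (y - (t + s))"
        using U period_lattice_add[OF K0(1) s] unfolding U_space_def by blast
      also have "\<dots> = P (y - (t + s))" by (rule P(2)[OF y])
      finally show "U y = P (y - (t + s))" .
    qed
    then show ?thesis by (simp add: algebra_simps)
  qed
  then show ?thesis by (intro that[OF shifted[of t]]) blast
qed

lemma continuous_on_trace:
  assumes U: "U \<in> U_space L T r" and K: "K \<in> sides Tp e"
  shows "continuous_on e (\<lambda>x. elem_trace K U x)"
proof -
  have "K \<in> Tp" "e \<subseteq> K" using K unfolding sides_def by blast+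
  obtain P where P: "continuous_on UNIV P" "\<forall>s\<in>\<Lambda>. \<forall>x\<in>K. elem_trace (shift s K) U (x + s) = P x"
    using U_space_trace[OF U \<open>K \<in> Tp\<close>] .
  have "elem_trace K U x = P x" if "x \<in> e" for x
    using bspec[OF bspec[OF P(2) period_lattice_0], of x] that \<open>e \<subseteq> K\<close> by auto
  then show ?thesis using continuous_on_subset[OF P(1) subset_UNIV] by (simp cong: continuous_on_cong)
qed

lemma trace_shift:
  assumes U: "U \<in> U_space L T r" and K: "K \<in> Tp" and s: "s \<in> \<Lambda>" and x: "x \<in> K"
  shows "elem_trace (shift s K) U (x + s) = elem_trace K U x"
proof -
  obtain P where P: "\<forall>s\<in>\<Lambda>. \<forall>x\<in>K. elem_trace (shift s K) U (x + s) = P x"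
    using U_space_trace[OF U K] .
  show ?thesis using bspec[OF bspec[OF P s] x] bspec[OF bspec[OF P period_lattice_0] x] by simp
qed

text \<open>The outward Poynting flux of \<open>K\<close> through \<open>e\<close>.\<close>

abbreviation flux :: "(real^3 \<Rightarrow> real^3) \<Rightarrow> (real^3 \<Rightarrow> real^3) \<Rightarrow> (real^3) set \<Rightarrow> (real^3) set \<Rightarrow> real^3 \<Rightarrow> real" where
  "flux E B K e x \<equiv> cross3 (elem_trace K E x) (elem_trace K B x) \<bullet> outer_normal K e"

text \<open>Divergence theorem for \<open>E \<times> B\<close> on one element.\<close>

lemma green_element:
  assumes E: "E \<in> U_space L T r" and B: "B \<in> U_space L T r" and K: "K \<in> T"
  shows "set_lebesgue_integral lebesgue K (\<lambda>x. B x \<bullet> curl E x) - set_lebesgue_integral lebesgue K (\<lambda>x. E x \<bullet> curl B x)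
    = (\<Sum>e\<in>edges_of K (near - {K}). surface_integral e (flux E B K e))"
proof -
  obtain P where "\<forall>i. real_polynomial_function (\<lambda>x. P x $ i)" "\<forall>x\<in>interior K. E x = P x"
    using U_space_polynomial[OF E K] .
  then have P: "\<And>i. real_polynomial_function (\<lambda>x. P x $ i)" "\<And>x. x \<in> interior K \<Longrightarrow> E x = P x"
    by blast+
  obtain Q where "\<forall>i. real_polynomial_function (\<lambda>x. Q x $ i)" "\<forall>x\<in>interior K. B x = Q x"
    using U_space_polynomial[OF B K] .
  then have Q: "\<And>i. real_polynomial_function (\<lambda>x. Q x $ i)" "\<And>x. x \<in> interior K \<Longrightarrow> B x = Q x"
    by blast+
  have deriv: "\<exists>D. \<forall>i. (\<forall>x. ((\<lambda>x. R x $ i) has_derivative D i x) (at x)) \<and> (\<forall>v. continuous_on UNIV (\<lambda>x. D i x v))"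
    if R: "\<And>i. real_polynomial_function (\<lambda>x. R x $ i)" for R :: "real^3 \<Rightarrow> real^3"
  proof (rule choice, rule allI)
    fix i
    show "\<exists>D. (\<forall>x. ((\<lambda>x. R x $ i) has_derivative D x) (at x)) \<and> (\<forall>v. continuous_on UNIV (\<lambda>x. D x v))"
      by (rule real_polynomial_function_derivative[OF R])
  qed
  obtain DP where DP': "\<forall>i. (\<forall>x. ((\<lambda>x. P x $ i) has_derivative DP i x) (at x)) \<and> (\<forall>v. continuous_on UNIV (\<lambda>x. DP i x v))"
    using deriv[OF P(1)] ..
  then have DP: "\<And>i x. ((\<lambda>x. P x $ i) has_derivative DP i x) (at x)" "\<And>i v. continuous_on UNIV (\<lambda>x. DP i x v)"
    by blast+
  obtain DQ where DQ': "\<forall>i. (\<forall>x. ((\<lambda>x. Q x $ i) has_derivative DQ i x) (at x)) \<and> (\<forall>v. continuous_on UNIV (\<lambda>x. DQ i x v))"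
    using deriv[OF Q(1)] ..
  then have DQ: "\<And>i x. ((\<lambda>x. Q x $ i) has_derivative DQ i x) (at x)" "\<And>i v. continuous_on UNIV (\<lambda>x. DQ i x v)"
    by blast+
  define c :: "(3 \<Rightarrow> real^3 \<Rightarrow> real^3 \<Rightarrow> real) \<Rightarrow> real^3 \<Rightarrow> real^3" where
    "c D x = vector [D 3 x (axis 2 1) - D 2 x (axis 3 1), D 1 x (axis 3 1) - D 3 x (axis 1 1), D 2 x (axis 1 1) - D 1 x (axis 2 1)]" for D x
  have curlE: "curl E x = c DP x" and curlB: "curl B x = c DQ x" if "x \<in> interior K" for x
    unfolding c_def using curl_eq[OF DP(1) open_interior that P(2)] curl_eq[OF DQ(1) open_interior that Q(2)] by blast+
  define F where "F i x = P x $ (i + 1) * Q x $ (i + 2) - Q x $ (i + 1) * P x $ (i + 2)" for i :: 3 and x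
  define DF where "DF i x v = (P x $ (i + 1) * DQ (i + 2) x v + DP (i + 1) x v * Q x $ (i + 2))
      - (Q x $ (i + 1) * DP (i + 2) x v + DQ (i + 1) x v * P x $ (i + 2))" for i :: 3 and x v
  have F: "F i x = cross3 (P x) (Q x) $ i" for i x by (simp add: F_def det_frame)
  have DF: "(F i has_derivative DF i x) (at x)" for i x
    unfolding F_def[abs_def] DF_def[abs_def] by (intro has_derivative_diff has_derivative_mult DP(1) DQ(1))
  have contP: "continuous_on S P" and contQ: "continuous_on S Q" for S
    using continuous_on_polynomial_components P(1) Q(1) by blast+
  have contD: "continuous_on S (\<lambda>x. DP i x v)" "continuous_on S (\<lambda>x. DQ i x v)" for S i v
    using continuous_on_subset[OF DP(2) subset_UNIV] continuous_on_subset[OF DQ(2) subset_UNIV] by blast+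
  have contDF: "continuous_on S (\<lambda>x. DF i x (axis i 1))" for S i
    unfolding DF_def by (intro continuous_intros contP contQ contD)
  have bn: "body_neighbours K (near - {K})" by (rule body_neighbours_near[OF K])
  have Kb: "convex_body K" by (rule body[OF K])
  \<comment> \<open>The identity div(E x B) = B.curl E - E.curl B for the polynomial
    representatives.\<close>
  have div: "(\<Sum>i\<in>UNIV. DF i x (axis i 1)) = Q x \<bullet> c DP x - P x \<bullet> c DQ x" for x
  proof -
    have [simp]: "(4 :: 3) = 1" "(5 :: 3) = 2" by simp_all
    show ?thesis by (simp add: DF_def c_def sum_3 inner_vec_def algebra_simps)
  qed
  have contc: "continuous_on S (c DP)" "continuous_on S (c DQ)" for S
    unfolding c_def[abs_def]
    by (subst continuous_on_componentwise, auto simp: Basis_vec_def inner_axis forall_3 intro!: continuous_intros contD)+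
  have 1: "set_integrable lebesgue K (\<lambda>x. Q x \<bullet> c DP x)" "set_integrable lebesgue K (\<lambda>x. P x \<bullet> c DQ x)"
    by (intro set_lebesgue_integral_compact(1)[OF convex_bodyD(2)[OF Kb]] continuous_intros contP contQ contc)+
  have "set_lebesgue_integral lebesgue K (\<lambda>x. B x \<bullet> curl E x) - set_lebesgue_integral lebesgue K (\<lambda>x. E x \<bullet> curl B x)
      = set_lebesgue_integral lebesgue K (\<lambda>x. Q x \<bullet> c DP x) - set_lebesgue_integral lebesgue K (\<lambda>x. P x \<bullet> c DQ x)"
    by (intro arg_cong2[where f = minus] set_integral_interior_cong[OF Kb]) (simp_all add: P(2) Q(2) curlE curlB)
  also have "\<dots> = set_lebesgue_integral lebesgue K (\<lambda>x. \<Sum>i\<in>UNIV. DF i x (axis i 1))"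
    unfolding div by (rule set_integral_diff(2)[OF 1, symmetric])
  also have "\<dots> = (\<Sum>i\<in>UNIV. set_lebesgue_integral lebesgue K (\<lambda>x. DF i x (axis i 1)))"
  proof -
    have i: "set_integrable lebesgue K (\<lambda>x. DF i x (axis i 1))" for i
      by (rule set_lebesgue_integral_compact(1)[OF convex_bodyD(2)[OF Kb] contDF])
    show ?thesis unfolding sum_3 using i by (simp add: set_integral_add)
  qed
  also have "\<dots> = (\<Sum>i\<in>UNIV. \<Sum>e\<in>edges_of K (near - {K}). surface_integral e (F i) * outer_normal K e $ i)"
    by (intro sum.cong refl divergence_convex_body[OF bn] DF contDF)
  also have "\<dots> = (\<Sum>e\<in>edges_of K (near - {K}). \<Sum>i\<in>UNIV. surface_integral e (F i) * outer_normal K e $ i)"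
    by (rule sum.swap)
  also have "\<dots> = (\<Sum>e\<in>edges_of K (near - {K}). surface_integral e (flux E B K e))"
  proof (rule sum.cong[OF refl])
    fix e assume e: "e \<in> edges_of K (near - {K})"
    have cont: "continuous_on e (\<lambda>x. cross3 (P x) (Q x))" by (intro continuous_on_cross contP contQ)
    have "F i = (\<lambda>x. cross3 (P x) (Q x) $ i)" for i using F by blast
    then have "(\<Sum>i\<in>UNIV. surface_integral e (F i) * outer_normal K e $ i) = surface_integral e (\<lambda>x. cross3 (P x) (Q x) \<bullet> outer_normal K e)"
      using surface_integral_inner[OF edges_ofD(4,2)[OF bn e] cont] by simp
    also have "\<dots> = surface_integral e (flux E B K e)"
    proof (rule surface_integral_cong)
      fix x assume "x \<in> e"
      then have x: "x \<in> K" using edges_ofD(3)[OF bn e] by blast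
      have "elem_trace K E x = P x" "elem_trace K B x = Q x"
        using contP[of UNIV] contQ[of UNIV] P(2) Q(2)
        by (auto intro!: elem_trace_eq[OF Kb x] simp: continuous_on_eq_continuous_at)
      then show "cross3 (P x) (Q x) \<bullet> outer_normal K e = flux E B K e x" by simp
    qed
    finally show "(\<Sum>i\<in>UNIV. surface_integral e (F i) * outer_normal K e $ i) = surface_integral e (flux E B K e)" .
  qed
  finally show ?thesis .
qed

lemma continuous_on_flux:
  assumes "E \<in> U_space L T r" "B \<in> U_space L T r" "K \<in> sides Tp e"
  shows "continuous_on e (flux E B K e)"
  by (intro continuous_intros continuous_on_cross continuous_on_trace[OF assms(1,3)] continuous_on_trace[OF assms(2,3)])

text \<open>Traces and normals are invariant under periods, so the element sums of
  \<open>green_element\<close> can be regrouped by representative edges through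
  \<open>sum_edges_periodic\<close>.\<close>

lemma green_mesh:
  assumes E: "E \<in> U_space L T r" and B: "B \<in> U_space L T r"
  shows "mesh_integral T (\<lambda>x. B x \<bullet> curl E x) - mesh_integral T (\<lambda>x. E x \<bullet> curl B x)
    = edge_integral (periodic_edges L T) (\<lambda>e x. \<Sum>K\<in>sides Tp e. flux E B K e x)"
proof -
  have "mesh_integral T (\<lambda>x. B x \<bullet> curl E x) - mesh_integral T (\<lambda>x. E x \<bullet> curl B x)
      = (\<Sum>K\<in>T. \<Sum>e\<in>edges_of K (near - {K}). surface_integral e (flux E B K e))"
    unfolding mesh_integral_def sum_subtractf[symmetric] by (intro sum.cong refl green_element[OF E B])
  also have "\<dots> = (\<Sum>e\<in>periodic_edges L T. \<Sum>K\<in>sides Tp e. surface_integral e (flux E B K e))"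
  proof (rule sum_edges_periodic)
    fix K e s assume e: "e \<in> interior_edges Tp" and K: "K \<in> sides Tp e" and s: "s \<in> \<Lambda>"
    obtain A C n where AC: "A \<in> Tp" "C \<in> Tp" "compact e" "aff_dim e = 2" "plane_normal e n"
      by (rule interior_edge_sides[OF packing_periodic e])
    show "surface_integral (shift s e) (flux E B (shift s K) (shift s e)) = surface_integral e (flux E B K e)"
    proof (rule surface_integral_translation[OF AC(4,5,3) continuous_on_flux[OF E B K]])
      fix x assume "x \<in> e"
      then have "K \<in> Tp" "x \<in> K" using K by (auto simp: sides_def)
      then show "flux E B (shift s K) (shift s e) (x + s) = flux E B K e x"
        using trace_shift[OF E _ s] trace_shift[OF B _ s] outer_normal_translation by simp
    qed
  qed
  also have "\<dots> = edge_integral (periodic_edges L T) (\<lambda>e x. \<Sum>K\<in>sides Tp e. flux E B K e x)"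
    unfolding edge_integral_def
  proof (rule sum.cong[OF refl])
    fix e assume "e \<in> periodic_edges L T"
    then have e: "e \<in> interior_edges Tp" using periodic_edges_subset by blast
    obtain A C n where AC: "A \<noteq> C" "sides Tp e = {A, C}" "compact e" "aff_dim e = 2"
      by (rule interior_edge_sides[OF packing_periodic e])
    then show "(\<Sum>K\<in>sides Tp e. surface_integral e (flux E B K e)) = surface_integral e (\<lambda>x. \<Sum>K\<in>sides Tp e. flux E B K e x)"
      using surface_integral_linear(1)[OF AC(4,3) continuous_on_flux[OF E B, of A] continuous_on_flux[OF E B, of C]] by simp
  qed
  finally show ?thesis .
qed

text \<open>With U = E and V = B the two curl terms combine, by \<open>green_mesh\<close>, to minus
  the summed Poynting fluxes. This cancels the contribution of the averages in the edge
  terms.\<close>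

lemma maxwell_energy:
  assumes E: "E \<in> U_space L T r" and B: "B \<in> U_space L T r"
  shows "b_form L T E' B' E B E B
    = mesh_integral T (\<lambda>x. E' x \<bullet> E x) + mesh_integral T (\<lambda>x. B' x \<bullet> B x) + 1/2 * Theta2 L T E B"
proof -
  let ?Ex = "periodic_edges L T"
  have "edge_integral ?Ex (\<lambda>e x. E_flux Tp e E B x \<bullet> tjump Tp e B x) - edge_integral ?Ex (\<lambda>e x. B_flux Tp e E B x \<bullet> tjump Tp e E x)
      = 1/2 * Theta2 L T E B + edge_integral ?Ex (\<lambda>e x. \<Sum>K\<in>sides Tp e. flux E B K e x)"
    unfolding Theta2_def edge_integral_def sum_subtractf[symmetric] sum_distrib_left sum.distrib[symmetric]
  proof (rule sum.cong[OF refl])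
    fix e assume "e \<in> ?Ex"
    then have e: "e \<in> interior_edges Tp" using periodic_edges_subset by blast
    obtain A C n where AC: "A \<noteq> C" "sides Tp e = {A, C}" "outer_normal A e = n" "outer_normal C e = - n"
      and e': "aff_dim e = 2" "compact e"
      by (rule interior_edge_sides[OF packing_periodic e])
    have tr: "continuous_on e (\<lambda>x. elem_trace A E x)" "continuous_on e (\<lambda>x. elem_trace C E x)"
      "continuous_on e (\<lambda>x. elem_trace A B x)" "continuous_on e (\<lambda>x. elem_trace C B x)"
      using continuous_on_trace[OF E] continuous_on_trace[OF B] AC(2) by simp_all
    have tj: "tjump Tp e E x = cross3 (elem_trace A E x) n + cross3 (elem_trace C E x) (- n)"
      "tjump Tp e B x = cross3 (elem_trace A B x) n + cross3 (elem_trace C B x) (- n)" for x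
      using AC by (simp_all add: tjump_def)
    have fl: "E_flux Tp e E B x = (1/2) *\<^sub>R (elem_trace A E x + elem_trace C E x) + (1/2) *\<^sub>R tjump Tp e B x"
      "B_flux Tp e E B x = (1/2) *\<^sub>R (elem_trace A B x + elem_trace C B x) - (1/2) *\<^sub>R tjump Tp e E x" for x
      using AC by (simp_all add: E_flux_def B_flux_def avg_def)
    have ctj: "continuous_on e (tjump Tp e E)" "continuous_on e (tjump Tp e B)"
      unfolding tj[abs_def] by (intro continuous_intros continuous_on_cross tr)+
    have cfl: "continuous_on e (E_flux Tp e E B)" "continuous_on e (B_flux Tp e E B)"
      unfolding fl[abs_def] by (intro continuous_intros tr ctj)+
    let ?S = "\<lambda>x. E_flux Tp e E B x \<bullet> tjump Tp e B x" and ?S' = "\<lambda>x. B_flux Tp e E B x \<bullet> tjump Tp e E x"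
    let ?N = "\<lambda>x. (norm (tjump Tp e E x))\<^sup>2 + (norm (tjump Tp e B x))\<^sup>2" and ?X = "\<lambda>x. \<Sum>K\<in>sides Tp e. flux E B K e x"
    have cS: "continuous_on e ?S" "continuous_on e ?S'" and cN: "continuous_on e ?N"
      by (intro continuous_intros cfl ctj)+
    have cX: "continuous_on e ?X"
      using continuous_on_flux[OF E B] by (intro continuous_on_sum) auto
    have id: "?S x + (-1) * ?S' x = 1/2 * ?N x + ?X x" for x
      using maxwell_flux_identity[of "elem_trace A E x" "elem_trace C E x" "elem_trace A B x" n "elem_trace C B x"] AC
      unfolding fl tj by simp
    have "surface_integral e ?S - surface_integral e ?S' = surface_integral e (\<lambda>x. ?S x + (-1) * ?S' x)"
      by (subst surface_integral_linear(1)[OF e' cS(1)])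
        (auto intro!: continuous_intros cS simp: surface_integral_linear(2)[OF e' cS(2) cS(2), of "-1", simplified])
    also have "\<dots> = surface_integral e (\<lambda>x. 1/2 * ?N x + ?X x)" unfolding id ..
    also have "\<dots> = surface_integral e (\<lambda>x. 1/2 * ?N x) + surface_integral e ?X"
      by (rule surface_integral_linear(1)[OF e' _ cX]) (intro continuous_intros cN)
    also have "surface_integral e (\<lambda>x. 1/2 * ?N x) = 1/2 * surface_integral e ?N"
      by (rule surface_integral_linear(2)[OF e' cN cN])
    finally show "surface_integral e ?S - surface_integral e ?S' = 1/2 * surface_integral e ?N + surface_integral e ?X" .
  qed
  then show ?thesis using green_mesh[OF E B] by (simp add: b_form_def Let_def)
qed

end

section \<open>Vlasov part\<close>

lemma norm_square_eq_sum_Basis: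
  fixes \<xi> :: "'a::euclidean_space"
  shows "(norm \<xi>)\<^sup>2 = (\<Sum>b\<in>Basis. (\<xi> \<bullet> b)\<^sup>2)"
proof -
  have "(norm \<xi>)\<^sup>2 = \<xi> \<bullet> \<xi>" by (rule power2_norm_eq_inner)
  also have "\<dots> = (\<Sum>b\<in>Basis. (\<xi> \<bullet> b) * (\<xi> \<bullet> b))" by (rule euclidean_inner)
  finally show ?thesis by (simp add: power2_eq_square)
qed

lemma poly_on_norm_square:
  assumes "k \<ge> 2"
  shows "poly_on k D (\<lambda>z::(real^3) \<times> (real^3). (norm (snd z))\<^sup>2)"
proof -
  \<comment> \<open>The exponent of the square of one velocity coordinate: degree 2 at the basis
    vector \<open>(0, b)\<close>, and 0 elsewhere, in particular at all position
    coordinates.\<close>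
  define \<beta> :: "real^3 \<Rightarrow> (real^3) \<times> (real^3) \<Rightarrow> nat" where "\<beta> b = (\<lambda>b'. if b' = (0, b) then 2 else 0)" for b
  let ?A = "\<beta> ` Basis"
  have inj: "inj_on \<beta> Basis"
  proof (rule inj_onI)
    fix b c assume "\<beta> b = \<beta> c"
    then have "\<beta> b (0, b) = \<beta> c (0, b)" by simp
    then show "b = c" by (simp add: \<beta>_def split: if_splits)
  qed
  have B: "(0, b) \<in> (Basis :: ((real^3) \<times> (real^3)) set)" if "b \<in> Basis" for b
    using that by (auto simp: Basis_prod_def)
  have sub: "?A \<subseteq> multi_indices k"
  proof
    fix \<alpha> assume "\<alpha> \<in> ?A"
    then obtain b where b: "b \<in> Basis" "\<alpha> = \<beta> b" by blast
    have "(\<Sum>b'\<in>Basis. \<beta> b b') = 2" using B[OF b(1)] by (simp add: \<beta>_def)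
    moreover have "\<beta> b b' = 0" if "b' \<notin> Basis" for b' using that B[OF b(1)] by (auto simp: \<beta>_def)
    ultimately show "\<alpha> \<in> multi_indices k" using assms b(2) by (simp add: multi_indices_def)
  qed
  have "(norm (snd z))\<^sup>2 = (\<Sum>\<alpha>\<in>multi_indices k. (if \<alpha> \<in> ?A then 1 else 0) * (\<Prod>b\<in>Basis. (z \<bullet> b) ^ \<alpha> b))"
    for z :: "(real^3) \<times> (real^3)"
  proof -
    have mono: "(\<Prod>b'\<in>Basis. (z \<bullet> b') ^ \<beta> b b') = (snd z \<bullet> b)\<^sup>2" if "b \<in> Basis" for b
    proof -
      have "(\<Prod>b'\<in>Basis. (z \<bullet> b') ^ \<beta> b b') = (\<Prod>b'\<in>(Basis :: ((real^3) \<times> (real^3)) set). if b' = (0, b) then (z \<bullet> (0, b))\<^sup>2 else 1)"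
        by (rule prod.cong) (simp_all add: \<beta>_def)
      also have "\<dots> = (snd z \<bullet> b)\<^sup>2" using B[OF that] by (simp add: inner_prod_def)
      finally show ?thesis .
    qed
    have "(\<Sum>\<alpha>\<in>multi_indices k. (if \<alpha> \<in> ?A then 1 else 0) * (\<Prod>b\<in>Basis. (z \<bullet> b) ^ \<alpha> b))
        = (\<Sum>\<alpha>\<in>?A. \<Prod>b\<in>Basis. (z \<bullet> b) ^ \<alpha> b)"
      using sub by (intro sum.mono_neutral_cong_right finite_multi_indices) auto
    also have "\<dots> = (\<Sum>b\<in>Basis. (snd z \<bullet> b)\<^sup>2)"
      unfolding sum.reindex[OF inj] by (rule sum.cong) (simp_all add: mono)
    finally show ?thesis by (simp add: norm_square_eq_sum_Basis)
  qed
  then show ?thesis unfolding poly_on_def by (intro exI[of _ "\<lambda>\<alpha>. if \<alpha> \<in> ?A then 1 else 0"]) blast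
qed

lemma G_space_norm_square:
  "k \<ge> 2 \<Longrightarrow> (\<lambda>z. (norm (snd z))\<^sup>2) \<in> G_space L Tx T\<xi> k"
  using poly_on_norm_square by (simp add: G_space_def)

lemma grad_eq:
  assumes "GDERIV u x :> D"
  shows "grad u x = D"
  unfolding grad_def
proof (rule the_equality)
  show "GDERIV u x :> D" by (rule assms)
  fix D' assume "GDERIV u x :> D'"
  then have "(\<lambda>h. D' \<bullet> h) = (\<lambda>h. D \<bullet> h)"
    using assms has_derivative_unique unfolding gderiv_def by (metis (no_types, lifting) inner_commute ext)
  then have "\<forall>h. D' \<bullet> h = D \<bullet> h" by (metis (lifting))
  then show "D' = D" by (rule iffD1[OF vector_eq_rdot])
qed

lemma grad_const: "grad (\<lambda>y. c) x = 0"
  by (rule grad_eq) (simp add: gderiv_def)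

lemma grad_norm_square: "grad (\<lambda>\<eta>. (norm \<eta>)\<^sup>2) \<xi> = 2 *\<^sub>R \<xi>"
proof (rule grad_eq)
  have "((\<lambda>\<eta>. \<eta> \<bullet> \<eta>) has_derivative (\<lambda>h. h \<bullet> (2 *\<^sub>R \<xi>))) (at \<xi>)"
    by (auto intro!: derivative_eq_intros simp: inner_commute)
  then show "GDERIV (\<lambda>\<eta>. (norm \<eta>)\<^sup>2) \<xi> :> 2 *\<^sub>R \<xi>" by (simp add: gderiv_def power2_norm_eq_inner)
qed

lemma elem_trace_continuous:
  fixes P :: "real^3 \<Rightarrow> 'b::real_normed_vector"
  assumes "convex_body K" "x \<in> K" "continuous_on UNIV P"
  shows "elem_trace K P x = P x"
  by (rule elem_trace_eq) (use assms in \<open>simp_all add: continuous_on_eq_continuous_at\<close>)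

lemma jump_continuous_interior_edge:
  fixes u :: "real^3 \<Rightarrow> real"
  assumes T: "packing T" and e: "e \<in> interior_edges T" and u: "continuous_on UNIV u" and x: "x \<in> e"
  shows "jump T e u x = 0"
proof -
  obtain A B n where AB: "A \<in> T" "B \<in> T" "A \<noteq> B" "e = A \<inter> B" "sides T e = {A, B}"
    "outer_normal A e = n" "outer_normal B e = - n"
    by (rule interior_edge_sides[OF T e])
  have "elem_trace A u x = u x" "elem_trace B u x = u x"
    using T AB(1,2,4) x u by (auto intro!: elem_trace_continuous simp: packing_def)
  then show ?thesis using AB(3,5-7) by (simp add: jump_def)
qed

lemma surface_integral_zero: "(\<And>x. x \<in> e \<Longrightarrow> F x = 0) \<Longrightarrow> surface_integral e F = 0"
  using surface_integral_cong[of e F "\<lambda>_. 0"] by (simp add: surface_integral_def)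

lemma mesh_integral_zero [simp]: "mesh_integral T (\<lambda>x. 0 :: real) = 0"
  by (simp add: mesh_integral_def)

lemma mesh_integral_cong_interior:
  fixes F G :: "'a::euclidean_space \<Rightarrow> 'b::{banach, second_countable_topology}"
  assumes "\<And>K. K \<in> T \<Longrightarrow> convex_body K" "\<And>K x. K \<in> T \<Longrightarrow> x \<in> interior K \<Longrightarrow> F x = G x"
  shows "mesh_integral T F = mesh_integral T G"
  unfolding mesh_integral_def
  by (rule sum.cong[OF refl], rule set_integral_interior_cong) (use assms in blast)+

text \<open>The product mesh is a set of products. Distinct pairs give distinct products because
  elements are nonempty, so the sum can be indexed by pairs.\<close>

lemma mesh_integral_product:
  fixes F :: "(real^3) \<times> (real^3) \<Rightarrow> real"
  assumes "\<And>K. K \<in> Tx \<Longrightarrow> convex_body K" "\<And>M. M \<in> T\<xi> \<Longrightarrow> convex_body M"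
  shows "mesh_integral (product_mesh Tx T\<xi>) F = (\<Sum>K\<in>Tx. \<Sum>M\<in>T\<xi>. set_lebesgue_integral lebesgue (K \<times> M) F)"
proof -
  have eq: "product_mesh Tx T\<xi> = (\<lambda>(K, M). K \<times> M) ` (Tx \<times> T\<xi>)" by (auto simp: product_mesh_def)
  have inj: "inj_on (\<lambda>(K, M). K \<times> M) (Tx \<times> T\<xi>)"
  proof (rule inj_onI, clarify)
    fix K M K' M' assume a: "K \<in> Tx" "M \<in> T\<xi>" "K' \<in> Tx" "M' \<in> T\<xi>" "K \<times> M = K' \<times> M'"
    then have "K \<noteq> {}" "M \<noteq> {}" using assms convex_bodyD(6) by blast+
    then show "K = K' \<and> M = M'" using a(5) by (simp add: times_eq_iff)
  qed
  show ?thesis unfolding mesh_integral_def eq sum.reindex[OF inj]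
    by (simp add: sum.cartesian_product case_prod_unfold)
qed

text \<open>Only the outflow part of the upwind flux survives on the boundary: \<open>s / 2 + \<bar>s\<bar> / 2 = max s 0\<close>.\<close>

lemma boundary_flux:
  assumes L: "L > 0" and T: "is_mesh (closed_cube L) T" and e: "e \<in> boundary_edges (closed_cube L) T" and \<xi>: "\<xi> \<in> e"
    and u: "\<And>K. K \<in> T \<Longrightarrow> \<exists>p. continuous_on UNIV p \<and> (\<forall>\<eta>\<in>interior K. u \<eta> = p \<eta>)"
    and \<beta>: "continuous_on UNIV \<beta>"
  shows "upwind_flux T e u \<beta> \<xi> \<bullet> jump T e (\<lambda>\<eta>. (norm \<eta>)\<^sup>2) \<xi>
    = elem_trace (boundary_side T e) u \<xi> * (norm \<xi>)\<^sup>2 * max (\<beta> \<xi> \<bullet> outer_normal (boundary_side T e) e) 0"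
proof -
  obtain K n where K: "K \<in> T" "sides T e = {K}" "boundary_side T e = K" "outer_normal K e = n" "norm n = 1"
    "e \<subseteq> K" "aff_dim e = 2" "plane_normal e n"
    by (rule boundary_edge_side[OF L T e])
  have body: "convex_body K" by (rule convex_body_mesh[OF T K(1)])
  have \<xi>K: "\<xi> \<in> K" using K(6) \<xi> by blast
  obtain p where p: "continuous_on UNIV p" "\<forall>\<eta>\<in>interior K. u \<eta> = p \<eta>" using u[OF K(1)] by blast
  have pc: "isCont p \<xi>" "isCont \<beta> \<xi>" using p(1) \<beta> by (simp_all add: continuous_on_eq_continuous_at)
  have tu: "elem_trace K u \<xi> = p \<xi>"
    by (rule elem_trace_eq[OF body \<xi>K pc(1)]) (use p(2) in blast)
  have tb: "elem_trace K (\<lambda>z. u z *\<^sub>R \<beta> z) \<xi> = p \<xi> *\<^sub>R \<beta> \<xi>"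
    by (rule elem_trace_eq[OF body \<xi>K]) (use p(2) pc in \<open>auto intro!: continuous_intros\<close>)
  have tn: "elem_trace K (\<lambda>\<eta>. (norm \<eta>)\<^sup>2) \<xi> = (norm \<xi>)\<^sup>2"
    by (rule elem_trace_continuous[OF body \<xi>K]) (intro continuous_intros)
  have en: "\<bar>\<beta> \<xi> \<bullet> edge_normal e\<bar> = \<bar>\<beta> \<xi> \<bullet> n\<bar>" using edge_normal_cases[OF K(7,8)] by auto
  have nn: "n \<bullet> n = 1" using K(5) by (simp add: norm_eq_1)
  have "upwind_flux T e u \<beta> \<xi> \<bullet> jump T e (\<lambda>\<eta>. (norm \<eta>)\<^sup>2) \<xi>
      = p \<xi> * (norm \<xi>)\<^sup>2 * ((\<beta> \<xi> \<bullet> n) / 2 + \<bar>\<beta> \<xi> \<bullet> n\<bar> / 2)"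
    unfolding upwind_flux_def avg_def jump_def K(2) by (simp add: tu tb tn en K(4) nn inner_add_left algebra_simps)
  also have "(\<beta> \<xi> \<bullet> n) / 2 + \<bar>\<beta> \<xi> \<bullet> n\<bar> / 2 = max (\<beta> \<xi> \<bullet> n) 0" by simp
  finally show ?thesis unfolding K(3,4) tu .
qed

text \<open>Both transport terms in x vanish, since the test function is constant in x. The force
  term leaves the work of the electric field, which is where the current appears.\<close>

lemma vlasov_energy:
  fixes f :: "(real^3) \<times> (real^3) \<Rightarrow> real"
  assumes Lx: "Lx > 0" and L\<xi>: "L\<xi> > 0" and Tx: "is_mesh (closed_cube Lx) Tx" and T\<xi>: "is_mesh (closed_cube L\<xi>) T\<xi>"
    and f: "f \<in> G_space Lx Tx T\<xi> k" and E: "E \<in> U_space Lx Tx r"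
  shows "a_form Lx L\<xi> Tx T\<xi> f' f E B (\<lambda>z. (norm (snd z))\<^sup>2)
    = mesh_integral (product_mesh Tx T\<xi>) (\<lambda>z. f' z * (norm (snd z))\<^sup>2)
      - 2 * mesh_integral Tx (\<lambda>x. current T\<xi> f x \<bullet> E x) + Theta3 L\<xi> Tx T\<xi> f E B"
proof -
  interpret torus_mesh Lx Tx using Lx Tx by unfold_locales
  have body\<xi>: "convex_body M" if "M \<in> T\<xi>" for M by (rule convex_body_mesh[OF T\<xi> that])
  let ?Th = "product_mesh Tx T\<xi>" and ?E\<xi> = "interior_edges T\<xi> \<union> boundary_edges (closed_cube L\<xi>) T\<xi>"
  have fp: "\<exists>p. continuous_on UNIV p \<and> (\<forall>z\<in>interior (K \<times> M). f z = p z)" if "K \<in> Tx" "M \<in> T\<xi>" for K M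
  proof -
    have "poly_on k (interior (K \<times> M)) f" using f that unfolding G_space_def product_mesh_def by blast
    then obtain p where "real_polynomial_function p" "\<forall>z\<in>interior (K \<times> M). f z = p z" by (rule poly_on_polynomial)
    then show ?thesis using real_polynomial_function_continuous by blast
  qed
  have slice: "\<exists>p. continuous_on UNIV p \<and> (\<forall>\<eta>\<in>interior M. f (x, \<eta>) = p \<eta>)"
    if x: "K \<in> Tx" "x \<in> interior K" "M \<in> T\<xi>" for K M x
  proof -
    obtain p where p: "continuous_on UNIV p" "\<forall>z\<in>interior (K \<times> M). f z = p z" using fp[OF x(1,3)] by blast
    have "continuous_on UNIV (\<lambda>\<eta>. p (x, \<eta>))"
      by (rule continuous_on_compose2[OF p(1)]) (auto intro!: continuous_intros)
    moreover have "\<forall>\<eta>\<in>interior M. f (x, \<eta>) = p (x, \<eta>)" using p(2) x(2) by (simp add: interior_Times)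
    ultimately show ?thesis by blast
  qed
  have x_flux: "edge_integral (periodic_edges Lx Tx) (\<lambda>e x. upwind_flux Tp e (\<lambda>y. f (y, \<xi>)) (\<lambda>y. \<xi>) x \<bullet> jump Tp e (\<lambda>y. (norm \<xi>)\<^sup>2) x) = 0" for \<xi>
    unfolding edge_integral_def
    using periodic_edges_subset jump_continuous_interior_edge[OF packing_periodic]
    by (intro sum.neutral ballI surface_integral_zero) (auto simp: continuous_on_const)
  have \<xi>_flux: "mesh_integral Tx (\<lambda>x. edge_integral ?E\<xi> (\<lambda>e \<xi>.
        upwind_flux T\<xi> e (\<lambda>\<eta>. f (x, \<eta>)) (\<lambda>\<eta>. E x + cross3 \<eta> (B x)) \<xi> \<bullet> jump T\<xi> e (\<lambda>\<eta>. (norm \<eta>)\<^sup>2) \<xi>))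
      = Theta3 L\<xi> Tx T\<xi> f E B"
    unfolding Theta3_def
  proof (rule mesh_integral_cong_interior[OF body])
    fix K x assume x: "K \<in> Tx" "x \<in> interior K"
    let ?\<beta> = "\<lambda>\<eta>. E x + cross3 \<eta> (B x)"
    let ?G = "\<lambda>e \<xi>. upwind_flux T\<xi> e (\<lambda>\<eta>. f (x, \<eta>)) ?\<beta> \<xi> \<bullet> jump T\<xi> e (\<lambda>\<eta>. (norm \<eta>)\<^sup>2) \<xi>"
    have fin: "finite T\<xi>" using T\<xi> by (simp add: is_mesh_def)
    \<comment> \<open>An interior edge has two sides and a boundary edge only one, so the sum over
      their union counts no edge twice.\<close>
    have disj: "interior_edges T\<xi> \<inter> boundary_edges (closed_cube L\<xi>) T\<xi> = {}"
      using boundary_edge_side[OF L\<xi> T\<xi>] by (metis disjoint_iff)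
    have c: "continuous_on UNIV (\<lambda>\<eta>::real^3. (norm \<eta>)\<^sup>2)" "continuous_on UNIV ?\<beta>"
      by (intro continuous_intros continuous_on_cross)+
    have int: "surface_integral e (?G e) = 0" if "e \<in> interior_edges T\<xi>" for e
      by (rule surface_integral_zero) (simp add: jump_continuous_interior_edge[OF packing_mesh[OF T\<xi>] that c(1)])
    have "edge_integral ?E\<xi> ?G = edge_integral (boundary_edges (closed_cube L\<xi>) T\<xi>) ?G"
      unfolding edge_integral_def sum.union_disjoint[OF finite_interior_edges[OF fin] finite_boundary_edges[OF fin] disj]
      by (simp add: int)
    also have "\<dots> = edge_integral (boundary_edges (closed_cube L\<xi>) T\<xi>) (\<lambda>e \<xi>. let K = boundary_side T\<xi> e in
       elem_trace K (\<lambda>\<eta>. f (x, \<eta>)) \<xi> * (norm \<xi>)\<^sup>2 * max (?\<beta> \<xi> \<bullet> outer_normal K e) 0)"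
      unfolding edge_integral_def Let_def
      by (intro sum.cong refl surface_integral_cong boundary_flux[OF L\<xi> T\<xi> _ _ _ c(2)] slice[OF x])
    finally show "edge_integral ?E\<xi> ?G = \<dots>" .
  qed
  have inner: "mesh_integral ?Th (\<lambda>(x, \<xi>). f (x, \<xi>) * ((E x + cross3 \<xi> (B x)) \<bullet> (2 *\<^sub>R \<xi>)))
      = 2 * mesh_integral Tx (\<lambda>x. current T\<xi> f x \<bullet> E x)"
  proof -
    let ?F = "\<lambda>(x, \<xi>). f (x, \<xi>) * ((E x + cross3 \<xi> (B x)) \<bullet> (2 *\<^sub>R \<xi>))"
    \<comment> \<open>The magnetic part drops out because \<xi> x B is orthogonal to \<xi>; the
      factor 2 comes from the gradient of the squared norm.\<close>
    have F: "?F (x, \<xi>) = 2 * (f (x, \<xi>) * (E x \<bullet> \<xi>))" for x \<xi>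
      by (simp add: inner_add_left dot_cross_self)
    have *: "set_lebesgue_integral lebesgue (K \<times> M) ?F
          = set_lebesgue_integral lebesgue K (\<lambda>x. set_lebesgue_integral lebesgue M (\<lambda>\<xi>. ?F (x, \<xi>)))"
        "set_integrable lebesgue K (\<lambda>x. set_lebesgue_integral lebesgue M (\<lambda>\<xi>. ?F (x, \<xi>)))"
      if KM: "K \<in> Tx" "M \<in> T\<xi>" for K M
    proof -
      obtain p where p: "continuous_on UNIV p" "\<forall>z\<in>interior (K \<times> M). f z = p z" using fp[OF KM] by blast
      obtain P where P: "\<forall>i. real_polynomial_function (\<lambda>x. P x $ i)" "\<forall>x\<in>interior K. E x = P x"
        using U_space_polynomial[OF E KM(1)] .
      have cP: "continuous_on S P" for S using continuous_on_polynomial_components P(1) by blast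
      have "continuous_on (K \<times> M) (\<lambda>z. P (fst z))"
        by (rule continuous_on_compose2[OF cP[of UNIV]]) (auto intro!: continuous_intros)
      then have G: "continuous_on (K \<times> M) (\<lambda>z. 2 * (p z * (P (fst z) \<bullet> snd z)))"
        using continuous_on_subset[OF p(1) subset_UNIV] by (intro continuous_intros)
      have eq: "?F z = 2 * (p z * (P (fst z) \<bullet> snd z))" if "z \<in> interior (K \<times> M)" for z
      proof -
        obtain x \<xi> where z: "z = (x, \<xi>)" by (cases z)
        show ?thesis using that p(2) P(2) unfolding z F by (auto simp: interior_Times)
      qed
      show "set_lebesgue_integral lebesgue (K \<times> M) ?F
          = set_lebesgue_integral lebesgue K (\<lambda>x. set_lebesgue_integral lebesgue M (\<lambda>\<xi>. ?F (x, \<xi>)))"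
        by (rule set_integral_Times(1)[OF body[OF KM(1)] body\<xi>[OF KM(2)] G eq])
      show "set_integrable lebesgue K (\<lambda>x. set_lebesgue_integral lebesgue M (\<lambda>\<xi>. ?F (x, \<xi>)))"
        by (rule set_integral_Times(2)[OF body[OF KM(1)] body\<xi>[OF KM(2)] G eq])
    qed
    have "mesh_integral ?Th ?F = (\<Sum>K\<in>Tx. \<Sum>M\<in>T\<xi>. set_lebesgue_integral lebesgue (K \<times> M) ?F)"
      by (rule mesh_integral_product[OF body body\<xi>])
    also have "\<dots> = (\<Sum>K\<in>Tx. set_lebesgue_integral lebesgue K (\<lambda>x. 2 * (current T\<xi> f x \<bullet> E x)))"
    proof (rule sum.cong[OF refl])
      fix K assume K: "K \<in> Tx"
      have "(\<Sum>M\<in>T\<xi>. set_lebesgue_integral lebesgue (K \<times> M) ?F)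
          = (\<Sum>M\<in>T\<xi>. integral\<^sup>L lebesgue (\<lambda>x. indicator K x *\<^sub>R set_lebesgue_integral lebesgue M (\<lambda>\<xi>. ?F (x, \<xi>))))"
        by (rule sum.cong[OF refl], subst *(1)[OF K], assumption) (simp only: set_lebesgue_integral_def[of lebesgue K])
      also have "\<dots> = integral\<^sup>L lebesgue (\<lambda>x. \<Sum>M\<in>T\<xi>. indicator K x *\<^sub>R set_lebesgue_integral lebesgue M (\<lambda>\<xi>. ?F (x, \<xi>)))"
        by (rule Bochner_Integration.integral_sum[symmetric]) (use *(2)[OF K] in \<open>simp add: set_integrable_def\<close>)
      also have "\<dots> = set_lebesgue_integral lebesgue K (\<lambda>x. \<Sum>M\<in>T\<xi>. set_lebesgue_integral lebesgue M (\<lambda>\<xi>. ?F (x, \<xi>)))"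
        by (simp add: set_lebesgue_integral_def[of lebesgue K] sum_distrib_left)
      also have "\<dots> = set_lebesgue_integral lebesgue K (\<lambda>x. 2 * (current T\<xi> f x \<bullet> E x))"
      proof (rule set_integral_interior_cong[OF body[OF K]])
        fix x assume x: "x \<in> interior K"
        have "set_lebesgue_integral lebesgue M (\<lambda>\<xi>. ?F (x, \<xi>)) = 2 * (set_lebesgue_integral lebesgue M (\<lambda>\<xi>. f (x, \<xi>) *\<^sub>R \<xi>) \<bullet> E x)"
          if M: "M \<in> T\<xi>" for M
        proof -
          obtain p where p: "continuous_on UNIV p" "\<forall>\<eta>\<in>interior M. f (x, \<eta>) = p \<eta>" using slice[OF K x M] by blast
          have "continuous_on M (\<lambda>\<xi>. p \<xi> *\<^sub>R \<xi>)"
            using continuous_on_subset[OF p(1) subset_UNIV] by (intro continuous_intros)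
          then have "set_integrable lebesgue M (\<lambda>\<xi>. p \<xi> *\<^sub>R \<xi>)"
            by (rule set_lebesgue_integral_compact(1)[OF convex_bodyD(2)[OF body\<xi>[OF M]]])
          then have "set_integrable lebesgue M (\<lambda>\<xi>. f (x, \<xi>) *\<^sub>R \<xi>)"
            by (rule absolutely_integrable_spike[OF _ negligible_diff_interior[OF body\<xi>[OF M]]]) (use p(2) in simp)
          \<comment> \<open>The integrability just shown allows the constant vector
            \<open>E x\<close> to be moved through the vector-valued integral that defines the
            current.\<close>
          then have pull: "set_lebesgue_integral lebesgue M (\<lambda>\<xi>. f (x, \<xi>) *\<^sub>R \<xi>) \<bullet> E x
              = integral\<^sup>L lebesgue (\<lambda>\<xi>. (indicator M \<xi> *\<^sub>R f (x, \<xi>) *\<^sub>R \<xi>) \<bullet> E x)"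
            unfolding set_lebesgue_integral_def set_integrable_def by (rule integral_inner_left[symmetric])
          have "set_lebesgue_integral lebesgue M (\<lambda>\<xi>. ?F (x, \<xi>))
              = integral\<^sup>L lebesgue (\<lambda>\<xi>. 2 * ((indicator M \<xi> *\<^sub>R f (x, \<xi>) *\<^sub>R \<xi>) \<bullet> E x))"
            unfolding set_lebesgue_integral_def F
            by (rule Bochner_Integration.integral_cong) (simp_all add: inner_commute)
          then show ?thesis unfolding pull by simp
        qed
        then show "(\<Sum>M\<in>T\<xi>. set_lebesgue_integral lebesgue M (\<lambda>\<xi>. ?F (x, \<xi>))) = 2 * (current T\<xi> f x \<bullet> E x)"
          by (simp add: current_def mesh_integral_def inner_sum_left sum_distrib_left)
      qed
      finally show "(\<Sum>M\<in>T\<xi>. set_lebesgue_integral lebesgue (K \<times> M) ?F) = set_lebesgue_integral lebesgue K (\<lambda>x. 2 * (current T\<xi> f x \<bullet> E x))" .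
    qed
    also have "\<dots> = 2 * mesh_integral Tx (\<lambda>x. current T\<xi> f x \<bullet> E x)"
      by (simp add: mesh_integral_def sum_distrib_left)
    finally show ?thesis .
  qed
  show ?thesis
    unfolding a_form_def Let_def
    using inner by (simp add: grad_const grad_norm_square x_flux \<xi>_flux case_prod_unfold)
qed

section \<open>Time derivatives of the element integrals\<close>

lemma has_derivative_integral_weighted:
  fixes f :: "real \<Rightarrow> 'a::euclidean_space \<Rightarrow> real"
  assumes K: "convex_body K" and w: "continuous_on K w" and t: "t \<in> I" "at t within I \<noteq> bot"
    and f: "\<And>\<tau>. \<tau> \<in> I \<Longrightarrow> poly_on k (interior K) (f \<tau>)"
    and f': "\<And>x. x \<in> interior K \<Longrightarrow> ((\<lambda>\<tau>. f \<tau> x) has_real_derivative f' x) (at t within I)"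
  shows "((\<lambda>\<tau>. set_lebesgue_integral lebesgue K (\<lambda>x. f \<tau> x * w x)) has_real_derivative
    set_lebesgue_integral lebesgue K (\<lambda>x. f' x * w x)) (at t within I)"
proof -
  obtain n :: nat and z \<phi> where n': "\<forall>j<n. z j \<in> interior K" "\<forall>j<n. real_polynomial_function (\<phi> j)"
    "\<forall>u. poly_on k (interior K) u \<longrightarrow> (\<forall>x\<in>interior K. u x = (\<Sum>j<n. u (z j) * \<phi> j x))"
    using poly_on_interpolation[of "interior K" k] .
  then have n: "\<And>j. j < n \<Longrightarrow> z j \<in> interior K" "\<And>j. j < n \<Longrightarrow> real_polynomial_function (\<phi> j)"
    by blast+
  have interp: "u x = (\<Sum>j<n. u (z j) * \<phi> j x)" if "poly_on k (interior K) u" "x \<in> interior K" for u x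
    by (rule bspec[OF mp[OF spec[OF n'(3)] that(1)] that(2)])
  show ?thesis
  \<comment> \<open>The coefficients are the values at fixed interior nodes, differentiable in time
    by assumption; the weight joins the spatial factor.\<close>
  proof (rule has_derivative_integral_separable[OF K, where J = "{..<n}" and a = "\<lambda>j \<tau>. f \<tau> (z j)"
        and \<phi> = "\<lambda>j x. \<phi> j x * w x" and a' = "\<lambda>j. f' (z j)", OF _ _ _ _ _ t])
    show "continuous_on K (\<lambda>x. \<phi> j x * w x)" if "j \<in> {..<n}" for j
      using that by (intro continuous_on_mult real_polynomial_function_continuous n(2) w) simp
    show "f \<tau> x * w x = (\<Sum>j\<in>{..<n}. f \<tau> (z j) * (\<phi> j x * w x))" if "\<tau> \<in> I" "x \<in> interior K" for \<tau> x
      by (subst interp[OF f[OF that(1)] that(2)]) (simp add: sum_distrib_right mult.assoc)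
  qed (use n(1) f' in \<open>auto intro!: DERIV_cmult_right\<close>)
qed

text \<open>All components share the same nodes, so \<open>U\<close> is interpolated with vector
  coefficients. Its squared norm is then separable over pairs of nodes, with inner products of node
  values as coefficients.\<close>

lemma has_derivative_integral_norm_square:
  fixes U :: "real \<Rightarrow> real^3 \<Rightarrow> real^3"
  assumes K: "convex_body K" and t: "t \<in> I" "at t within I \<noteq> bot"
    and U: "\<And>\<tau> i. \<tau> \<in> I \<Longrightarrow> poly_on r (interior K) (\<lambda>x. U \<tau> x $ i)"
    and U': "\<And>x. x \<in> interior K \<Longrightarrow> ((\<lambda>\<tau>. U \<tau> x) has_vector_derivative U' x) (at t within I)"
  shows "((\<lambda>\<tau>. set_lebesgue_integral lebesgue K (\<lambda>x. (norm (U \<tau> x))\<^sup>2)) has_real_derivative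
    2 * set_lebesgue_integral lebesgue K (\<lambda>x. U' x \<bullet> U t x)) (at t within I)"
proof -
  obtain n :: nat and z \<phi> where n': "\<forall>j<n. z j \<in> interior K" "\<forall>j<n. real_polynomial_function (\<phi> j)"
    "\<forall>u. poly_on r (interior K) u \<longrightarrow> (\<forall>x\<in>interior K. u x = (\<Sum>j<n. u (z j) * \<phi> j x))"
    using poly_on_interpolation[of "interior K" r] .
  then have n: "\<And>j. j < n \<Longrightarrow> z j \<in> interior K" "\<And>j. j < n \<Longrightarrow> real_polynomial_function (\<phi> j)"
    by blast+
  have interp: "u x = (\<Sum>j<n. u (z j) * \<phi> j x)" if "poly_on r (interior K) u" "x \<in> interior K" for u x
    by (rule bspec[OF mp[OF spec[OF n'(3)] that(1)] that(2)])
  have eq: "U \<tau> x = (\<Sum>j<n. \<phi> j x *\<^sub>R U \<tau> (z j))" if "\<tau> \<in> I" "x \<in> interior K" for \<tau> x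
    unfolding vec_eq_iff by (intro allI trans[OF interp[OF U[OF that(1)] that(2)]]) (simp add: mult.commute)
  have inner': "((\<lambda>\<tau>. U \<tau> x \<bullet> U \<tau> y) has_real_derivative U t x \<bullet> U' y + U' x \<bullet> U t y) (at t within I)"
    if "x \<in> interior K" "y \<in> interior K" for x y
    using bounded_bilinear.has_vector_derivative[OF bounded_bilinear_inner U'[OF that(1)] U'[OF that(2)]]
    by (simp add: has_real_derivative_iff_has_vector_derivative)
  have "((\<lambda>\<tau>. set_lebesgue_integral lebesgue K (\<lambda>x. (norm (U \<tau> x))\<^sup>2)) has_real_derivative
      set_lebesgue_integral lebesgue K (\<lambda>x. 2 * (U' x \<bullet> U t x))) (at t within I)"
  proof (rule has_derivative_integral_separable[OF K, where J = "{..<n} \<times> {..<n}"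
        and a = "\<lambda>(i, j) \<tau>. U \<tau> (z i) \<bullet> U \<tau> (z j)" and \<phi> = "\<lambda>(i, j) x. \<phi> i x * \<phi> j x"
        and a' = "\<lambda>(i, j). U t (z i) \<bullet> U' (z j) + U' (z i) \<bullet> U t (z j)", OF _ _ _ _ _ t])
    show "continuous_on K ((\<lambda>(i, j) x. \<phi> i x * \<phi> j x) p)" if "p \<in> {..<n} \<times> {..<n}" for p
      using that n(2) by (auto intro!: continuous_intros real_polynomial_function_continuous)
    show "((\<lambda>(i, j) \<tau>. U \<tau> (z i) \<bullet> U \<tau> (z j)) p has_real_derivative
        (\<lambda>(i, j). U t (z i) \<bullet> U' (z j) + U' (z i) \<bullet> U t (z j)) p) (at t within I)"
      if "p \<in> {..<n} \<times> {..<n}" for p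
      using that n(1) inner' by auto
    show "(norm (U \<tau> x))\<^sup>2 = (\<Sum>p\<in>{..<n} \<times> {..<n}. (\<lambda>(i, j) \<tau>. U \<tau> (z i) \<bullet> U \<tau> (z j)) p \<tau> * (\<lambda>(i, j) x. \<phi> i x * \<phi> j x) p x)"
      if "\<tau> \<in> I" "x \<in> interior K" for \<tau> x
    proof -
      have "(norm (U \<tau> x))\<^sup>2 = (\<Sum>i<n. \<phi> i x *\<^sub>R U \<tau> (z i)) \<bullet> (\<Sum>j<n. \<phi> j x *\<^sub>R U \<tau> (z j))"
        unfolding power2_norm_eq_inner eq[OF that] ..
      also have "\<dots> = (\<Sum>i<n. \<Sum>j<n. U \<tau> (z i) \<bullet> U \<tau> (z j) * (\<phi> i x * \<phi> j x))"
        unfolding inner_sum_left inner_sum_right by (intro sum.cong refl) (simp add: inner_commute mult_ac)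
      finally show ?thesis by (simp add: sum.cartesian_product case_prod_unfold)
    qed
    show "((\<lambda>\<tau>. (norm (U \<tau> x))\<^sup>2) has_real_derivative 2 * (U' x \<bullet> U t x)) (at t within I)" if "x \<in> interior K" for x
      using inner'[OF that that] by (simp add: power2_norm_eq_inner inner_commute)
  qed simp
  then show ?thesis by simp
qed

section \<open>The energy balance\<close>

theorem lemma3p2:
  fixes Lx L\<xi> :: real
    and Tx T\<xi> :: "(real^3) set set"
    and k r :: nat
    and I :: "real set"
    and f :: "real \<Rightarrow> (real^3) \<times> (real^3) \<Rightarrow> real"
    and E B :: "real \<Rightarrow> real^3 \<Rightarrow> real^3"
  assumes "Lx > 0" and "L\<xi> > 0"
    and "is_mesh (closed_cube Lx) Tx" and "is_mesh (closed_cube L\<xi>) T\<xi>"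
    and "k \<ge> 2" and "r \<ge> 0"
    and "is_interval I" and "interior I \<noteq> {}"
    and "dg_solution Lx L\<xi> Tx T\<xi> k r I f E B"
    and "t \<in> I"
  shows "\<exists>D. ((\<lambda>\<tau>. energy Tx T\<xi> (f \<tau>) (E \<tau>) (B \<tau>)) has_real_derivative D) (at t within I) \<and>
             D + Theta2 Lx Tx (E t) (B t) + Theta3 L\<xi> Tx T\<xi> (f t) (E t) (B t) = 0"
proof -
  interpret torus_mesh Lx Tx using assms(1,3) by unfold_locales
  have body\<xi>: "convex_body M" if "M \<in> T\<xi>" for M by (rule convex_body_mesh[OF assms(4) that])
  have bodyh: "convex_body Z" if "Z \<in> product_mesh Tx T\<xi>" for Z
    using that body body\<xi> convex_body_Times by (auto simp: product_mesh_def)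
  let ?Th = "product_mesh Tx T\<xi>"
  let ?f' = "\<lambda>z. vector_derivative (\<lambda>\<tau>. f \<tau> z) (at t within I)"
  let ?E' = "\<lambda>x. vector_derivative (\<lambda>\<tau>. E \<tau> x) (at t within I)"
  let ?B' = "\<lambda>x. vector_derivative (\<lambda>\<tau>. B \<tau> x) (at t within I)"
  have t: "t \<in> I" by fact
  have nt: "at t within I \<noteq> bot"
  proof -
    \<comment> \<open>The time \<open>t\<close> may be an endpoint of \<open>I\<close>; as
      \<open>I\<close> is convex with nonempty interior, one-sided derivatives are still unique
      there.\<close>
    have "t islimpt interior I"
      using islimpt_interior_convex[OF _ assms(8) t] assms(7) by (simp add: is_interval_convex_1)
    then have "t islimpt I" using islimpt_subset interior_subset by blast
    then show ?thesis using trivial_limit_within by blast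
  qed
  have sol: "f \<tau> \<in> G_space Lx Tx T\<xi> k" "E \<tau> \<in> U_space Lx Tx r" "B \<tau> \<in> U_space Lx Tx r" if "\<tau> \<in> I" for \<tau>
    using assms(9) that unfolding dg_solution_def by blast+
  have f': "((\<lambda>\<tau>. f \<tau> z) has_real_derivative ?f' z) (at t within I)" if "Z \<in> ?Th" "z \<in> interior Z" for Z z
  proof -
    have "(\<lambda>\<tau>. f \<tau> z) differentiable (at t within I)"
      using assms(9) t that unfolding dg_solution_def by blast
    then show ?thesis unfolding has_real_derivative_iff_has_vector_derivative vector_derivative_works .
  qed
  have EB': "((\<lambda>\<tau>. E \<tau> x) has_vector_derivative ?E' x) (at t within I)"
    "((\<lambda>\<tau>. B \<tau> x) has_vector_derivative ?B' x) (at t within I)" if "K \<in> Tx" "x \<in> interior K" for K x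
  proof -
    have "(\<lambda>\<tau>. E \<tau> x) differentiable (at t within I)" "(\<lambda>\<tau>. B \<tau> x) differentiable (at t within I)"
      using assms(9) t that unfolding dg_solution_def by blast+
    then show "((\<lambda>\<tau>. E \<tau> x) has_vector_derivative ?E' x) (at t within I)"
      "((\<lambda>\<tau>. B \<tau> x) has_vector_derivative ?B' x) (at t within I)"
      unfolding vector_derivative_works .
  qed
  have "a_form Lx L\<xi> Tx T\<xi> ?f' (f t) (E t) (B t) (\<lambda>z. (norm (snd z))\<^sup>2) = 0"
    using assms(9) t G_space_norm_square[OF assms(5)] unfolding dg_solution_def by blast
  then have a: "mesh_integral ?Th (\<lambda>z. ?f' z * (norm (snd z))\<^sup>2)
      - 2 * mesh_integral Tx (\<lambda>x. current T\<xi> (f t) x \<bullet> E t x) + Theta3 L\<xi> Tx T\<xi> (f t) (E t) (B t) = 0"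
    unfolding vlasov_energy[OF assms(1-4) sol(1,2)[OF t]] .
  have "b_form Lx Tx ?E' ?B' (E t) (B t) (E t) (B t) = l_form Tx (current T\<xi> (f t)) (E t)"
    using assms(9) t sol(2,3)[OF t] unfolding dg_solution_def by blast
  then have b: "mesh_integral Tx (\<lambda>x. ?E' x \<bullet> E t x) + mesh_integral Tx (\<lambda>x. ?B' x \<bullet> B t x) + 1/2 * Theta2 Lx Tx (E t) (B t)
      = - mesh_integral Tx (\<lambda>x. current T\<xi> (f t) x \<bullet> E t x)"
    unfolding maxwell_energy[OF sol(2,3)[OF t]] l_form_def .
  have df: "((\<lambda>\<tau>. mesh_integral ?Th (\<lambda>z. f \<tau> z * (norm (snd z))\<^sup>2)) has_real_derivative
      mesh_integral ?Th (\<lambda>z. ?f' z * (norm (snd z))\<^sup>2)) (at t within I)"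
    unfolding mesh_integral_def
  proof (rule DERIV_sum)
    fix Z assume Z: "Z \<in> ?Th"
    show "((\<lambda>\<tau>. set_lebesgue_integral lebesgue Z (\<lambda>z. f \<tau> z * (norm (snd z))\<^sup>2)) has_real_derivative
        set_lebesgue_integral lebesgue Z (\<lambda>z. ?f' z * (norm (snd z))\<^sup>2)) (at t within I)"
    proof (rule has_derivative_integral_weighted[OF bodyh[OF Z] _ t nt])
      show "poly_on k (interior Z) (f \<tau>)" if "\<tau> \<in> I" for \<tau> using sol(1)[OF that] Z by (simp add: G_space_def)
    qed (auto intro!: continuous_intros f'[OF Z])
  qed
  \<comment> \<open>Stated for a generic field because it is used for both E and B.\<close>
  have dU: "((\<lambda>\<tau>. mesh_integral Tx (\<lambda>x. (norm (U \<tau> x))\<^sup>2)) has_real_derivative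
      2 * mesh_integral Tx (\<lambda>x. U' x \<bullet> U t x)) (at t within I)"
    if U: "\<And>\<tau>. \<tau> \<in> I \<Longrightarrow> U \<tau> \<in> U_space Lx Tx r"
      and U': "\<And>K x. K \<in> Tx \<Longrightarrow> x \<in> interior K \<Longrightarrow> ((\<lambda>\<tau>. U \<tau> x) has_vector_derivative U' x) (at t within I)" for U U'
    unfolding mesh_integral_def sum_distrib_left
  proof (rule DERIV_sum)
    fix K assume K: "K \<in> Tx"
    show "((\<lambda>\<tau>. set_lebesgue_integral lebesgue K (\<lambda>x. (norm (U \<tau> x))\<^sup>2)) has_real_derivative
        2 * set_lebesgue_integral lebesgue K (\<lambda>x. U' x \<bullet> U t x)) (at t within I)"
    proof (rule has_derivative_integral_norm_square[OF body[OF K] t nt])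
      show "poly_on r (interior K) (\<lambda>x. U \<tau> x $ i)" if "\<tau> \<in> I" for \<tau> i using U[OF that] K by (simp add: U_space_def)
    qed (rule U'[OF K])
  qed
  \<comment> \<open>Separating the electric from the magnetic energy uses additivity of the
    integral, hence integrability of both squared norms.\<close>
  have split: "energy Tx T\<xi> (f \<tau>) (E \<tau>) (B \<tau>) = mesh_integral ?Th (\<lambda>z. f \<tau> z * (norm (snd z))\<^sup>2)
      + (mesh_integral Tx (\<lambda>x. (norm (E \<tau> x))\<^sup>2) + mesh_integral Tx (\<lambda>x. (norm (B \<tau> x))\<^sup>2))" if \<tau>: "\<tau> \<in> I" for \<tau>
  proof -
    have int: "set_integrable lebesgue K (\<lambda>x. (norm (U x))\<^sup>2)" if U: "U \<in> U_space Lx Tx r" and K: "K \<in> Tx" for U K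
    proof -
      obtain P where P: "\<forall>i. real_polynomial_function (\<lambda>x. P x $ i)" "\<forall>x\<in>interior K. U x = P x"
        using U_space_polynomial[OF U K] .
      have "continuous_on K P" using continuous_on_polynomial_components P(1) by blast
      then have "continuous_on K (\<lambda>x. (norm (P x))\<^sup>2)" by (intro continuous_intros)
      then show ?thesis by (rule set_integrable_interior[OF body[OF K]]) (use P(2) in simp)
    qed
    show ?thesis
      unfolding energy_def mesh_integral_def sum.distrib[symmetric]
      using int[OF sol(2)[OF \<tau>]] int[OF sol(3)[OF \<tau>]]
      by (simp add: set_integral_add case_prod_unfold)
  qed
  let ?D = "mesh_integral ?Th (\<lambda>z. ?f' z * (norm (snd z))\<^sup>2)
      + (2 * mesh_integral Tx (\<lambda>x. ?E' x \<bullet> E t x) + 2 * mesh_integral Tx (\<lambda>x. ?B' x \<bullet> B t x))"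
  have dE: "((\<lambda>\<tau>. mesh_integral Tx (\<lambda>x. (norm (E \<tau> x))\<^sup>2)) has_real_derivative
      2 * mesh_integral Tx (\<lambda>x. ?E' x \<bullet> E t x)) (at t within I)"
    by (rule dU[OF sol(2) EB'(1)])
  have dB: "((\<lambda>\<tau>. mesh_integral Tx (\<lambda>x. (norm (B \<tau> x))\<^sup>2)) has_real_derivative
      2 * mesh_integral Tx (\<lambda>x. ?B' x \<bullet> B t x)) (at t within I)"
    by (rule dU[OF sol(3) EB'(2)])
  have "((\<lambda>\<tau>. energy Tx T\<xi> (f \<tau>) (E \<tau>) (B \<tau>)) has_real_derivative ?D) (at t within I)"
    using DERIV_add[OF df DERIV_add[OF dE dB]]
    by (rule has_field_derivative_transform_within[OF _ zero_less_one t]) (rule split[symmetric])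
  \<comment> \<open>Add \<open>a\<close> to twice \<open>b\<close>: the current terms cancel and
    half of \<Theta>2 becomes \<Theta>2.\<close>
  moreover have "?D + Theta2 Lx Tx (E t) (B t) + Theta3 L\<xi> Tx T\<xi> (f t) (E t) (B t) = 0"
    using a b by linarith
  ultimately show ?thesis by blast
qed

end
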